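(* Let $E$ be a completely regular Hausdorff space and let $\mathbf{T}=(T(t))_{t\ge0}$ be a semigroup on the norming dual pair $(C_b(E),\mathcal{M}_0(E))$ which is $\sigma$-continuous at $0$, where $\sigma=\sigma(C_b(E),\mathcal{M}_0(E))$. (i) If the strict topology on $C_b(E)$ is complete, then, for every $f\in C_b(E)$, the orbit $t\mapsto T(t)f$ is locally $\mathcal{M}_0(E)$-integrable. (ii) If $E$ is a complete metric space, then $\mathbf{T}$ is integrable.
   Context: A norming dual pair $(X,Y)$ consists of nontrivial (complex) Banach spaces $X,Y$ and a duality pairing (bilinear form) $\langle\cdot,\cdot\rangle:X\times Y\to\mathbb{C}$ such that $\|x\|_X=\sup\{|\langle x,y\rangle|: \|y\|_Y\le1\}$ for all $x\in X$ and $\|y\|_Y=\sup\{|\langle x,y\rangle|:\|x\|_X\le1\}$ for all $y\in Y$. Via the pairing, $X\subset Y^*$. $L(X,\sigma)$ is the algebra of $\sigma(X,Y)$-continuous linear operators on $X$ (automatically norm bounded). $C_b(E)$ is the Banach space of bounded continuous functions $f:E\to\mathbb{C}$ with the supremum norm. $\mathcal{M}_0(E)$ is the Banach space (with total variation norm) of complex Radon measures on the Borel $\sigma$-algebra $\mathcal{B}(E)$, i.e. complex measures $\mu$ with $|\mu|(A)=\sup\{|\mu|(K):K\subset A,\ K\text{ compact}\}$ for all $A\in\mathcal{B}(E)$. With $\langle f,\mu\rangle=\int_E f\,d\mu$, $(C_b(E),\mathcal{M}_0(E))$ is a norming dual pair for every completely regular Hausdorff space $E$. The strict topology on $C_b(E)$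 is the locally convex topology generated by the seminorms $f\mapsto\sup_{x\in E}|\varphi(x)f(x)|$, where $\varphi$ ranges over the bounded functions on $E$ vanishing at infinity, i.e. for every $\varepsilon>0$ there is a compact $K\subset E$ with $|\varphi|\le\varepsilon$ off $K$; its dual is $\mathcal{M}_0(E)$. A semigroup on $(X,Y)$ is a family $\mathbf{T}=(T(t))_{t\ge0}\subset L(X,\sigma)$ with $T(t+s)=T(t)T(s)$ for all $t,s\ge0$ and $T(0)=\mathrm{id}_X$. It is $\sigma$-continuous at $0$ if $T(t)x\to x$ in $\sigma(X,Y)$ as $t\downarrow0$ for every $x\in X$. It is of type $(M,\omega)$, where $M\ge1,\omega\in\mathbb{R}$, if $\|T(t)\|\le Me^{\omega t}$ for all $t\ge0$. A semigroup is integrable if it is of some type $(M,\omega)$, $t\mapsto\langle T(t)x,y\rangle$ is measurable for all $x\in X,y\in Y$, and there exist a complex number $\lambda_0$ with $\mathrm{Re}\,\lambda_0>\omega$ and $R_0\in L(X,\sigma)$ such that $\langle R_0x,y\rangle=\int_0^\infty e^{-\lambda_0t}\langle T(t)x,y\rangle\,dt$ for all $x\in X,y\in Y$. For a $\sigma$-finite measure space $(\Omega,\mathscr{F},m)$, a function $f:\Omega\to X$ is $Y$-integrable if $\omega\mapsto\langle f(\omega),y\rangle$ is integrable for every $y\in Y$ and, for every $A\in\mathscr{F}$, the functional $y\mapsto\int_A\langle f,y\rangle\,dm$ in $Y^*$ belongs to $X\subset Y^*$. A function on $[0,\infty)$ is locally $Y$-integrable if it is $Y$-integrable on every bounded interval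 in $[0,\infty)$ with respect to Lebesgue measure. *)

theory Defs
  imports "HOL-Analysis.Analysis"
begin

section \<open>Operators and semigroups on a dual pair\<close>

text \<open>
  A dual pair is given by a type \<open>'x\<close> with complex scalar multiplication \<open>smul\<close>, a set
  \<open>Y\<close> and a pairing \<open>pair :: 'x \<Rightarrow> 'y \<Rightarrow> complex\<close>; only the elements of \<open>Y\<close> count as
  functionals.
\<close>

definition weak_topology :: "'y set \<Rightarrow> ('x \<Rightarrow> 'y \<Rightarrow> complex) \<Rightarrow> 'x topology" where
  "weak_topology Y pair =
     topology_generated_by {{x. pair x y \<in> U} | y U. y \<in> Y \<and> open U}"

definition weak_operators ::
    "(complex \<Rightarrow> 'x \<Rightarrow> 'x::ab_group_add) \<Rightarrow> 'y set \<Rightarrow> ('x \<Rightarrow> 'y \<Rightarrow> complex) \<Rightarrow> ('x \<Rightarrow> 'x) set" where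
  "weak_operators smul Y pair =
     {S. Vector_Spaces.linear smul smul S \<and>
         continuous_map (weak_topology Y pair) (weak_topology Y pair) S}"

text \<open>
  A family indexed by \<open>[0,\<infinity>)\<close> is a function on all of \<^typ>\<open>real\<close> whose values at negative
  arguments are never used.
\<close>

definition operator_semigroup ::
    "(complex \<Rightarrow> 'x \<Rightarrow> 'x::ab_group_add) \<Rightarrow> 'y set \<Rightarrow> ('x \<Rightarrow> 'y \<Rightarrow> complex) \<Rightarrow>
     (real \<Rightarrow> 'x \<Rightarrow> 'x) \<Rightarrow> bool" where
  "operator_semigroup smul Y pair T \<longleftrightarrow>
     (\<forall>t\<ge>0. T t \<in> weak_operators smul Y pair) \<and>
     (\<forall>t\<ge>0. \<forall>s\<ge>0. T (t + s) = T t \<circ> T s) \<and>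
     T 0 = id"

definition weakly_continuous_at_0 ::
    "'y set \<Rightarrow> ('x \<Rightarrow> 'y \<Rightarrow> complex) \<Rightarrow> (real \<Rightarrow> 'x \<Rightarrow> 'x) \<Rightarrow> bool" where
  "weakly_continuous_at_0 Y pair T \<longleftrightarrow>
     (\<forall>x. limitin (weak_topology Y pair) (\<lambda>t. T t x) x (at_right 0))"

text \<open>
  Boundedness of the operators is stated explicitly because \<^const>\<open>onorm\<close> is a meaningful
  operator norm only for bounded operators.
\<close>

definition semigroup_type ::
    "real \<Rightarrow> real \<Rightarrow> (real \<Rightarrow> 'x \<Rightarrow> 'x::real_normed_vector) \<Rightarrow> bool" where
  "semigroup_type M \<omega> T \<longleftrightarrow>
     M \<ge> 1 \<and> (\<forall>t\<ge>0. bounded_linear (T t) \<and> onorm (T t) \<le> M * exp (\<omega> * t))"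

definition integrable_semigroup ::
    "(complex \<Rightarrow> 'x \<Rightarrow> 'x::real_normed_vector) \<Rightarrow> 'y set \<Rightarrow> ('x \<Rightarrow> 'y \<Rightarrow> complex) \<Rightarrow>
     (real \<Rightarrow> 'x \<Rightarrow> 'x) \<Rightarrow> bool" where
  "integrable_semigroup smul Y pair T \<longleftrightarrow>
     operator_semigroup smul Y pair T \<and>
     (\<exists>M \<omega>. semigroup_type M \<omega> T \<and>
        (\<forall>x. \<forall>y\<in>Y. (\<lambda>t. pair (T t x) y) \<in> borel_measurable (restrict_space borel {0..})) \<and>
        (\<exists>z\<^sub>0 :: complex. Re z\<^sub>0 > \<omega> \<and>
           (\<exists>R\<^sub>0 \<in> weak_operators smul Y pair. \<forall>x. \<forall>y\<in>Y.
              pair (R\<^sub>0 x) y =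
                (LINT t:{0..}|lborel. exp (- z\<^sub>0 * complex_of_real t) * pair (T t x) y))))"

definition Y_integrable ::
    "'y set \<Rightarrow> ('x \<Rightarrow> 'y \<Rightarrow> complex) \<Rightarrow> 'w measure \<Rightarrow> ('w \<Rightarrow> 'x) \<Rightarrow> bool" where
  "Y_integrable Y pair m f \<longleftrightarrow>
     (\<forall>y\<in>Y. integrable m (\<lambda>w. pair (f w) y)) \<and>
     (\<forall>A\<in>sets m. \<exists>x. \<forall>y\<in>Y. (LINT w:A|m. pair (f w) y) = pair x y)"

definition locally_Y_integrable ::
    "'y set \<Rightarrow> ('x \<Rightarrow> 'y \<Rightarrow> complex) \<Rightarrow> (real \<Rightarrow> 'x) \<Rightarrow> bool" where
  "locally_Y_integrable Y pair f \<longleftrightarrow>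
     (\<forall>J. is_interval J \<and> bounded J \<and> J \<subseteq> {0..} \<longrightarrow>
        Y_integrable Y pair (restrict_space lborel J) f)"


section \<open>Complex Radon measures\<close>

text \<open>
  A complex measure is a set function on the Borel sets, extended by 0 to all other sets so
  that distinct functions are distinct measures.
\<close>

definition complex_borel_measure :: "('e::topological_space set \<Rightarrow> complex) \<Rightarrow> bool" where
  "complex_borel_measure \<mu> \<longleftrightarrow>
     \<mu> {} = 0 \<and>
     (\<forall>A :: nat \<Rightarrow> 'e set. range A \<subseteq> sets borel \<and> disjoint_family A \<longrightarrow>
        (\<lambda>n. \<mu> (A n)) sums \<mu> (\<Union>n. A n)) \<and>
     (\<forall>A. A \<notin> sets borel \<longrightarrow> \<mu> A = 0)"

definition total_variation :: "('e::topological_space set \<Rightarrow> complex) \<Rightarrow> 'e set \<Rightarrow> ennreal" where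
  "total_variation \<mu> A =
     (SUP P \<in> {P. finite P \<and> partition_on A P \<and> P \<subseteq> sets borel}. ennreal (\<Sum>B\<in>P. norm (\<mu> B)))"

definition radon_measures :: "('e::t2_space set \<Rightarrow> complex) set" where
  "radon_measures =
     {\<mu>. complex_borel_measure \<mu> \<and>
         (\<forall>A\<in>sets borel.
            total_variation \<mu> A = (SUP K \<in> {K. K \<subseteq> A \<and> compact K}. total_variation \<mu> K))}"

text \<open>
  For a real measure \<open>\<nu>\<close> this is the positive part \<open>\<nu>\<^sup>+(A) = sup {\<nu>(B) | B \<subseteq> A Borel}\<close> of the Jordan
  decomposition; \<^const>\<open>ennreal\<close> truncates negative values to 0, which is harmless since \<open>B = {}\<close>
  is allowed. The negative part of \<open>\<nu>\<close> is the positive part of \<open>-\<nu>\<close>.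
\<close>

definition positive_variation :: "('e::topological_space set \<Rightarrow> real) \<Rightarrow> 'e measure" where
  "positive_variation \<nu> =
     measure_of UNIV (sets borel) (\<lambda>A. SUP B \<in> {B \<in> sets borel. B \<subseteq> A}. ennreal (\<nu> B))"

definition complex_measure_integral ::
    "('e::topological_space \<Rightarrow> complex) \<Rightarrow> ('e set \<Rightarrow> complex) \<Rightarrow> complex" where
  "complex_measure_integral f \<mu> =
     (LINT x|positive_variation (\<lambda>A. Re (\<mu> A)). f x) -
     (LINT x|positive_variation (\<lambda>A. - Re (\<mu> A)). f x) +
     \<i> * ((LINT x|positive_variation (\<lambda>A. Im (\<mu> A)). f x) -
          (LINT x|positive_variation (\<lambda>A. - Im (\<mu> A)). f x))"


section \<open>Bounded continuous functions\<close>

definition Cb_scale ::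
    "complex \<Rightarrow> ('e::topological_space \<Rightarrow>\<^sub>C complex) \<Rightarrow> ('e \<Rightarrow>\<^sub>C complex)" where
  "Cb_scale c f = Bcontfun (\<lambda>x. c * apply_bcontfun f x)"

lemma apply_Cb_scale [simp]: "apply_bcontfun (Cb_scale c f) x = c * apply_bcontfun f x"
proof -
  have "continuous_on UNIV (\<lambda>x. c * apply_bcontfun f x)"
    by (auto intro!: continuous_intros)
  moreover have "bounded ((*) c ` range (apply_bcontfun f))"
    by (intro bounded_linear_image bounded_linear_mult_right) simp
  ultimately have "(\<lambda>x. c * apply_bcontfun f x) \<in> bcontfun"
    by (simp add: bcontfun_def image_image)
  then show ?thesis
    by (simp add: Cb_scale_def Bcontfun_inverse)
qed

lemma vector_space_Cb_scale: "vector_space Cb_scale"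
  by unfold_locales (rule bcontfun_eqI, simp add: plus_bcontfun.rep_eq algebra_simps)+

definition Cb_pairing ::
    "('e::topological_space \<Rightarrow>\<^sub>C complex) \<Rightarrow> ('e set \<Rightarrow> complex) \<Rightarrow> complex" where
  "Cb_pairing f \<mu> = complex_measure_integral (apply_bcontfun f) \<mu>"


section \<open>The strict topology\<close>

definition seminorm_topology :: "('x::ab_group_add \<Rightarrow> real) set \<Rightarrow> 'x topology" where
  "seminorm_topology P =
     topology_generated_by {{g. p (g - f) < e} | p f e. p \<in> P \<and> 0 < e}"

text \<open>Completeness of a linear topology: every proper Cauchy filter converges.\<close>

definition complete_linear_topology :: "'x::ab_group_add topology \<Rightarrow> bool" where
  "complete_linear_topology \<tau> \<longleftrightarrow>
     (\<forall>F. F \<noteq> bot \<and>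
        (\<forall>U. openin \<tau> U \<and> 0 \<in> U \<longrightarrow>
           (\<exists>A. eventually (\<lambda>f. f \<in> A) F \<and> (\<forall>f\<in>A. \<forall>g\<in>A. f - g \<in> U))) \<longrightarrow>
        (\<exists>f. limitin \<tau> (\<lambda>g. g) f F))"

definition vanishing_at_infinity :: "('e::topological_space \<Rightarrow> complex) \<Rightarrow> bool" where
  "vanishing_at_infinity \<phi> \<longleftrightarrow>
     (\<forall>e>0. \<exists>K. compact K \<and> (\<forall>x. x \<notin> K \<longrightarrow> norm (\<phi> x) \<le> e))"

definition strict_topology :: "('e::topological_space \<Rightarrow>\<^sub>C complex) topology" where
  "strict_topology =
     seminorm_topology
       {\<lambda>f. SUP x. norm (\<phi> x * apply_bcontfun f x) | \<phi>.
          bounded (range \<phi>) \<and> vanishing_at_infinity \<phi>}"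

end

theory Submission
  imports Defs
begin

text \<open>
  Write \<open>g(x) = \<integral> w(t) (T(t)f)(x) dt\<close> for a weight \<open>w\<close>. By Fubini \<open>g\<close> represents the weak integral of
  the orbit as soon as it is continuous. A gliding hump argument bounds \<open>T(t)\<close> near 0, and weak
  right-continuity makes \<open>(t,x) \<mapsto> (T(t)f)(x)\<close> jointly measurable although \<open>E\<close> need not be separable.

  (i) On a compact set, whether \<open>(T(t)f)(x\<^sub>n) \<rightarrow> (T(t)f)(x)\<close> for all \<open>t\<close> is decided by the countably many
  rational \<open>t\<close>, so dominated convergence along sequences shows that \<open>g\<close> is continuous on compact sets.
  The continuous functions of norm at most \<open>2 sup|g|\<close> that agree with \<open>g\<close> on a compact \<open>K\<close>, with \<open>K\<close>
  growing, form a Cauchy filter for the strict topology, whose limit is \<open>g\<close>.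

  (ii) On a metric space \<open>g\<close> is continuous by dominated convergence. For \<open>w(t) = e\<^bsup>-\<lambda>t\<^esup>\<close> the operator
  \<open>f \<mapsto> g\<close> is weakly continuous because the mixture \<open>\<integral> w(t) T(t)'\<mu> dt\<close> is Radon: it is concentrated on
  a separable closed set, where Ulam's theorem applies.
\<close>

section \<open>Complex measures and their integrals\<close>

text \<open>The orbit is only weakly right-continuous, so the integral is formed pointwise in x and
  must then be recognised as an element of C_b(E). The crux is continuity of g: dominated
  convergence works along sequences, while E need not be sequential. In (ii) the operator must also
  be weakly continuous, so its adjoint must send Radon measures to Radon measures and not merely to
  elements of the dual of C_b(E). New measures are not defined set by set but as functionals on
  bounded Borel functions that respect bounded pointwise convergence. Sums, Dirac series and
  mixtures then reduce to convergence theorems, and the Radon property to a bound on \<mu>(B) for B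
  in A - K. The gliding hump is used twice: with point evaluations, where the bad series is a Radon
  measure and weak boundedness gives norm boundedness; and with functions of the unit ball, where it
  is an element of C_b(E) and pointwise bounded operators become uniformly bounded.\<close>

definition sigma_additive :: "('e::topological_space set \<Rightarrow> 'b::real_normed_vector) \<Rightarrow> bool" where
  "sigma_additive \<nu> \<longleftrightarrow> \<nu> {} = 0 \<and>
     (\<forall>A :: nat \<Rightarrow> 'e set. range A \<subseteq> sets borel \<and> disjoint_family A \<longrightarrow>
        (\<lambda>n. \<nu> (A n)) sums \<nu> (\<Union>n. A n))"

lemma sigma_additive_Un:
  assumes "sigma_additive \<nu>" "A \<in> sets borel" "B \<in> sets borel" "A \<inter> B = {}"
  shows "\<nu> (A \<union> B) = \<nu> A + \<nu> B"
proof -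
  have "disjoint_family (binaryset A B)"
    using assms(4) by (auto simp: disjoint_family_on_def binaryset_def)
  moreover have "range (binaryset A B) \<subseteq> sets borel"
    using assms by (auto simp: range_binaryset_eq)
  ultimately have "(\<lambda>n. \<nu> (binaryset A B n)) sums \<nu> (\<Union>n. binaryset A B n)"
    using assms(1) by (auto simp: sigma_additive_def)
  moreover have "(\<lambda>n. \<nu> (binaryset A B n)) sums (\<nu> A + \<nu> B)"
    using assms(1) by (intro binaryset_sums) (auto simp: sigma_additive_def)
  ultimately show ?thesis
    by (simp add: UN_binaryset_eq sums_unique2)
qed

lemma sigma_additive_Diff:
  assumes "sigma_additive \<nu>" "A \<in> sets borel" "B \<in> sets borel" "B \<subseteq> A"
  shows "\<nu> (A - B) = \<nu> A - \<nu> B"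
proof -
  have "\<nu> (B \<union> (A - B)) = \<nu> B + \<nu> (A - B)"
    using assms by (intro sigma_additive_Un) auto
  moreover have "B \<union> (A - B) = A" using assms by auto
  ultimately show ?thesis by simp
qed

lemma sigma_additive_split:
  assumes "sigma_additive \<nu>" "A \<in> sets borel" "B \<in> sets borel"
  shows "\<nu> A = \<nu> (A \<inter> B) + \<nu> (A - B)"
  using sigma_additive_Un[OF assms(1), of "A \<inter> B" "A - B"] assms
  by (simp add: Int_Diff_disjoint Int_Diff_Un)

lemma sigma_additive_finite_UN:
  assumes "sigma_additive \<nu>" "finite I" "\<And>i. i \<in> I \<Longrightarrow> B i \<in> sets borel" "disjoint_family_on B I"
  shows "\<nu> (\<Union>i\<in>I. B i) = (\<Sum>i\<in>I. \<nu> (B i))"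
  using assms(2,3,4)
proof (induction I)
  case empty
  then show ?case using assms(1) by (simp add: sigma_additive_def)
next
  case (insert i I)
  have "\<nu> (B i \<union> (\<Union>i\<in>I. B i)) = \<nu> (B i) + \<nu> (\<Union>i\<in>I. B i)"
  proof (rule sigma_additive_Un[OF assms(1)])
    show "B i \<inter> (\<Union>i\<in>I. B i) = {}"
      using insert.prems(2) insert.hyps(2) by (auto simp: disjoint_family_on_def)
    show "B i \<in> sets borel" "(\<Union>i\<in>I. B i) \<in> sets borel"
      using insert.prems(1) insert.hyps(1) by auto
  qed
  moreover have "\<nu> (\<Union>i\<in>I. B i) = (\<Sum>i\<in>I. \<nu> (B i))"
    using insert by (auto simp: disjoint_family_on_def)
  ultimately show ?case
    using insert by simp
qed

text \<open>If the values were unbounded, a set with unboundedly large values on subsets could be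
  shrunk to one of the same kind while cutting off a piece of norm at least 1. Infinitely many such
  disjoint pieces contradict convergence of the series.\<close>

lemma sigma_additive_bounded:
  assumes "sigma_additive \<nu>"
  shows "\<exists>C. \<forall>A\<in>sets borel. norm (\<nu> A) \<le> C"
proof (rule ccontr)
  assume unb: "\<nexists>C. \<forall>A\<in>sets borel. norm (\<nu> A) \<le> C"
  define big where
    "big A \<longleftrightarrow> A \<in> sets borel \<and> (\<forall>C. \<exists>B\<in>sets borel. B \<subseteq> A \<and> norm (\<nu> B) > C)" for A
  have step: "\<exists>B. big B \<and> B \<subseteq> A \<and> norm (\<nu> (A - B)) \<ge> 1" if "big A" for A
  proof -
    have A: "A \<in> sets borel" using that by (simp add: big_def)
    have large: "\<And>C. \<exists>B\<in>sets borel. B \<subseteq> A \<and> norm (\<nu> B) > C"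
      using that by (simp add: big_def)
    \<comment> \<open>The margin \<open>norm (\<nu> A) + 1\<close> gives both D and A - D a value of
      norm at least 1, so either of them may be the piece that is cut off.\<close>
    from large[of "norm (\<nu> A) + 1"]
    obtain D where D: "D \<in> sets borel" "D \<subseteq> A" "norm (\<nu> D) > norm (\<nu> A) + 1"
      by blast
    have AD: "norm (\<nu> (A - D)) \<ge> 1"
      using sigma_additive_Diff[OF assms A D(1,2)] D(3) norm_triangle_ineq2[of "\<nu> D" "\<nu> A"]
      by (simp add: norm_minus_commute)
    have D1: "norm (\<nu> D) \<ge> 1"
      using D(3) norm_ge_zero[of "\<nu> A"] by linarith
    have "big D \<or> big (A - D)"
    proof (rule ccontr)
      assume "\<not> (big D \<or> big (A - D))"
      then have "\<exists>C. \<forall>B\<in>sets borel. B \<subseteq> D \<longrightarrow> norm (\<nu> B) \<le> C"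
        "\<exists>C. \<forall>B\<in>sets borel. B \<subseteq> A - D \<longrightarrow> norm (\<nu> B) \<le> C"
        using A D(1) by (simp_all add: big_def not_less)
      then obtain C1 C2 where
        C: "\<forall>B\<in>sets borel. B \<subseteq> D \<longrightarrow> norm (\<nu> B) \<le> C1"
           "\<forall>B\<in>sets borel. B \<subseteq> A - D \<longrightarrow> norm (\<nu> B) \<le> C2"
        by blast
      from large[of "C1 + C2"]
      obtain B where B: "B \<in> sets borel" "B \<subseteq> A" "norm (\<nu> B) > C1 + C2"
        by blast
      have "\<nu> B = \<nu> (B \<inter> D) + \<nu> (B - D)"
        using sigma_additive_split assms B D by blast
      moreover have "norm (\<nu> (B \<inter> D)) \<le> C1" "norm (\<nu> (B - D)) \<le> C2"
        using B D C(1)[rule_format, of "B \<inter> D"] C(2)[rule_format, of "B - D"] by auto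
      ultimately show False
        using B(3) norm_triangle_ineq[of "\<nu> (B \<inter> D)" "\<nu> (B - D)"] by simp
    qed
    then show ?thesis
    proof
      assume "big D"
      then show ?thesis using D AD by blast
    next
      assume "big (A - D)"
      moreover have "A - (A - D) = D" using D by auto
      ultimately show ?thesis using D1 by (intro exI[of _ "A - D"]) auto
    qed
  qed
  have "big UNIV"
    unfolding big_def using unb by (auto simp: not_le)
  then have "\<exists>B. \<forall>n. big (B n) \<and> B (Suc n) \<subseteq> B n \<and> norm (\<nu> (B n - B (Suc n))) \<ge> 1"
    using step by (intro dependent_nat_choice) auto
  then obtain B where B: "\<And>n. big (B n)" "\<And>n. B (Suc n) \<subseteq> B n"
    "\<And>n. norm (\<nu> (B n - B (Suc n))) \<ge> 1"
    by blast
  have "disjoint_family (\<lambda>n. B n - B (Suc n))"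
    using B(2) disjoint_family_Suc[of "\<lambda>n. - B n"]
    by (simp add: Diff_eq Int_commute)
  moreover have "range (\<lambda>n. B n - B (Suc n)) \<subseteq> sets borel"
    using B(1) by (auto simp: big_def)
  ultimately have "(\<lambda>n. \<nu> (B n - B (Suc n))) sums \<nu> (\<Union>n. B n - B (Suc n))"
    using assms unfolding sigma_additive_def by blast
  then have "(\<lambda>n. \<nu> (B n - B (Suc n))) \<longlonglongrightarrow> 0"
    by (intro summable_LIMSEQ_zero) (rule sums_summable)
  then have "\<forall>\<^sub>F n in sequentially. norm (\<nu> (B n - B (Suc n))) < 1"
    by (simp add: tendsto_iff dist_norm)
  then obtain n where "norm (\<nu> (B n - B (Suc n))) < 1"
    by (auto simp: eventually_sequentially)
  then show False using B(3)[of n] by simp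
qed

lemma sigma_additive_uminus:
  "sigma_additive \<nu> \<Longrightarrow> sigma_additive (\<lambda>A. - \<nu> A)"
  by (auto simp: sigma_additive_def intro: sums_minus)

lemma sets_positive_variation [simp, measurable_cong]: "sets (positive_variation \<nu>) = sets borel"
  and space_positive_variation [simp]: "space (positive_variation \<nu>) = UNIV"
proof -
  have "sigma_sets UNIV (sets borel) = sets (borel :: 'a measure)"
    by (metis sets.sigma_sets_eq space_borel)
  then show "sets (positive_variation \<nu>) = sets borel" "space (positive_variation \<nu>) = UNIV"
    by (simp_all add: positive_variation_def)
qed

text \<open>\<open>measure_of\<close> takes over the given set function only if it is countably
  additive, and this has to be checked. One inequality is superadditivity, from disjoint unions of
  competitors; the other cuts a competitor along the sets A i.\<close>

lemma emeasure_positive_variation: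
  fixes \<nu> :: "'e::topological_space set \<Rightarrow> real"
  assumes "sigma_additive \<nu>" "A \<in> sets borel"
  shows "emeasure (positive_variation \<nu>) A = (SUP B \<in> {B \<in> sets borel. B \<subseteq> A}. ennreal (\<nu> B))"
proof (rule emeasure_measure_of[OF positive_variation_def])
  let ?P = "\<lambda>A. SUP B \<in> {B \<in> sets borel. B \<subseteq> A}. ennreal (\<nu> B)"
  have nonempty: "{B \<in> sets borel. B \<subseteq> A} \<noteq> {}" for A :: "'e set" by auto
  show "sets borel \<subseteq> Pow (UNIV :: 'e set)" by simp
  show "A \<in> sets (positive_variation \<nu>)" using assms by simp
  have "?P {} = ennreal (\<nu> {})"
    by (rule SUP_eq_const) auto
  then show "positive (sets (positive_variation \<nu>)) ?P"
    using assms by (simp add: positive_def sigma_additive_def)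
  have P2: "?P A + ?P B \<le> ?P (A \<union> B)"
    if "A \<inter> B = {}" for A B :: "'e set"
  proof -
    \<comment> \<open>If one of the two values is negative, its truncation is 0 and the other set
      alone is a sufficient competitor.\<close>
    have *: "ennreal (\<nu> C) + ennreal (\<nu> D) \<le> ?P (A \<union> B)"
      if "C \<in> sets borel" "D \<in> sets borel" "C \<subseteq> A" "D \<subseteq> B" for C D
    proof -
      have "ennreal (\<nu> C) \<le> ?P (A \<union> B)" "ennreal (\<nu> D) \<le> ?P (A \<union> B)"
           "ennreal (\<nu> (C \<union> D)) \<le> ?P (A \<union> B)"
        using that by (auto intro!: SUP_upper)
      moreover have "\<nu> (C \<union> D) = \<nu> C + \<nu> D"
        using that \<open>A \<inter> B = {}\<close> by (intro sigma_additive_Un assms) auto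
      ultimately show ?thesis
        by (cases "\<nu> C \<ge> 0"; cases "\<nu> D \<ge> 0") (auto simp: ennreal_plus[symmetric] ennreal_neg simp del: ennreal_plus)
    qed
    have "?P A + ?P B = (SUP C \<in> {C \<in> sets borel. C \<subseteq> A}. ennreal (\<nu> C) + ?P B)"
      by (simp add: ennreal_SUP_add_left[OF nonempty])
    also have "\<dots> = (SUP C \<in> {C \<in> sets borel. C \<subseteq> A}. SUP D \<in> {D \<in> sets borel. D \<subseteq> B}. ennreal (\<nu> C) + ennreal (\<nu> D))"
      by (simp add: ennreal_SUP_add_right[OF nonempty])
    also have "\<dots> \<le> ?P (A \<union> B)"
      using * by (intro SUP_least) auto
    finally show ?thesis .
  qed
  show "countably_additive (sets (positive_variation \<nu>)) ?P"
  proof (rule countably_additiveI)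
    fix A :: "nat \<Rightarrow> 'e set"
    assume A: "range A \<subseteq> sets (positive_variation \<nu>)" "disjoint_family A"
    show "(\<Sum>i. ?P (A i)) = ?P (\<Union>i. A i)"
    proof (rule antisym)
      have fin: "(\<Sum>i<n. ?P (A i)) \<le> ?P (\<Union>i<n. A i)" for n
      proof (induction n)
        case (Suc n)
        have "(\<Sum>i<Suc n. ?P (A i)) \<le> ?P (\<Union>i<n. A i) + ?P (A n)"
          using Suc by (simp add: add_right_mono)
        also have "\<dots> \<le> ?P ((\<Union>i<n. A i) \<union> A n)"
        proof (rule P2)
          show "(\<Union>i<n. A i) \<inter> A n = {}"
            using A(2) by (auto simp: disjoint_family_on_def) (metis less_irrefl disjoint_iff)
        qed
        finally show ?case by (simp add: lessThan_Suc Un_commute)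
      qed simp
      have "(\<Sum>i<n. ?P (A i)) \<le> ?P (\<Union>i. A i)" for n
        by (rule order_trans[OF fin]) (rule SUP_subset_mono, auto)
      then show "(\<Sum>i. ?P (A i)) \<le> ?P (\<Union>i. A i)"
        by (intro suminf_le_const) auto
    next
      show "?P (\<Union>i. A i) \<le> (\<Sum>i. ?P (A i))"
      proof (rule SUP_least, clarify)
        fix B :: "'e set" assume B: "B \<in> sets borel" "B \<subseteq> (\<Union>i. A i)"
        have "range (\<lambda>i. B \<inter> A i) \<subseteq> sets borel" "disjoint_family (\<lambda>i. B \<inter> A i)"
          using A B by (auto simp: disjoint_family_on_def)
        then have "(\<lambda>i. \<nu> (B \<inter> A i)) sums \<nu> (\<Union>i. B \<inter> A i)"
          using assms(1) unfolding sigma_additive_def by blast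
        moreover have "(\<Union>i. B \<inter> A i) = B" using B by auto
        ultimately have "(\<lambda>n. \<Sum>i<n. \<nu> (B \<inter> A i)) \<longlonglongrightarrow> \<nu> B"
          by (simp add: sums_def)
        then have lim: "(\<lambda>n. ennreal (\<Sum>i<n. \<nu> (B \<inter> A i))) \<longlonglongrightarrow> ennreal (\<nu> B)"
          by (rule tendsto_ennrealI)
        have "ennreal (\<Sum>i<n. \<nu> (B \<inter> A i)) \<le> (\<Sum>i. ?P (A i))" for n
        proof -
          \<comment> \<open>Negative terms are first replaced by 0, because \<open>ennreal\<close>
            respects sums only of nonnegative reals.\<close>
          have "ennreal (\<Sum>i<n. \<nu> (B \<inter> A i)) \<le> ennreal (\<Sum>i<n. max 0 (\<nu> (B \<inter> A i)))"
            by (intro ennreal_leI sum_mono) auto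
          also have "\<dots> = (\<Sum>i<n. ennreal (max 0 (\<nu> (B \<inter> A i))))"
            by simp
          also have "\<dots> = (\<Sum>i<n. ennreal (\<nu> (B \<inter> A i)))"
            by (intro sum.cong) (auto simp: max_def ennreal_neg)
          also have "\<dots> \<le> (\<Sum>i<n. ?P (A i))"
            using A B by (intro sum_mono SUP_upper) auto
          also have "\<dots> \<le> (\<Sum>i. ?P (A i))"
            by (rule sum_le_suminf) auto
          finally show ?thesis .
        qed
        then show "ennreal (\<nu> B) \<le> (\<Sum>i. ?P (A i))"
          by (intro LIMSEQ_le_const2[OF lim]) auto
      qed
    qed
  qed
qed

lemma finite_positive_variation:
  assumes "sigma_additive \<nu>"
  shows "finite_measure (positive_variation \<nu>)"
proof (rule finite_measureI)
  obtain C where C: "\<And>A. A \<in> sets borel \<Longrightarrow> norm (\<nu> A) \<le> C"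
    using sigma_additive_bounded[OF assms] by blast
  have "emeasure (positive_variation \<nu>) UNIV \<le> ennreal C"
    using C by (subst emeasure_positive_variation[OF assms])
      (auto intro!: SUP_least ennreal_leI dest: abs_le_D1)
  then show "emeasure (positive_variation \<nu>) (space (positive_variation \<nu>)) \<noteq> \<infinity>"
    by (auto simp: top_unique)
qed

lemma positive_variation_upper:
  assumes "sigma_additive \<nu>" "A \<in> sets borel" "B \<in> sets borel" "B \<subseteq> A"
  shows "\<nu> B \<le> measure (positive_variation \<nu>) A"
proof -
  interpret finite_measure "positive_variation \<nu>"
    by (rule finite_positive_variation[OF assms(1)])
  have "ennreal (\<nu> B) \<le> emeasure (positive_variation \<nu>) A"
    using assms by (subst emeasure_positive_variation) (auto intro!: SUP_upper)
  then show ?thesis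
    by (simp add: emeasure_eq_measure)
qed

lemma positive_variation_least:
  assumes "sigma_additive \<nu>" "A \<in> sets borel" "\<And>B. B \<in> sets borel \<Longrightarrow> B \<subseteq> A \<Longrightarrow> \<nu> B \<le> C"
  shows "measure (positive_variation \<nu>) A \<le> C"
proof -
  interpret finite_measure "positive_variation \<nu>"
    by (rule finite_positive_variation[OF assms(1)])
  have "0 \<le> C" using assms(3)[of "{}"] assms(1) by (simp add: sigma_additive_def)
  have "emeasure (positive_variation \<nu>) A \<le> ennreal C"
    using assms by (subst emeasure_positive_variation) (auto intro!: SUP_least ennreal_leI)
  then show ?thesis
    using \<open>0 \<le> C\<close> by (simp add: emeasure_eq_measure)
qed

text \<open>For B inside A, \<nu> B = \<nu> A - \<nu> (A - B), and - \<nu> (A - B) is at most the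
  negative variation of A. The supremum over B gives one inequality; the same argument for - \<nu>
  gives the other.\<close>

lemma jordan_decomposition:
  assumes "sigma_additive \<nu>" "A \<in> sets borel"
  shows "measure (positive_variation \<nu>) A - measure (positive_variation (\<lambda>A. - \<nu> A)) A = \<nu> A"
proof -
  note m = sigma_additive_uminus[OF assms(1)]
  have "measure (positive_variation \<nu>) A \<le> \<nu> A + measure (positive_variation (\<lambda>A. - \<nu> A)) A"
  proof (rule positive_variation_least[OF assms])
    fix B assume B: "B \<in> sets borel" "B \<subseteq> A"
    show "\<nu> B \<le> \<nu> A + measure (positive_variation (\<lambda>A. - \<nu> A)) A"
      using positive_variation_upper[OF m assms(2), of "A - B"]
        sigma_additive_Diff[OF assms B] B assms by auto
  qed
  moreover have "measure (positive_variation (\<lambda>A. - \<nu> A)) A \<le> measure (positive_variation \<nu>) A - \<nu> A"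
  proof (rule positive_variation_least[OF m assms(2)])
    fix B assume B: "B \<in> sets borel" "B \<subseteq> A"
    show "- \<nu> B \<le> measure (positive_variation \<nu>) A - \<nu> A"
      using positive_variation_upper[OF assms, of "A - B"]
        sigma_additive_Diff[OF assms B] B assms by auto
  qed
  ultimately show ?thesis by linarith
qed

lemma complex_measureD:
  assumes "complex_borel_measure \<mu>"
  shows "sigma_additive \<mu>" "sigma_additive (\<lambda>A. Re (\<mu> A))" "sigma_additive (\<lambda>A. Im (\<mu> A))"
    "sigma_additive (\<lambda>A. - Re (\<mu> A))" "sigma_additive (\<lambda>A. - Im (\<mu> A))"
proof -
  show 1: "sigma_additive \<mu>"
    using assms by (auto simp: sigma_additive_def complex_borel_measure_def)
  show "sigma_additive (\<lambda>A. Re (\<mu> A))" "sigma_additive (\<lambda>A. Im (\<mu> A))"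
    using 1 by (auto simp: sigma_additive_def intro: bounded_linear.sums bounded_linear_Re bounded_linear_Im)
  then show "sigma_additive (\<lambda>A. - Re (\<mu> A))" "sigma_additive (\<lambda>A. - Im (\<mu> A))"
    by (auto intro: sigma_additive_uminus)
qed

section \<open>Bounded Borel functions and functionals on them\<close>

definition bounded_borel :: "('e::topological_space \<Rightarrow> complex) set" where
  "bounded_borel = {f \<in> borel_measurable borel. bounded (range f)}"

lemma bounded_borelI:
  "f \<in> borel_measurable borel \<Longrightarrow> (\<And>x. norm (f x) \<le> C) \<Longrightarrow> f \<in> bounded_borel"
  by (auto simp: bounded_borel_def bounded_iff)

lemma bounded_borelD:
  assumes "f \<in> bounded_borel"
  shows "f \<in> borel_measurable borel" "\<exists>C. \<forall>x. norm (f x) \<le> C"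
  using assms by (auto simp: bounded_borel_def bounded_iff)

lemma bounded_borel_closed [intro]:
  fixes f g :: "'e::topological_space \<Rightarrow> complex"
  shows "f \<in> bounded_borel \<Longrightarrow> g \<in> bounded_borel \<Longrightarrow> (\<lambda>x. f x + g x) \<in> bounded_borel"
    "f \<in> bounded_borel \<Longrightarrow> (\<lambda>x. c * f x) \<in> bounded_borel"
    "A \<in> sets borel \<Longrightarrow> (\<lambda>x. indicator A x) \<in> bounded_borel"
    "(\<lambda>x. c) \<in> bounded_borel"
proof -
  show "(\<lambda>x. f x + g x) \<in> bounded_borel" if "f \<in> bounded_borel" "g \<in> bounded_borel"
  proof -
    obtain C where "f \<in> borel_measurable borel" "\<And>x. norm (f x) \<le> C"
      using bounded_borelD \<open>f \<in> bounded_borel\<close> by blast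
    moreover obtain D where "g \<in> borel_measurable borel" "\<And>x. norm (g x) \<le> D"
      using bounded_borelD \<open>g \<in> bounded_borel\<close> by blast
    ultimately show ?thesis
      by (intro bounded_borelI[of _ "C + D"]) (auto intro!: norm_triangle_le add_mono)
  qed
  show "(\<lambda>x. c * f x) \<in> bounded_borel" if "f \<in> bounded_borel"
  proof -
    obtain C where "f \<in> borel_measurable borel" "\<And>x. norm (f x) \<le> C"
      using bounded_borelD \<open>f \<in> bounded_borel\<close> by blast
    then show ?thesis
      by (intro bounded_borelI[of _ "norm c * C"]) (auto simp: norm_mult intro!: mult_left_mono)
  qed
  show "(\<lambda>x. indicator A x) \<in> bounded_borel" if "A \<in> sets borel"
    using that by (intro bounded_borelI[of _ 1]) (auto simp: indicator_def)
  show "(\<lambda>x. c) \<in> bounded_borel"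
    by (intro bounded_borelI[of _ "norm c"]) auto
qed

lemma integrable_bounded_borel:
  assumes "sigma_additive \<nu>" "f \<in> bounded_borel"
  shows "integrable (positive_variation \<nu>) f"
proof -
  interpret finite_measure "positive_variation \<nu>"
    by (rule finite_positive_variation[OF assms(1)])
  obtain C where "f \<in> borel_measurable borel" "\<And>x. norm (f x) \<le> C"
    using bounded_borelD assms(2) by blast
  then show ?thesis by (intro integrable_const_bound[of _ C]) auto
qed

text \<open>
  Linear functionals on the bounded Borel functions that respect bounded pointwise convergence
  are the same thing as complex measures.
\<close>

definition normal_functional :: "(('e::topological_space \<Rightarrow> complex) \<Rightarrow> complex) \<Rightarrow> bool" where
  "normal_functional L \<longleftrightarrow>
     (\<forall>f\<in>bounded_borel. \<forall>g\<in>bounded_borel. L (\<lambda>x. f x + g x) = L f + L g) \<and>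
     (\<forall>f\<in>bounded_borel. \<forall>c. L (\<lambda>x. c * f x) = c * L f) \<and>
     (\<forall>F f C. (\<forall>n. F n \<in> borel_measurable borel) \<longrightarrow> (\<forall>n x. norm (F n x) \<le> C) \<longrightarrow>
        (\<forall>x. (\<lambda>n. F n x) \<longlonglongrightarrow> f x) \<longrightarrow> (\<lambda>n. L (F n)) \<longlonglongrightarrow> L f)"

text \<open>The value 0 off the Borel sets is the normalisation required by
  \<open>complex_borel_measure\<close>.\<close>

definition functional_measure ::
    "(('e::topological_space \<Rightarrow> complex) \<Rightarrow> complex) \<Rightarrow> 'e set \<Rightarrow> complex" where
  "functional_measure L A = (if A \<in> sets borel then L (indicator A) else 0)"

lemma normal_functionalD:
  assumes "normal_functional L"
  shows "f \<in> bounded_borel \<Longrightarrow> g \<in> bounded_borel \<Longrightarrow> L (\<lambda>x. f x + g x) = L f + L g"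
    "f \<in> bounded_borel \<Longrightarrow> L (\<lambda>x. c * f x) = c * L f"
    "(\<And>n. F n \<in> borel_measurable borel) \<Longrightarrow> (\<And>n x. norm (F n x) \<le> C) \<Longrightarrow>
        (\<And>x. (\<lambda>n. F n x) \<longlonglongrightarrow> h x) \<Longrightarrow> (\<lambda>n. L (F n)) \<longlonglongrightarrow> L h"
  using assms unfolding normal_functional_def by blast+

lemma normal_functional_zero:
  assumes "normal_functional L" shows "L (\<lambda>x. 0) = 0"
  using normal_functionalD(2)[OF assms, of "\<lambda>x. 0" 0] by auto

lemma normal_functional_sum:
  assumes "normal_functional L" "finite I" "\<And>i. i \<in> I \<Longrightarrow> f i \<in> bounded_borel"
  shows "(\<lambda>x. \<Sum>i\<in>I. f i x) \<in> bounded_borel \<and> L (\<lambda>x. \<Sum>i\<in>I. f i x) = (\<Sum>i\<in>I. L (f i))"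
  using assms(2,3)
proof (induction I)
  case empty
  then show ?case by (auto simp: normal_functional_zero[OF assms(1)])
next
  case (insert i I)
  then show ?case
    using normal_functionalD(1)[OF assms(1), of "f i" "\<lambda>x. \<Sum>i\<in>I. f i x"] by auto
qed

lemma normal_functional_integral:
  assumes "complex_borel_measure \<mu>"
  shows "normal_functional (\<lambda>f. complex_measure_integral f \<mu>)"
  unfolding normal_functional_def
proof (intro conjI ballI allI impI)
  note sa = complex_measureD(2-5)[OF assms]
  note int = sa[THEN integrable_bounded_borel]
  show "complex_measure_integral (\<lambda>x. f x + g x) \<mu> =
      complex_measure_integral f \<mu> + complex_measure_integral g \<mu>"
    if "f \<in> bounded_borel" "g \<in> bounded_borel" for f g
    using that by (simp add: complex_measure_integral_def int algebra_simps)
  show "complex_measure_integral (\<lambda>x. c * f x) \<mu> = c * complex_measure_integral f \<mu>"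
    if "f \<in> bounded_borel" for f c
    using that by (simp add: complex_measure_integral_def int algebra_simps)
  fix F :: "nat \<Rightarrow> 'a \<Rightarrow> complex" and f C
  assume F: "\<forall>n. F n \<in> borel_measurable borel" "\<forall>n x. norm (F n x) \<le> C"
    "\<forall>x. (\<lambda>n. F n x) \<longlonglongrightarrow> f x"
  have f: "f \<in> borel_measurable borel"
    using F by (auto intro: borel_measurable_LIMSEQ_metric)
  have "(\<lambda>n. LINT x|positive_variation \<nu>. F n x) \<longlonglongrightarrow> (LINT x|positive_variation \<nu>. f x)"
    if "sigma_additive \<nu>" for \<nu>
  proof (rule integral_dominated_convergence[where w="\<lambda>x. C"])
    interpret finite_measure "positive_variation \<nu>"
      by (rule finite_positive_variation[OF that])
    show "integrable (positive_variation \<nu>) (\<lambda>x. C)" by simp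
  qed (use F f in \<open>auto simp: measurable_cong_sets[OF sets_positive_variation refl]\<close>)
  then show "(\<lambda>n. complex_measure_integral (F n) \<mu>) \<longlonglongrightarrow> complex_measure_integral f \<mu>"

    unfolding complex_measure_integral_def by (intro tendsto_intros) (simp_all add: sa)
qed

text \<open>The Jordan decomposition recombines the four integrals into real and imaginary part of
  \<mu> A.\<close>

lemma integral_complex_indicator:
  assumes "complex_borel_measure \<mu>" "A \<in> sets borel"
  shows "complex_measure_integral (indicator A) \<mu> = \<mu> A"
proof -
  note sa = complex_measureD(2,3)[OF assms(1)]
  have "(LINT x|positive_variation \<nu>. (indicator A x :: complex)) = measure (positive_variation \<nu>) A"
    if "sigma_additive \<nu>" for \<nu>
  proof -
    interpret finite_measure "positive_variation \<nu>"
      by (rule finite_positive_variation[OF that])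
    have "(indicator A x :: complex) = of_real (indicator A x)" for x
      by (simp add: indicator_def)
    then show ?thesis by (simp add: assms)
  qed
  note I = this[OF sa(1)] this[OF sa(2)] this[OF sigma_additive_uminus[OF sa(1)]]
    this[OF sigma_additive_uminus[OF sa(2)]]
  show ?thesis
    using jordan_decomposition[OF sa(1) assms(2)] jordan_decomposition[OF sa(2) assms(2)]
    by (simp add: complex_measure_integral_def I complex_eq_iff)
qed

lemma bounded_borel_sum:
  fixes f :: "'i \<Rightarrow> 'e::topological_space \<Rightarrow> complex"
  assumes "finite I" "\<And>i. i \<in> I \<Longrightarrow> f i \<in> bounded_borel"
  shows "(\<lambda>x. \<Sum>i\<in>I. f i x) \<in> bounded_borel"
  using assms by (induction I) auto

text \<open>Simple functions converge to f pointwise with norm at most twice that of f. One constant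
  therefore bounds them all, and the limit case may be restricted to the bounded convergence that
  \<open>normal_functional\<close> respects.\<close>

lemma bounded_borel_induct [consumes 1, case_names indicator add scale lim]:
  fixes f :: "'e::topological_space \<Rightarrow> complex"
  assumes f: "f \<in> bounded_borel"
    and ind: "\<And>A. A \<in> sets borel \<Longrightarrow> P (indicator A)"
    and add: "\<And>f g. f \<in> bounded_borel \<Longrightarrow> g \<in> bounded_borel \<Longrightarrow> P f \<Longrightarrow> P g \<Longrightarrow> P (\<lambda>x. f x + g x)"
    and scale: "\<And>f c. f \<in> bounded_borel \<Longrightarrow> P f \<Longrightarrow> P (\<lambda>x. c * f x)"
    and lim: "\<And>F f C. (\<And>n. F n \<in> borel_measurable borel) \<Longrightarrow> (\<And>n x. norm (F n x) \<le> C) \<Longrightarrow>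
      (\<And>x. (\<lambda>n. F n x) \<longlonglongrightarrow> f x) \<Longrightarrow> (\<And>n. P (F n)) \<Longrightarrow> P f"
  shows "P f"
proof -
  obtain C where C: "f \<in> borel_measurable borel" "\<And>x. norm (f x) \<le> C"
    using bounded_borelD f by blast
  obtain F where F: "\<And>n. simple_function borel (F n)" "\<And>x. (\<lambda>n. F n x) \<longlonglongrightarrow> f x"
    "\<And>n x. dist (F n x) 0 \<le> 2 * dist (f x) 0"
    using borel_measurable_implies_sequence_metric[OF C(1), of 0] by auto
  have bd: "norm (F n x) \<le> 2 * C" for n x
    using F(3)[of n x] C(2)[of x] by simp
  have "P (F n)" for n
  proof -
    define R where "R = range (F n)"
    have R: "finite R" using F(1)[of n] by (simp add: simple_function_def R_def)
    have m: "F n -` {y} \<in> sets borel" for y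
      using F(1)[of n] borel_measurable_simple_function measurable_sets[of "F n" borel borel "{y}"] by auto
    have trm: "(\<lambda>x. y * indicator (F n -` {y}) x) \<in> bounded_borel"
      "P (\<lambda>x. y * indicator (F n -` {y}) x)" for y
      using m by (auto intro!: scale ind)
    have Fn: "F n = (\<lambda>x. \<Sum>y\<in>R. y * indicator (F n -` {y}) x)"
    proof
      fix x
      have "(\<Sum>y\<in>R. y * indicator (F n -` {y}) x) = (\<Sum>y\<in>R. if F n x = y then y else 0)"
        by (intro sum.cong) (auto simp: indicator_def)
      also have "\<dots> = F n x" using R by (simp add: sum.delta R_def)
      finally show "F n x = (\<Sum>y\<in>R. y * indicator (F n -` {y}) x)" by simp
    qed
    have zero: "P (\<lambda>x. 0)" using ind[of "{}"] by (simp add: indicator_def[abs_def])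
    have "P (\<lambda>x. \<Sum>y\<in>Q. y * indicator (F n -` {y}) x)" if "finite Q" for Q
      using that
    proof induction
      case (insert z Q)
      then show ?case
        using add[OF trm(1) bounded_borel_sum[OF insert.hyps(1) trm(1)] trm(2) insert.IH]
        by (simp only: sum.insert[OF insert.hyps(1,2)])
    qed (simp add: zero)
    from this[OF R] show ?thesis by (subst Fn)
  qed
  then show ?thesis
    using lim[OF borel_measurable_simple_function[OF F(1)] bd F(2)] by blast
qed

lemma normal_functional_eqI:
  assumes L: "normal_functional L" "normal_functional L'"
    and eq: "\<And>A. A \<in> sets borel \<Longrightarrow> L (indicator A) = L' (indicator A)"
    and f: "f \<in> bounded_borel"
  shows "L f = L' f"
  using f
proof (induction rule: bounded_borel_induct)
  case (lim F f C)
  from normal_functionalD(3)[OF L(1) lim(1-3)] normal_functionalD(3)[OF L(2) lim(1-3)]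
  show ?case by (simp add: lim(4) LIMSEQ_unique)
qed (simp_all add: eq L[THEN normal_functionalD(1)] L[THEN normal_functionalD(2)])

text \<open>Countable additivity is bounded convergence of the indicators of finite unions.\<close>

lemma measure_functional:
  assumes L: "normal_functional L"
  shows "complex_borel_measure (functional_measure L)"
  unfolding complex_borel_measure_def
proof (intro conjI allI impI)
  show "functional_measure L {} = 0"
    using normal_functional_zero[OF L] by (simp add: functional_measure_def indicator_def[abs_def])
  show "functional_measure L A = 0" if "A \<notin> sets borel" for A
    using that by (simp add: functional_measure_def)
  fix A :: "nat \<Rightarrow> 'a set"
  assume A: "range A \<subseteq> sets borel \<and> disjoint_family A"
  have part: "(\<Sum>i<n. functional_measure L (A i)) = L (\<lambda>x. \<Sum>i<n. indicator (A i) x)" for n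
    using normal_functional_sum[OF L, of "{..<n}" "\<lambda>i x. indicator (A i) x"] A
      bounded_borel_closed(3)[of "A _"]
    by (force simp: functional_measure_def)
  have eq: "(\<Sum>i<n. indicator (A i) x :: complex) = indicator (\<Union>i<n. A i) x" for n x
    using A by (intro indicator_UN_disjoint[symmetric]) (auto simp: disjoint_family_on_def)
  have "(\<lambda>n. L (\<lambda>x. indicator (\<Union>i<n. A i) x)) \<longlonglongrightarrow> L (indicator (\<Union>i. A i))"
  proof (rule normal_functionalD(3)[OF L, where C=1])
    show "(\<lambda>n. indicator (\<Union>i<n. A i) x :: complex) \<longlonglongrightarrow> indicator (\<Union>i. A i) x" for x
      by (rule LIMSEQ_indicator_UN)
  qed (use A in \<open>auto simp: indicator_def\<close>)
  then show "(\<lambda>n. functional_measure L (A n)) sums functional_measure L (\<Union>n. A n)"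
    using A by (auto simp: sums_def part eq) (auto simp: functional_measure_def)
qed

text \<open>Both sides are normal functionals that agree on indicators. Linear combinations, Dirac
  series and mixtures of measures are all constructed through this correspondence.\<close>

lemma integral_functional_measure:
  assumes L: "normal_functional L" and "f \<in> bounded_borel"
  shows "complex_measure_integral f (functional_measure L) = L f"
proof (rule normal_functional_eqI[OF _ L _ assms(2)])
  note cb = measure_functional[OF L]
  show "normal_functional (\<lambda>f. complex_measure_integral f (functional_measure L))"
    by (rule normal_functional_integral[OF cb])
  show "complex_measure_integral (indicator A) (functional_measure L) = L (indicator A)"
    if "A \<in> sets borel" for A
    using that by (simp add: integral_complex_indicator[OF cb]) (simp add: functional_measure_def)
qed

lemma norm_LINT_le:
  fixes f :: "'a \<Rightarrow> 'b::{banach, second_countable_topology}"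
  assumes "integrable M f" "integrable M g" "\<And>x. norm (f x) \<le> g x"
  shows "norm (LINT x|M. f x) \<le> (LINT x|M. g x)"
  using assms by (intro order_trans[OF integral_norm_bound] integral_mono integrable_norm)

text \<open>The factor 4 counts the positive and negative variations of real and imaginary part,
  each of total mass at most K.\<close>

lemma norm_integral_le:
  assumes \<mu>: "complex_borel_measure \<mu>" "\<And>A. A \<in> sets borel \<Longrightarrow> norm (\<mu> A) \<le> K"
    and f: "f \<in> borel_measurable borel" "\<And>x. norm (f x) \<le> C"
  shows "norm (complex_measure_integral f \<mu>) \<le> 4 * K * C"
proof -
  have "0 \<le> C" using f(2) norm_ge_zero order_trans by blast
  have B: "norm (LINT x|positive_variation \<nu>. f x) \<le> K * C"
    if "sigma_additive \<nu>" "\<And>A. A \<in> sets borel \<Longrightarrow> \<nu> A \<le> K" for \<nu>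
  proof -
    interpret finite_measure "positive_variation \<nu>"
      by (rule finite_positive_variation[OF that(1)])
    have "norm (LINT x|positive_variation \<nu>. f x) \<le> (LINT x|positive_variation \<nu>. C)"
    proof (rule norm_LINT_le)
      show "integrable (positive_variation \<nu>) f"
        using that f by (intro integrable_bounded_borel bounded_borelI[of _ C])
    qed (simp_all add: f)
    also have "\<dots> \<le> K * C"
      using \<open>0 \<le> C\<close> positive_variation_least[OF that(1), of UNIV K] that(2)
      by (simp add: mult_right_mono)
    finally show ?thesis .
  qed
  have le: "Re (\<mu> A) \<le> K" "- Re (\<mu> A) \<le> K" "Im (\<mu> A) \<le> K" "- Im (\<mu> A) \<le> K" if "A \<in> sets borel" for A
    using \<mu>(2)[OF that] abs_Re_le_cmod[of "\<mu> A"] abs_Im_le_cmod[of "\<mu> A"] by linarith+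
  note b = complex_measureD(2)[OF \<mu>(1), THEN B, OF le(1)]
    complex_measureD(4)[OF \<mu>(1), THEN B, OF le(2)]
    complex_measureD(3)[OF \<mu>(1), THEN B, OF le(3)]
    complex_measureD(5)[OF \<mu>(1), THEN B, OF le(4)]
  have tri: "norm (p - q + \<i> * (r - s)) \<le> norm p + norm q + (norm r + norm s)" for p q r s
    using norm_triangle_ineq[of "p - q" "\<i> * (r - s)"] norm_triangle_ineq4[of p q]
      norm_triangle_ineq4[of r s] by (simp add: norm_mult)
  show ?thesis
    unfolding complex_measure_integral_def using b by (intro order_trans[OF tri]) linarith
qed

lemma integral_bounded:
  assumes "complex_borel_measure \<mu>"
  obtains K where "K \<ge> 0"
    "\<And>f C. f \<in> borel_measurable borel \<Longrightarrow> (\<And>x. norm (f x) \<le> C) \<Longrightarrow>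
       norm (complex_measure_integral f \<mu>) \<le> K * C"
proof -
  obtain K where K: "\<forall>A\<in>sets borel. norm (\<mu> A) \<le> K"
    using sigma_additive_bounded[OF complex_measureD(1)[OF assms]] ..
  then have "norm (\<mu> {}) \<le> K" by simp
  then have "4 * K \<ge> 0" using norm_ge_zero[of "\<mu> {}"] by linarith
  then show ?thesis
    using norm_integral_le[OF assms] K by (intro that[of "4 * K"]) auto
qed

section \<open>Radon measures\<close>

text \<open>\<open>partition_on\<close> demands nonempty cells that exhaust A: empty members of the
  family are dropped, and the uncovered rest becomes a further cell.\<close>

lemma sum_norm_le_variation:
  assumes "\<mu> {} = 0" "A \<in> sets borel" "finite I"
    and B: "\<And>i. i \<in> I \<Longrightarrow> B i \<in> sets borel" "\<And>i. i \<in> I \<Longrightarrow> B i \<subseteq> A" "disjoint_family_on B I"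
  shows "ennreal (\<Sum>i\<in>I. norm (\<mu> (B i))) \<le> total_variation \<mu> A"
proof -
  define J where "J = {i\<in>I. B i \<noteq> {}}"
  have J: "J \<subseteq> I" "finite J" using assms(3) by (auto simp: J_def)
  define R where "R = A - (\<Union>i\<in>I. B i)"
  define P where "P = B ` J \<union> ({R} - {{}})"
  \<comment> \<open>Once empty sets are dropped, disjointness forces distinct indices to carry
    distinct sets, so the sum over indices is a sum over cells.\<close>
  have inj: "inj_on B J"
  proof (rule inj_onI)
    fix i j assume "i \<in> J" "j \<in> J" "B i = B j"
    then show "i = j" using B(3) by (auto simp: J_def disjoint_family_on_def)
  qed
  have "R \<in> sets borel"
    unfolding R_def using assms(2,3) B(1) by (intro sets.Diff sets.finite_UN) auto
  then have Pb: "P \<subseteq> sets borel" "finite P" using B(1) J by (auto simp: P_def)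
  have UP: "\<Union>P = A"
  proof -
    have "\<Union>(B ` J) = (\<Union>i\<in>I. B i)" by (auto simp: J_def)
    moreover have "(\<Union>i\<in>I. B i) \<union> R = A" using B(2) by (auto simp: R_def)
    moreover have "\<Union>({R} - {{}}) = R" by auto
    ultimately show ?thesis by (simp add: P_def)
  qed
  have BB: "disjnt (B i) (B j)" if "i \<in> J" "j \<in> J" "B i \<noteq> B j" for i j
  proof -
    have "i \<noteq> j" using that by auto
    then show ?thesis using B(3) that J(1) unfolding disjoint_family_on_def disjnt_def by blast
  qed
  have BR: "disjnt (B i) R" "disjnt R (B i)" if "i \<in> J" for i
    using that J(1) by (auto simp: R_def disjnt_def)
  have "partition_on A P"
  proof (rule partition_onI)
    fix p q assume "p \<in> P" "q \<in> P" "p \<noteq> q"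
    then consider i j where "i \<in> J" "j \<in> J" "p = B i" "q = B j" | i where "i \<in> J" "p = B i" "q = R"
      | i where "i \<in> J" "p = R" "q = B i"
      unfolding P_def by blast
    then show "disjnt p q"
      using BB BR \<open>p \<noteq> q\<close> by cases auto
  next
    show "\<Union>P = A" by (rule UP)
  qed (auto simp: P_def J_def)
  then have "ennreal (\<Sum>C\<in>P. norm (\<mu> C)) \<le> total_variation \<mu> A"
    unfolding total_variation_def using Pb by (intro SUP_upper) auto
  moreover have "(\<Sum>i\<in>I. norm (\<mu> (B i))) = (\<Sum>i\<in>J. norm (\<mu> (B i)))"
    using assms(1,3) J by (intro sum.mono_neutral_right) (auto simp: J_def)
  moreover have "(\<Sum>i\<in>J. norm (\<mu> (B i))) = (\<Sum>C\<in>B ` J. norm (\<mu> C))"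
    by (simp add: sum.reindex[OF inj])
  moreover have "(\<Sum>C\<in>B ` J. norm (\<mu> C)) \<le> (\<Sum>C\<in>P. norm (\<mu> C))"
    using Pb by (intro sum_mono2) (auto simp: P_def)
  ultimately show ?thesis
    by (metis (no_types, lifting) ennreal_leI order_trans)
qed

text \<open>The indices with nonnegative value contribute \<nu> of one union, the others minus \<nu>
  of another; hence the factor 2.\<close>

lemma sum_abs_le_of_bound:
  fixes \<nu> :: "'e::topological_space set \<Rightarrow> real"
  assumes "sigma_additive \<nu>" "A \<in> sets borel"
    and C: "\<And>B. B \<in> sets borel \<Longrightarrow> B \<subseteq> A \<Longrightarrow> \<bar>\<nu> B\<bar> \<le> C"
    and I: "finite I" "\<And>i. i \<in> I \<Longrightarrow> B i \<in> sets borel" "\<And>i. i \<in> I \<Longrightarrow> B i \<subseteq> A"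
      "disjoint_family_on B I"
  shows "(\<Sum>i\<in>I. \<bar>\<nu> (B i)\<bar>) \<le> 2 * C"
proof -
  define P where "P = {i\<in>I. \<nu> (B i) \<ge> 0}"
  define N where "N = {i\<in>I. \<not> \<nu> (B i) \<ge> 0}"
  have un: "\<nu> (\<Union>i\<in>J. B i) = (\<Sum>i\<in>J. \<nu> (B i))" "\<bar>\<nu> (\<Union>i\<in>J. B i)\<bar> \<le> C" if "J \<subseteq> I" for J
  proof -
    have fJ: "finite J" using I that finite_subset by blast
    show "\<nu> (\<Union>i\<in>J. B i) = (\<Sum>i\<in>J. \<nu> (B i))"
      using that I fJ
      by (intro sigma_additive_finite_UN assms(1) disjoint_family_on_mono[OF that]) auto
    have "(\<Union>i\<in>J. B i) \<in> sets borel" using that I fJ by (intro sets.finite_UN) auto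
    then show "\<bar>\<nu> (\<Union>i\<in>J. B i)\<bar> \<le> C" using that I by (intro C) auto
  qed
  have "(\<Sum>i\<in>I. \<bar>\<nu> (B i)\<bar>) = (\<Sum>i\<in>P. \<bar>\<nu> (B i)\<bar>) + (\<Sum>i\<in>N. \<bar>\<nu> (B i)\<bar>)"
  proof -
    have "I = P \<union> N" "P \<inter> N = {}" "finite P" "finite N" using I(1) by (auto simp: P_def N_def)
    then show ?thesis by (metis sum.union_disjoint)
  qed
  also have "\<dots> = (\<Sum>i\<in>P. \<nu> (B i)) - (\<Sum>i\<in>N. \<nu> (B i))"
    unfolding diff_conv_add_uminus sum_negf[symmetric]
    by (intro arg_cong2[where f="(+)"] sum.cong) (auto simp: P_def N_def)
  also have "\<dots> \<le> C + C"
    using un[of P] un[of N] by (auto simp: P_def N_def)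
  finally show ?thesis by simp
qed

text \<open>The 4 is 2 for real and imaginary part times 2 for the signs. In particular the total
  variation is finite.\<close>

lemma total_variation_le_of_bound:
  assumes "complex_borel_measure \<mu>" "A \<in> sets borel"
    and C: "\<And>B. B \<in> sets borel \<Longrightarrow> B \<subseteq> A \<Longrightarrow> norm (\<mu> B) \<le> C"
  shows "total_variation \<mu> A \<le> ennreal (4 * C)"
  unfolding total_variation_def
proof (rule SUP_least, rule ennreal_leI)
  fix P assume P: "P \<in> {P. finite P \<and> partition_on A P \<and> P \<subseteq> sets borel}"
  have P': "finite P" "\<And>B. B \<in> P \<Longrightarrow> B \<in> sets borel" "\<And>B. B \<in> P \<Longrightarrow> B \<subseteq> A"
     "disjoint_family_on (\<lambda>B. B) P"
    using P by (auto simp: partition_on_def disjoint_def disjoint_family_on_def)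
  have "(\<Sum>B\<in>P. norm (\<mu> B)) \<le> (\<Sum>B\<in>P. \<bar>Re (\<mu> B)\<bar> + \<bar>Im (\<mu> B)\<bar>)"
    by (intro sum_mono cmod_le)
  also have "\<dots> = (\<Sum>B\<in>P. \<bar>Re (\<mu> B)\<bar>) + (\<Sum>B\<in>P. \<bar>Im (\<mu> B)\<bar>)"
    by (simp add: sum.distrib)
  also have "\<dots> \<le> 2 * C + 2 * C"
  proof (rule add_mono)
    show "(\<Sum>B\<in>P. \<bar>Re (\<mu> B)\<bar>) \<le> 2 * C"
      by (rule sum_abs_le_of_bound[OF complex_measureD(2)[OF assms(1)] assms(2) _ P'])
        (use C abs_Re_le_cmod order_trans in blast)+
    show "(\<Sum>B\<in>P. \<bar>Im (\<mu> B)\<bar>) \<le> 2 * C"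
      by (rule sum_abs_le_of_bound[OF complex_measureD(3)[OF assms(1)] assms(2) _ P'])
        (use C abs_Im_le_cmod order_trans in blast)+
  qed
  finally show "(\<Sum>B\<in>P. norm (\<mu> B)) \<le> 4 * C" by simp
qed

lemma total_variation_mono:
  assumes "\<mu> {} = 0" "A \<in> sets borel" "B \<subseteq> A"
  shows "total_variation \<mu> B \<le> total_variation \<mu> A"
  unfolding total_variation_def[of \<mu> B]
proof (rule SUP_least)
  fix P assume "P \<in> {P. finite P \<and> partition_on B P \<and> P \<subseteq> sets borel}"
  then show "ennreal (\<Sum>B\<in>P. norm (\<mu> B)) \<le> total_variation \<mu> A"
    using assms
    by (intro sum_norm_le_variation[where B="\<lambda>B. B"])
       (auto simp: partition_on_def disjoint_def disjoint_family_on_def)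
qed

text \<open>Up to the factor 4, the variation of A - K is the supremum of norm (\<mu> B) over its
  Borel subsets B, so inner regularity can be tested on values of \<mu>. Every later proof that a
  measure is Radon uses this form.\<close>

lemma radon_measure_iff:
  fixes \<mu> :: "'e::t2_space set \<Rightarrow> complex"
  assumes \<mu>: "complex_borel_measure \<mu>"
  shows "\<mu> \<in> radon_measures \<longleftrightarrow>
    (\<forall>A\<in>sets borel. \<forall>e>0. \<exists>K. K \<subseteq> A \<and> compact K \<and>
       (\<forall>B\<in>sets borel. B \<subseteq> A - K \<longrightarrow> norm (\<mu> B) \<le> e))" (is "_ \<longleftrightarrow> ?R")
proof
  have emp: "\<mu> {} = 0" using \<mu> by (simp add: complex_borel_measure_def)
  obtain C where "\<forall>A\<in>sets borel. norm (\<mu> A) \<le> C"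
    using sigma_additive_bounded[OF complex_measureD(1)[OF \<mu>]] ..
  then have bd: "total_variation \<mu> A \<le> ennreal (4 * C)" if "A \<in> sets borel" for A
    using that by (intro total_variation_le_of_bound \<mu>) auto
  have fin: "total_variation \<mu> A \<noteq> \<infinity>" if "A \<in> sets borel" for A
    using le_less_trans[OF bd[OF that] ennreal_less_top] by simp
  show ?R if radon: "\<mu> \<in> radon_measures"
  proof (intro ballI allI impI)
    fix A :: "'e set" and e :: real assume A: "A \<in> sets borel" and "e > 0"
    have "total_variation \<mu> A = (SUP K \<in> {K. K \<subseteq> A \<and> compact K}. total_variation \<mu> K)"
      using radon A by (simp add: radon_measures_def)
    moreover have "{K. K \<subseteq> A \<and> compact K} \<noteq> {}" by auto
    ultimately have "\<exists>K\<in>{K. K \<subseteq> A \<and> compact K}. total_variation \<mu> A < total_variation \<mu> K + ennreal e"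
      using fin[OF A] by (intro SUP_approx_ennreal[OF \<open>e > 0\<close>])
    then obtain K where K: "K \<subseteq> A" "compact K" "total_variation \<mu> A < total_variation \<mu> K + ennreal e"
      by auto
    have Kb: "K \<in> sets borel" using K(2) by (simp add: borel_closed compact_imp_closed)
    have "norm (\<mu> B) \<le> e" if B: "B \<in> sets borel" "B \<subseteq> A - K" for B
    proof -
      \<comment> \<open>Adding B as a cell to a partition of K gives disjoint sets inside A, so the
        variation of K and norm (\<mu> B) together stay below the variation of A.\<close>
      have "total_variation \<mu> K + ennreal (norm (\<mu> B)) =
          (SUP P \<in> {P. finite P \<and> partition_on K P \<and> P \<subseteq> sets borel}.
             ennreal (\<Sum>B\<in>P. norm (\<mu> B)) + ennreal (norm (\<mu> B)))"
      proof -
        \<comment> \<open>Pulling the summand into the supremum needs a nonempty index set; for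
          empty K the partition without cells is the witness.\<close>
        have "{K} - {{}} \<in> {P. finite P \<and> partition_on K P \<and> P \<subseteq> sets borel}"
          using Kb by (auto simp: partition_on_def disjoint_def)
        then show ?thesis
          unfolding total_variation_def by (intro ennreal_SUP_add_left[symmetric]) blast
      qed
      also have "\<dots> \<le> total_variation \<mu> A"
      proof (rule SUP_least)
        fix P assume P: "P \<in> {P. finite P \<and> partition_on K P \<and> P \<subseteq> sets borel}"
        have "B \<notin> P"
        proof
          assume "B \<in> P"
          then have "B \<subseteq> K" "B \<noteq> {}" using P by (auto simp: partition_on_def)
          then show False using B by auto
        qed
        then have "ennreal (\<Sum>B\<in>P. norm (\<mu> B)) + ennreal (norm (\<mu> B)) =
            ennreal (\<Sum>B\<in>insert B P. norm (\<mu> B))"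
          using P by (simp add: sum_nonneg add.commute flip: ennreal_plus)
        also have "\<dots> \<le> total_variation \<mu> A"
        proof (rule sum_norm_le_variation[where \<mu>=\<mu> and B="\<lambda>B. B"])
          have "P \<subseteq> Pow K" using P by (auto simp: partition_on_def)
          then show "C \<subseteq> A" if "C \<in> insert B P" for C using that B K by auto
          show "disjoint_family_on (\<lambda>B. B) (insert B P)"
            using P B K \<open>P \<subseteq> Pow K\<close>
            by (auto simp: partition_on_def disjoint_def disjoint_family_on_def)
        qed (use P B A emp in auto)
        finally show "ennreal (\<Sum>B\<in>P. norm (\<mu> B)) + ennreal (norm (\<mu> B)) \<le> total_variation \<mu> A" .
      qed
      also have "\<dots> \<le> total_variation \<mu> K + ennreal e" using K(3) by simp
      finally have "ennreal (norm (\<mu> B)) \<le> ennreal e"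
        using fin[OF Kb] by (simp add: ennreal_add_left_cancel_le)
      then show ?thesis using \<open>e > 0\<close> by simp
    qed
    then show "\<exists>K. K \<subseteq> A \<and> compact K \<and> (\<forall>B\<in>sets borel. B \<subseteq> A - K \<longrightarrow> norm (\<mu> B) \<le> e)"
      using K by auto
  qed
  show "\<mu> \<in> radon_measures" if R: ?R
    unfolding radon_measures_def
  proof (safe intro!: \<mu>)
    fix A :: "'e set" assume A: "A \<in> sets borel"
    show "total_variation \<mu> A = (SUP K \<in> {K. K \<subseteq> A \<and> compact K}. total_variation \<mu> K)" (is "_ = ?S")
    proof (rule antisym)
      show "?S \<le> total_variation \<mu> A"
        using emp A by (intro SUP_least total_variation_mono) auto
      show "total_variation \<mu> A \<le> ?S"
      proof (rule ennreal_le_epsilon)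
        fix e :: real assume "e > 0"
        \<comment> \<open>The quarter cancels the factor 4 of
          \<open>total_variation_le_of_bound\<close>.\<close>
        then obtain K where K: "K \<subseteq> A" "compact K"
          "\<forall>B\<in>sets borel. B \<subseteq> A - K \<longrightarrow> norm (\<mu> B) \<le> e / 4"
          using R[rule_format, OF A, of "e / 4"] by auto
        have Kb: "K \<in> sets borel" using K(2) by (simp add: borel_closed compact_imp_closed)
        have D: "total_variation \<mu> (A - K) \<le> ennreal (4 * (e / 4))"
          using K A Kb by (intro total_variation_le_of_bound \<mu>) auto
        have "total_variation \<mu> A \<le> total_variation \<mu> K + total_variation \<mu> (A - K)"
          unfolding total_variation_def[of \<mu> A]
        proof (rule SUP_least)
          fix P assume P: "P \<in> {P. finite P \<and> partition_on A P \<and> P \<subseteq> sets borel}"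
          then have disj: "disjoint_family_on (\<lambda>B. B) P" "finite P" "P \<subseteq> sets borel"
            "\<And>B. B \<in> P \<Longrightarrow> B \<subseteq> A"
            by (auto simp: partition_on_def disjoint_def disjoint_family_on_def)
          have "(\<Sum>B\<in>P. norm (\<mu> B)) \<le> (\<Sum>B\<in>P. norm (\<mu> (B \<inter> K)) + norm (\<mu> (B - K)))"
          proof (rule sum_mono)
            fix B assume "B \<in> P"
            then have "\<mu> B = \<mu> (B \<inter> K) + \<mu> (B - K)"
              using disj Kb by (intro sigma_additive_split complex_measureD[OF \<mu>]) auto
            then show "norm (\<mu> B) \<le> norm (\<mu> (B \<inter> K)) + norm (\<mu> (B - K))"
              using norm_triangle_ineq by simp
          qed
          then have "ennreal (\<Sum>B\<in>P. norm (\<mu> B)) \<le>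
              ennreal ((\<Sum>B\<in>P. norm (\<mu> (B \<inter> K))) + (\<Sum>B\<in>P. norm (\<mu> (B - K))))"
            by (intro ennreal_leI) (simp add: sum.distrib)
          also have "\<dots> = ennreal (\<Sum>B\<in>P. norm (\<mu> (B \<inter> K))) + ennreal (\<Sum>B\<in>P. norm (\<mu> (B - K)))"
            by (simp add: sum_nonneg)
          also have "\<dots> \<le> total_variation \<mu> K + total_variation \<mu> (A - K)"
            using disj Kb A emp
            by (intro add_mono sum_norm_le_variation[where \<mu>=\<mu>])
               (auto simp: disjoint_family_on_def subset_iff)
          finally show "ennreal (\<Sum>B\<in>P. norm (\<mu> B)) \<le> total_variation \<mu> K + total_variation \<mu> (A - K)" .
        qed
        also have "\<dots> \<le> ?S + ennreal e"
          using K D by (intro add_mono SUP_upper) auto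
        finally show "total_variation \<mu> A \<le> ?S + ennreal e" .
      qed
    qed
  qed
qed

lemma radon_complex_measure: "\<mu> \<in> radon_measures \<Longrightarrow> complex_borel_measure \<mu>"
  by (simp add: radon_measures_def)

text \<open>The union of compact sets for \<mu> and for \<nu> serves for the combination. Only
  integrals of the new measure are recorded, since the pairing sees nothing else.\<close>

lemma radon_linear_combination:
  fixes \<mu> \<nu> :: "'e::t2_space set \<Rightarrow> complex"
  assumes "\<mu> \<in> radon_measures" "\<nu> \<in> radon_measures"
  shows "\<exists>\<rho>\<in>radon_measures. \<forall>f\<in>bounded_borel. complex_measure_integral f \<rho> =
    a * complex_measure_integral f \<mu> + b * complex_measure_integral f \<nu>"
proof -
  note cb = assms[THEN radon_complex_measure]
  define L where "L f = a * complex_measure_integral f \<mu> + b * complex_measure_integral f \<nu>" for f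
  have L: "normal_functional L"
    unfolding normal_functional_def L_def
    by (auto simp: algebra_simps cb[THEN normal_functional_integral, THEN normal_functionalD(1)]
        cb[THEN normal_functional_integral, THEN normal_functionalD(2)]
        intro!: tendsto_intros cb[THEN normal_functional_integral, THEN normal_functionalD(3)])
  note cL = measure_functional[OF L]
  have "functional_measure L \<in> radon_measures"
    unfolding radon_measure_iff[OF cL]
  proof (intro ballI allI impI)
    fix A :: "'e set" and e :: real assume A: "A \<in> sets borel" and "e > 0"
    define d where "d = e / (norm a + norm b + 1)"
    have d: "d > 0" using \<open>e > 0\<close> by (auto simp: d_def intro!: divide_pos_pos add_nonneg_pos)
    obtain K1 where K1: "K1 \<subseteq> A" "compact K1" "\<forall>B\<in>sets borel. B \<subseteq> A - K1 \<longrightarrow> norm (\<mu> B) \<le> d"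
      using assms(1) A d unfolding radon_measure_iff[OF cb(1)] by meson
    obtain K2 where K2: "K2 \<subseteq> A" "compact K2" "\<forall>B\<in>sets borel. B \<subseteq> A - K2 \<longrightarrow> norm (\<nu> B) \<le> d"
      using assms(2) A d unfolding radon_measure_iff[OF cb(2)] by meson
    have "norm (functional_measure L B) \<le> e" if B: "B \<in> sets borel" "B \<subseteq> A - (K1 \<union> K2)" for B
    proof -
      have "functional_measure L B = a * \<mu> B + b * \<nu> B"
        using B by (simp add: functional_measure_def L_def cb[THEN integral_complex_indicator])
      then have "norm (functional_measure L B) \<le> norm a * norm (\<mu> B) + norm b * norm (\<nu> B)"
        using norm_triangle_ineq[of "a * \<mu> B" "b * \<nu> B"] by (simp add: norm_mult)
      also have "norm (\<mu> B) \<le> d" using K1(3) B by auto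
      also have "norm (\<nu> B) \<le> d" using K2(3) B by auto
      also have "norm a * d + norm b * d \<le> (norm a + norm b + 1) * d"
        using d by (simp add: algebra_simps)
      also have "\<dots> = e"
        by (simp add: d_def add_nonneg_eq_0_iff)
      finally show ?thesis by (simp add: mult_left_mono)
    qed
    then show "\<exists>K. K \<subseteq> A \<and> compact K \<and>
        (\<forall>B\<in>sets borel. B \<subseteq> A - K \<longrightarrow> norm (functional_measure L B) \<le> e)"
      using K1 K2 by (intro exI[of _ "K1 \<union> K2"]) auto
  qed
  then show ?thesis
    using integral_functional_measure[OF L] by (auto simp: L_def)
qed

text \<open>Finitely many points carry all but e of the mass and form a compact set; Tannery's
  theorem gives bounded convergence. Such measures turn the series of \<open>gliding_hump\<close>
  into elements of M_0(E).\<close>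

lemma radon_dirac_series:
  fixes c :: "nat \<Rightarrow> complex" and x :: "nat \<Rightarrow> 'e::t2_space"
  assumes c: "summable (\<lambda>k. norm (c k))"
  shows "\<exists>\<rho>\<in>radon_measures. \<forall>f\<in>bounded_borel. complex_measure_integral f \<rho> = (\<Sum>k. c k * f (x k))"
proof -
  define L where "L f = (\<Sum>k. c k * f (x k))" for f
  have bd: "norm (c k * y) \<le> norm (c k) * C" if "norm y \<le> C" for k y C
    using that by (simp add: norm_mult mult_left_mono)
  have sm: "summable (\<lambda>k. norm (c k) * C)" for C using c by (rule summable_mult2)
  have summ: "summable (\<lambda>k. c k * f (x k))" if "f \<in> bounded_borel" for f
  proof -
    obtain C where "\<forall>x. norm (f x) \<le> C" using bounded_borelD(2)[OF \<open>f \<in> bounded_borel\<close>] ..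
    then show ?thesis by (intro summable_comparison_test'[OF sm[of C], of 0] bd) auto
  qed
  have L: "normal_functional L"
    unfolding normal_functional_def
  proof (intro conjI ballI allI impI)
    fix f g :: "'e \<Rightarrow> complex" assume "f \<in> bounded_borel" "g \<in> bounded_borel"
    then show "L (\<lambda>x. f x + g x) = L f + L g"
      by (simp add: L_def summ suminf_add algebra_simps)
  next
    fix f :: "'e \<Rightarrow> complex" and a assume "f \<in> bounded_borel"
    then show "L (\<lambda>x. a * f x) = a * L f"
      unfolding L_def by (subst suminf_mult[symmetric]) (auto simp: summ mult.left_commute)
  next
    fix F :: "nat \<Rightarrow> 'e \<Rightarrow> complex" and f C
    assume F: "\<forall>n. F n \<in> borel_measurable borel" "\<forall>n x. norm (F n x) \<le> C" "\<forall>x. (\<lambda>n. F n x) \<longlonglongrightarrow> f x"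
    have "(\<lambda>n. \<Sum>k. c k * F n (x k)) \<longlonglongrightarrow> (\<Sum>k. c k * f (x k))"
      using F sm[of C]
      by (intro tannerys_theorem[where M="\<lambda>k. norm (c k) * C", THEN conjunct2, THEN conjunct2]
            tendsto_intros always_eventually)
         (auto intro!: bd)
    then show "(\<lambda>n. L (F n)) \<longlonglongrightarrow> L f" by (simp add: L_def)
  qed
  note cL = measure_functional[OF L]
  have "functional_measure L \<in> radon_measures"
    unfolding radon_measure_iff[OF cL]
  proof (intro ballI allI impI)
    fix A :: "'e set" and e :: real assume A: "A \<in> sets borel" and "e > 0"
    obtain N where N: "\<And>n. n \<ge> N \<Longrightarrow> norm (\<Sum>k. norm (c (k + n))) < e"
      using suminf_exist_split[OF \<open>e > 0\<close> c] by auto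
    define K where "K = x ` {..<N} \<inter> A"
    have "norm (functional_measure L B) \<le> e" if B: "B \<in> sets borel" "B \<subseteq> A - K" for B
    proof -
      define t where "t k = c k * indicator B (x k)" for k
      have ts: "summable t"
        using summ[OF bounded_borel_closed(3)[OF B(1)]] by (simp add: t_def[abs_def])
      have "t k = 0" if "k < N" for k
        using B that by (auto simp: t_def K_def indicator_def)
      then have "suminf t = (\<Sum>k. t (k + N))"
        by (subst suminf_split_initial_segment[OF ts, of N]) simp
      also have "norm \<dots> \<le> (\<Sum>k. norm (c (k + N)))"
        using c by (intro norm_suminf_le) (auto simp: t_def indicator_def summable_iff_shift[of "\<lambda>k. norm (c k)"])
      also have "\<dots> \<le> e" using N[of N] by simp
      finally show ?thesis using B by (simp add: functional_measure_def L_def t_def[abs_def])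
    qed
    moreover have "compact K" "K \<subseteq> A" unfolding K_def by (auto intro!: finite_imp_compact)
    ultimately show "\<exists>K. K \<subseteq> A \<and> compact K \<and>
        (\<forall>B\<in>sets borel. B \<subseteq> A - K \<longrightarrow> norm (functional_measure L B) \<le> e)"
      by blast
  qed
  then show ?thesis
    using integral_functional_measure[OF L] by (auto simp: L_def)
qed

lemma radon_dirac:
  fixes x :: "'e::t2_space"
  shows "\<exists>\<rho>\<in>radon_measures. \<forall>f\<in>bounded_borel. complex_measure_integral f \<rho> = f x"
proof -
  define c :: "nat \<Rightarrow> complex" where "c k = (if k = 0 then 1 else 0)" for k
  have "summable (\<lambda>k. norm (c k))" by (rule summable_finite[of "{0}"]) (auto simp: c_def)
  from radon_dirac_series[OF this, of "\<lambda>_. x"]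
  obtain \<rho> where \<rho>: "\<rho> \<in> radon_measures"
    "\<And>f. f \<in> bounded_borel \<Longrightarrow> complex_measure_integral f \<rho> = (\<Sum>k. c k * f x)" by auto
  have "(\<Sum>k. c k * y) = y" for y
    using suminf_finite[of "{0}" "\<lambda>k. c k * y"] by (simp add: c_def)
  with \<rho> show ?thesis by auto
qed

section \<open>Uniform boundedness\<close>

text \<open>
  Sokal's gliding hump: the sign of \<open>c k\<close> is chosen so that the partial sum at stage \<open>k\<close> is at
  least as large as its last term, and the tail of the series cannot compensate for it.
\<close>

lemma gliding_hump:
  fixes \<phi> :: "'i \<Rightarrow> 'b \<Rightarrow> complex"
  assumes bd: "\<And>i. i \<in> I \<Longrightarrow> \<exists>N. \<forall>b\<in>B. norm (\<phi> i b) \<le> N"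
    and unb: "\<And>C. \<exists>i\<in>I. \<exists>b\<in>B. norm (\<phi> i b) > C"
  shows "\<exists>c b. (\<forall>k. norm (c k) \<le> (1/5) ^ k) \<and> (\<forall>k. b k \<in> B) \<and>
    (\<forall>C. \<exists>i\<in>I. norm (\<Sum>k. c k * \<phi> i (b k)) > C)"
proof -
  \<comment> \<open>For the chosen i, b maximises the norm over B up to the factor 2; later this
    bounds the whole tail by the term of stage n.\<close>
  have pick: "\<exists>i b. i \<in> I \<and> b \<in> B \<and> norm (\<phi> i b) > C \<and> (\<forall>b'\<in>B. norm (\<phi> i b') \<le> 2 * norm (\<phi> i b))"
    for C
  proof -
    obtain i b0 where i: "i \<in> I" "b0 \<in> B" "norm (\<phi> i b0) > 2 * \<bar>C\<bar>"
      using unb[of "2 * \<bar>C\<bar>"] by auto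
    define N where "N = (SUP b\<in>B. norm (\<phi> i b))"
    obtain N0 where "\<forall>b\<in>B. norm (\<phi> i b) \<le> N0" using bd[OF i(1)] ..
    then have bdd: "bdd_above ((\<lambda>b. norm (\<phi> i b)) ` B)" by (auto intro!: bdd_aboveI2)
    have N: "norm (\<phi> i b) \<le> N" if "b \<in> B" for b
      unfolding N_def using bdd that by (intro cSUP_upper)
    have "N > 0" "N > 2 * \<bar>C\<bar>" using N[OF i(2)] i(3) by auto
    then have "N / 2 < N" by simp
    then obtain b where b: "b \<in> B" "N / 2 < norm (\<phi> i b)"
      using less_cSUP_iff[of B "\<lambda>b. norm (\<phi> i b)" "N / 2"] bdd i(2) by (auto simp: N_def[symmetric])
    then show ?thesis
      using i(1) N \<open>N > 2 * \<bar>C\<bar>\<close> by (intro exI[of _ i] exI[of _ b]) (force intro: order_trans)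
  qed
  \<comment> \<open>After multiplication by (1/5) ^ n, this threshold makes the term of stage n
    larger than 2 * n, and half of it will survive the tail.\<close>
  have "\<forall>n. \<exists>p. fst p \<in> I \<and> snd p \<in> B \<and> norm (\<phi> (fst p) (snd p)) > 2 * real n * 5 ^ n \<and>
      (\<forall>b'\<in>B. norm (\<phi> (fst p) b') \<le> 2 * norm (\<phi> (fst p) (snd p)))"
    using pick by simp
  from choice[OF this] obtain p where p: "\<And>n. fst (p n) \<in> I" "\<And>n. snd (p n) \<in> B"
    "\<And>n. norm (\<phi> (fst (p n)) (snd (p n))) > 2 * real n * 5 ^ n"
    "\<And>n b'. b' \<in> B \<Longrightarrow> norm (\<phi> (fst (p n)) b') \<le> 2 * norm (\<phi> (fst (p n)) (snd (p n)))"
    by auto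
  define i where "i n = fst (p n)" for n
  define b where "b n = snd (p n)" for n
  note ib = p[folded i_def b_def]
  define sg :: "nat \<Rightarrow> ('i \<Rightarrow> complex) \<Rightarrow> complex" where
    "sg n s = (if norm (s (i n) + (1/5) ^ n * \<phi> (i n) (b n)) \<ge> norm (s (i n) - (1/5) ^ n * \<phi> (i n) (b n))
       then (1/5) ^ n else - ((1/5) ^ n))" for n s
  \<comment> \<open>The recursion carries the partial sum as a function of j: the sign at stage n is
    read off at the index \<open>i n\<close>, but later stages evaluate the same sum at other
    indices.\<close>
  define S where "S = rec_nat (\<lambda>_. 0) (\<lambda>n s j. s j + sg n s * \<phi> j (b n))"
  define c where "c n = sg n (S n)" for n
  have S_Suc: "S (Suc n) j = S n j + c n * \<phi> j (b n)" for n j by (simp add: S_def c_def)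
  have S0: "S 0 j = 0" for j by (simp add: S_def)
  have S: "S n j = (\<Sum>k<n. c k * \<phi> j (b k))" for n j
    by (induction n) (simp_all add: S0 S_Suc)
  have nc: "norm (c n) = (1/5) ^ n" for n
    by (simp add: c_def sg_def norm_power norm_divide)
  have big: "norm (S (Suc n) (i n)) \<ge> (1/5) ^ n * norm (\<phi> (i n) (b n))" for n
  proof -
    define d where "d = (1/5) ^ n * \<phi> (i n) (b n)"
    define a where "a = S n (i n)"
    have "norm (S (Suc n) (i n)) = max (norm (a + d)) (norm (a - d))"
      by (simp add: S_Suc c_def sg_def a_def d_def max_def)
    moreover have "norm ((a + d) - (a - d)) \<le> norm (a + d) + norm (a - d)"
      by (rule norm_triangle_ineq4)
    moreover have "(a + d) - (a - d) = 2 * d" by simp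
    ultimately have "norm (S (Suc n) (i n)) \<ge> norm d" by (simp add: norm_mult)
    then show ?thesis by (simp add: d_def norm_mult norm_power norm_divide)
  qed
  have "norm (\<Sum>k. c k * \<phi> (i n) (b k)) > n" for n
  proof -
    define a where "a = norm (\<phi> (i n) (b n))"
    have bound: "norm (c k * \<phi> (i n) (b k)) \<le> (1/5) ^ k * (2 * a)" for k
      using ib(4)[OF ib(2)] by (simp add: norm_mult nc a_def mult_left_mono)
    have sg5: "summable (\<lambda>k. (1/5) ^ k * (2 * a))" by (intro summable_mult2 summable_geometric) simp
    have sm: "summable (\<lambda>k. c k * \<phi> (i n) (b k))"
      using bound by (intro summable_comparison_test'[OF sg5, of 0]) auto
    have "norm (\<Sum>k. c (k + Suc n) * \<phi> (i n) (b (k + Suc n))) \<le> (\<Sum>k. (1/5) ^ (k + Suc n) * (2 * a))"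
      using bound by (intro norm_suminf_le summable_ignore_initial_segment sg5)
    also have "\<dots> = (\<Sum>k. (1/5) ^ k * ((1/5) ^ Suc n * (2 * a)))"
      by (simp add: power_add mult_ac)
    also have "\<dots> = (\<Sum>k. (1/5) ^ k) * ((1/5) ^ Suc n * (2 * a))"
      by (subst suminf_mult2) (auto intro!: summable_geometric)
    \<comment> \<open>Here (5/4) * (2/5) = 1/2, so with ratio 1/5 the tail takes at most half of the
      leading term.\<close>
    also have "\<dots> = (1/5) ^ n * a / 2"
      by (subst suminf_geometric) auto
    finally have tail: "norm (\<Sum>k. c (k + Suc n) * \<phi> (i n) (b (k + Suc n))) \<le> (1/5) ^ n * a / 2" .
    define s where "s = S (Suc n) (i n)"
    define t where "t = (\<Sum>k. c (k + Suc n) * \<phi> (i n) (b (k + Suc n)))"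
    have "(\<Sum>k. c k * \<phi> (i n) (b k)) = s + t"
      unfolding S s_def t_def by (subst suminf_split_initial_segment[OF sm, of "Suc n"]) simp
    moreover have "norm (s + t) \<ge> (1/5) ^ n * a - (1/5) ^ n * a / 2"
      using tail[folded t_def] big[of n, folded s_def a_def] norm_diff_ineq[of s t] by linarith
    ultimately have "norm (\<Sum>k. c k * \<phi> (i n) (b k)) \<ge> (1/5) ^ n * a - (1/5) ^ n * a / 2"
      by simp
    moreover have "(1/5) ^ n * a > (1/5) ^ n * (2 * real n * 5 ^ n)"
      using ib(3)[of n] by (intro mult_strict_left_mono) (auto simp: a_def)
    moreover have "(1/5) ^ n * (2 * real n * 5 ^ n) = 2 * real n"
      by (simp add: power_one_over)
    ultimately show ?thesis by linarith
  qed
  then have "\<exists>j\<in>I. norm (\<Sum>k. c k * \<phi> j (b k)) > C" for C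
    using ib(1) reals_Archimedean2[of C] by (meson less_trans)
  then show ?thesis using nc ib(2) by (intro exI[of _ c] exI[of _ b]) auto
qed

lemma summable_geometric_bound:
  fixes c :: "nat \<Rightarrow> 'a::real_normed_vector"
  assumes "\<And>k. norm (c k) \<le> (1/5) ^ k"
  shows "summable (\<lambda>k. norm (c k))"
proof (rule summable_comparison_test')
  show "summable (\<lambda>k. (1/5 :: real) ^ k)" by (rule summable_geometric) simp
qed (use assms in auto)

lemma bcontfun_bounded_borel: "apply_bcontfun f \<in> bounded_borel"
proof (rule bounded_borelI[of _ "norm f"])
  show "apply_bcontfun f \<in> borel_measurable borel"
    by (intro borel_measurable_continuous_onI continuous_on_apply_bcontfun)
qed (rule norm_bounded)

lemma ex_norm_bcontfun_gt:
  fixes f :: "'e::topological_space \<Rightarrow>\<^sub>C complex"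
  assumes "norm f > C" shows "\<exists>x. norm (apply_bcontfun f x) > C"
  using assms norm_bound[of f C] by (meson not_le)

text \<open>With point evaluations as test elements, \<open>gliding_hump\<close> yields coefficients
  and points whose Dirac series is a Radon measure unbounded on F.\<close>

lemma weakly_bounded_imp_bounded:
  fixes F :: "('e::t2_space \<Rightarrow>\<^sub>C complex) set"
  assumes wb: "\<And>\<mu>. \<mu> \<in> radon_measures \<Longrightarrow> \<exists>C. \<forall>f\<in>F. norm (Cb_pairing f \<mu>) \<le> C"
  shows "\<exists>C. \<forall>f\<in>F. norm f \<le> C"
proof (rule ccontr)
  assume unb: "\<nexists>C. \<forall>f\<in>F. norm f \<le> C"
  have "\<exists>c x. (\<forall>k. norm (c k) \<le> (1/5) ^ k) \<and> (\<forall>k. x k \<in> UNIV) \<and>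
    (\<forall>C. \<exists>f\<in>F. norm (\<Sum>k. c k * apply_bcontfun f (x k)) > C)"
  proof (rule gliding_hump)
    show "\<exists>N. \<forall>x\<in>UNIV. norm (apply_bcontfun f x) \<le> N" for f :: "'e \<Rightarrow>\<^sub>C complex"
      using norm_bounded[of f] by blast
    fix C
    obtain f where "f \<in> F" "norm f > C" using unb by (auto simp: not_le)
    then show "\<exists>f\<in>F. \<exists>x\<in>UNIV. norm (apply_bcontfun f x) > C"
      using ex_norm_bcontfun_gt[of C f] by auto
  qed
  then obtain c x where c: "\<And>k. norm (c k) \<le> (1/5) ^ k"
    and big: "\<And>C. \<exists>f\<in>F. norm (\<Sum>k. c k * apply_bcontfun f (x k)) > C" by auto
  obtain \<rho> where \<rho>: "\<rho> \<in> radon_measures"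
    "\<forall>f\<in>bounded_borel. complex_measure_integral f \<rho> = (\<Sum>k. c k * f (x k))"
    using radon_dirac_series[OF summable_geometric_bound[OF c], of x] by auto
  obtain C where "\<forall>f\<in>F. norm (Cb_pairing f \<rho>) \<le> C" using wb[OF \<rho>(1)] ..
  with big[of C] \<rho>(2) show False
    by (auto simp: Cb_pairing_def bcontfun_bounded_borel not_le[symmetric] simp del: not_le)
qed

lemma bounded_linear_apply_bcontfun: "bounded_linear (\<lambda>f. apply_bcontfun f x)"
  by (rule bounded_linear_intro[of _ 1])
    (auto simp: plus_bcontfun.rep_eq scaleR_bcontfun.rep_eq norm_bounded)

lemma norm_Cb_scale_le: "norm (Cb_scale c f) \<le> norm c * norm f"
  by (rule norm_bound) (simp add: norm_mult mult_left_mono norm_bounded)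

lemma scaleR_eq_Cb_scale: "r *\<^sub>R f = Cb_scale (of_real r) f"
  by (rule bcontfun_eqI) (simp add: scaleR_bcontfun.rep_eq scaleR_conv_of_real)

lemma linear_Cb_scale:
  assumes "Vector_Spaces.linear Cb_scale Cb_scale S"
  shows "S (f + g) = S f + S g" "S (Cb_scale c f) = Cb_scale c (S f)" "linear S"
proof -
  interpret Vector_Spaces.linear Cb_scale Cb_scale S by fact
  show "S (f + g) = S f + S g" "S (Cb_scale c f) = Cb_scale c (S f)"
    by (simp_all add: add scale)
  show "linear S" by (rule linearI) (simp_all add: add scale scaleR_eq_Cb_scale)
qed

lemma summable_bcontfun:
  fixes h :: "nat \<Rightarrow> 'e::topological_space \<Rightarrow>\<^sub>C complex"
  assumes M: "\<And>k. norm (h k) \<le> M k" "summable M"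
  shows "summable h"
proof -
  have ap: "apply_bcontfun (\<Sum>k<n. h k) x = (\<Sum>k<n. apply_bcontfun (h k) x)" for n x
    by (rule linear_sum) (rule bounded_linear.linear[OF bounded_linear_apply_bcontfun])
  have "uniform_limit UNIV (\<lambda>n x. \<Sum>k<n. apply_bcontfun (h k) x)
      (\<lambda>x. \<Sum>k. apply_bcontfun (h k) x) sequentially"
    using M order_trans[OF norm_bounded] by (intro Weierstrass_m_test) auto
  then have "uniform_limit UNIV (\<lambda>n. apply_bcontfun (\<Sum>k<n. h k))
      (\<lambda>x. \<Sum>k. apply_bcontfun (h k) x) sequentially"
    by (simp only: ap ext[OF ap])
  then obtain l where "(\<lambda>n. \<Sum>k<n. h k) \<longlonglongrightarrow> l"
    by (rule uniform_limit_bcontfunE) auto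
  then show ?thesis by (auto simp: summable_def sums_def)
qed

text \<open>The indices of the gliding hump are pairs of an operator and a point, the test elements
  are functions of the unit ball. Their series converges in norm to some g for which S i g is
  unbounded in i. Linearity over \<open>Cb_scale\<close> takes the complex coefficients out of S
  i.\<close>

lemma uniform_boundedness_Cb:
  fixes S :: "'i \<Rightarrow> ('e::topological_space \<Rightarrow>\<^sub>C complex) \<Rightarrow> ('e \<Rightarrow>\<^sub>C complex)"
  assumes lin: "\<And>i. Vector_Spaces.linear Cb_scale Cb_scale (S i)" "\<And>i. bounded_linear (S i)"
    and pw: "\<And>f. \<exists>C. \<forall>i. norm (S i f) \<le> C"
  shows "\<exists>C. \<forall>i f. norm f \<le> 1 \<longrightarrow> norm (S i f) \<le> C"
proof (rule ccontr)
  assume unb: "\<nexists>C. \<forall>i f. norm f \<le> 1 \<longrightarrow> norm (S i f) \<le> C"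
  have "\<exists>c f. (\<forall>k. norm (c k) \<le> (1/5) ^ k) \<and> (\<forall>k. f k \<in> {f. norm f \<le> 1}) \<and>
    (\<forall>C. \<exists>p\<in>UNIV. norm (\<Sum>k. c k * apply_bcontfun (S (fst p) (f k)) (snd p)) > C)"
  proof (rule gliding_hump)
    fix p :: "'i \<times> 'e"
    obtain K where K: "\<And>f. norm (S (fst p) f) \<le> norm f * K" "K > 0"
      using bounded_linear.pos_bounded[OF lin(2)[of "fst p"]] by auto
    have "norm (apply_bcontfun (S (fst p) f) (snd p)) \<le> K" if "norm f \<le> 1" for f
    proof -
      have "norm (apply_bcontfun (S (fst p) f) (snd p)) \<le> norm f * K"
        using norm_bounded K(1) order_trans by blast
      also have "\<dots> \<le> 1 * K" using that K(2) by (intro mult_right_mono) auto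
      finally show ?thesis by simp
    qed
    then show "\<exists>N. \<forall>f\<in>{f. norm f \<le> 1}. norm (apply_bcontfun (S (fst p) f) (snd p)) \<le> N" by auto
  next
    fix C
    have "\<not> (\<forall>i f. norm f \<le> 1 \<longrightarrow> norm (S i f) \<le> C)" using unb by blast
    then obtain i f where if': "norm f \<le> 1" "norm (S i f) > C" by (auto simp: not_le)
    then obtain x where "norm (apply_bcontfun (S i f) x) > C" using ex_norm_bcontfun_gt by blast
    then show "\<exists>p\<in>UNIV. \<exists>f\<in>{f. norm f \<le> 1}. norm (apply_bcontfun (S (fst p) f) (snd p)) > C"
      using if' by (intro bexI[of _ "(i, x)"] bexI[of _ f]) auto
  qed
  then obtain c f where c: "\<And>k. norm (c k) \<le> (1/5) ^ k" and f: "\<And>k. norm (f k) \<le> 1"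
    and big: "\<And>C. \<exists>p. norm (\<Sum>k. c k * apply_bcontfun (S (fst p) (f k)) (snd p)) > C" by auto
  have le: "norm (Cb_scale (c k) (f k)) \<le> (1/5) ^ k" for k
    using norm_Cb_scale_le[of "c k" "f k"] mult_mono[OF c f, of k k] by simp
  have sm: "summable (\<lambda>k. Cb_scale (c k) (f k))"
    by (rule summable_bcontfun[OF le]) (simp add: summable_geometric)
  define g where "g = (\<Sum>k. Cb_scale (c k) (f k))"
  obtain C where C: "\<forall>i. norm (S i g) \<le> C" using pw[of g] ..
  obtain i x where "norm (\<Sum>k. c k * apply_bcontfun (S i (f k)) x) > C" using big[of C] by auto
  moreover have "(\<Sum>k. c k * apply_bcontfun (S i (f k)) x) = apply_bcontfun (S i g) x"
  proof -
    have "S i g = (\<Sum>k. S i (Cb_scale (c k) (f k)))"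
      unfolding g_def by (rule bounded_linear.suminf[OF lin(2) sm])
    moreover have "summable (\<lambda>k. S i (Cb_scale (c k) (f k)))"
      by (rule bounded_linear.summable[OF lin(2) sm])
    ultimately have "apply_bcontfun (S i g) x = (\<Sum>k. apply_bcontfun (S i (Cb_scale (c k) (f k))) x)"
      by (simp add: bounded_linear.suminf[OF bounded_linear_apply_bcontfun])
    then show ?thesis by (simp add: linear_Cb_scale(2)[OF lin(1)])
  qed
  ultimately show False
    using C norm_bounded[of "S i g" x] by (metis not_le order_trans)
qed

section \<open>Weakly continuous operators\<close>

lemma topology_generated_by_nbhd:
  assumes "openin (topology_generated_by \<S>) U" "x \<in> U"
  shows "\<exists>F. finite F \<and> F \<subseteq> \<S> \<and> x \<in> \<Inter>F \<and> \<Inter>F \<subseteq> U"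
proof -
  have "generate_topology_on \<S> U" using assms(1) by (rule openin_topology_generated_by)
  then show ?thesis using assms(2)
  proof induction
    case Empty then show ?case by simp
  next
    case (Int a b)
    then obtain F G where "finite F" "F \<subseteq> \<S>" "x \<in> \<Inter>F" "\<Inter>F \<subseteq> a" "finite G" "G \<subseteq> \<S>" "x \<in> \<Inter>G" "\<Inter>G \<subseteq> b"
      by (metis IntE)
    then show ?case by (intro exI[of _ "F \<union> G"]) auto
  next
    case (UN K)
    then obtain k where "k \<in> K" "x \<in> k" by auto
    then obtain F where "finite F" "F \<subseteq> \<S>" "x \<in> \<Inter>F" "\<Inter>F \<subseteq> k" using UN.IH by meson
    then show ?case using \<open>k \<in> K\<close> by (intro exI[of _ F]) auto
  next
    case (Basis s)
    then show ?case by (intro exI[of _ "{s}"]) auto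
  qed
qed

text \<open>Complex linearity is spelled out through \<open>Cb_scale\<close>, since the vector space
  structure of the type has real scalars.\<close>

definition Cb_functional :: "(('e::topological_space \<Rightarrow>\<^sub>C complex) \<Rightarrow> complex) \<Rightarrow> bool" where
  "Cb_functional L \<longleftrightarrow> (\<forall>f g. L (f + g) = L f + L g) \<and> (\<forall>c f. L (Cb_scale c f) = c * L f)"

lemma Cb_functional_in_span:
  assumes "finite Y" "\<And>y. y \<in> Y \<Longrightarrow> Cb_functional (p y)" "Cb_functional L"
    "\<And>f. (\<forall>y\<in>Y. p y f = 0) \<Longrightarrow> L f = 0"
  shows "\<exists>a. \<forall>f. L f = (\<Sum>y\<in>Y. a y * p y f)"
  using assms
proof (induction Y arbitrary: L rule: finite_induct)
  case empty
  then show ?case by simp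
next
  case (insert z Y)
  show ?case
  proof (cases "\<forall>f. (\<forall>y\<in>Y. p y f = 0) \<longrightarrow> p z f = 0")
    case True
    have "\<exists>a. \<forall>f. L f = (\<Sum>y\<in>Y. a y * p y f)"
      using True insert.prems by (intro insert.IH) auto
    then obtain a where a: "\<forall>f. L f = (\<Sum>y\<in>Y. a y * p y f)" ..
    have "L f = (\<Sum>y\<in>insert z Y. (a(z := 0)) y * p y f)" for f
    proof -
      have "(\<Sum>y\<in>Y. a y * p y f) = (\<Sum>y\<in>Y. (a(z := 0)) y * p y f)"
        using insert.hyps by (intro sum.cong) auto
      then show ?thesis using insert.hyps a by simp
    qed
    then show ?thesis by blast
  next
    case False
    then obtain f0 where f0: "\<forall>y\<in>Y. p y f0 = 0" "p z f0 \<noteq> 0" by auto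
    define b where "b = L f0 / p z f0"
    have "\<exists>a. \<forall>f. L f - b * p z f = (\<Sum>y\<in>Y. a y * p y f)"
    proof (rule insert.IH)
      show "Cb_functional (\<lambda>f. L f - b * p z f)"
        using insert.prems by (auto simp: Cb_functional_def algebra_simps)
      fix f assume f: "\<forall>y\<in>Y. p y f = 0"
      \<comment> \<open>The multiple of f0 moves f into the kernel of p z without leaving the
        kernels of the other functionals.\<close>
      define h where "h = f + Cb_scale (- (p z f / p z f0)) f0"
      have "p y h = p y f - p z f / p z f0 * p y f0" if "y \<in> insert z Y" for y
        using insert.prems(1)[OF that] by (simp add: h_def Cb_functional_def)
      then have "\<forall>y\<in>insert z Y. p y h = 0" using f f0 by auto
      then have "L h = 0" by (rule insert.prems(3))
      moreover have "L h = L f - p z f / p z f0 * L f0"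
        using insert.prems(2) by (simp add: h_def Cb_functional_def)
      ultimately show "L f - b * p z f = 0" by (simp add: b_def)
    qed (use insert.prems in auto)
    then obtain a where a: "\<forall>f. L f - b * p z f = (\<Sum>y\<in>Y. a y * p y f)" ..
    have "L f = (\<Sum>y\<in>insert z Y. (a(z := b)) y * p y f)" for f
    proof -
      have "(\<Sum>y\<in>Y. a y * p y f) = (\<Sum>y\<in>Y. (a(z := b)) y * p y f)"
        using insert.hyps by (intro sum.cong) auto
      then show ?thesis using insert.hyps a[rule_format, of f] by (simp add: algebra_simps)
    qed
    then show ?thesis by blast
  qed
qed

lemma Cb_functional_pairing:
  assumes "\<mu> \<in> radon_measures" shows "Cb_functional (\<lambda>f. Cb_pairing f \<mu>)"
proof -
  note nf = normal_functional_integral[OF radon_complex_measure[OF assms]]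
  have "apply_bcontfun (f + g) = (\<lambda>x. apply_bcontfun f x + apply_bcontfun g x)"
    "apply_bcontfun (Cb_scale c f) = (\<lambda>x. c * apply_bcontfun f x)" for f g :: "'a \<Rightarrow>\<^sub>C complex" and c
    by (auto simp: plus_bcontfun.rep_eq)
  then show ?thesis
    by (simp add: Cb_functional_def Cb_pairing_def normal_functionalD[OF nf] bcontfun_bounded_borel)
qed

lemma Cb_pairing_bounded:
  fixes \<mu> :: "'e::t2_space set \<Rightarrow> complex"
  assumes "\<mu> \<in> radon_measures"
  shows "\<exists>K\<ge>0. \<forall>f. norm (Cb_pairing f \<mu>) \<le> K * norm f"
proof -
  obtain K where K: "K \<ge> 0" "\<And>f C. f \<in> borel_measurable borel \<Longrightarrow> (\<And>x. norm (f x) \<le> C) \<Longrightarrow>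
       norm (complex_measure_integral f \<mu>) \<le> K * C"
    by (rule integral_bounded[OF radon_complex_measure[OF assms]]) blast
  have "norm (Cb_pairing f \<mu>) \<le> K * norm f" for f
    unfolding Cb_pairing_def
    by (intro K(2) bounded_borelD(1) bcontfun_bounded_borel norm_bounded)
  then show ?thesis using K(1) by blast
qed

lemma radon_finite_combination:
  fixes Y :: "('e::t2_space set \<Rightarrow> complex) set"
  assumes "finite Y" "Y \<subseteq> radon_measures"
  shows "\<exists>\<rho>\<in>radon_measures. \<forall>f. Cb_pairing f \<rho> = (\<Sum>y\<in>Y. a y * Cb_pairing f y)"
  using assms
proof (induction Y)
  case empty
  obtain \<mu> :: "'e set \<Rightarrow> complex" where "\<mu> \<in> radon_measures" using radon_dirac by blast
  from radon_linear_combination[OF this this, of 0 0]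
  obtain \<rho> :: "'e set \<Rightarrow> complex" where \<rho>: "\<rho> \<in> radon_measures"
    "\<forall>f\<in>bounded_borel. complex_measure_integral f \<rho> = 0" by auto
  then have "\<forall>f. Cb_pairing f \<rho> = 0" by (simp add: Cb_pairing_def bcontfun_bounded_borel)
  with \<rho>(1) show ?case by auto
next
  case (insert z Y)
  then obtain \<rho> where \<rho>: "\<rho> \<in> radon_measures" "\<forall>f. Cb_pairing f \<rho> = (\<Sum>y\<in>Y. a y * Cb_pairing f y)"
    by auto
  have "z \<in> radon_measures" using insert by simp
  from radon_linear_combination[OF this \<rho>(1), of "a z" 1]
  obtain \<nu> where "\<nu> \<in> radon_measures" "\<forall>f. Cb_pairing f \<nu> = a z * Cb_pairing f z + Cb_pairing f \<rho>"
    by (auto simp: Cb_pairing_def bcontfun_bounded_borel)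
  then show ?case using insert \<rho> by auto
qed

abbreviation Cb_weak_topology :: "('e::t2_space \<Rightarrow>\<^sub>C complex) topology" where
  "Cb_weak_topology \<equiv> weak_topology radon_measures Cb_pairing"

abbreviation Cb_operators :: "(('e::t2_space \<Rightarrow>\<^sub>C complex) \<Rightarrow> ('e \<Rightarrow>\<^sub>C complex)) set" where
  "Cb_operators \<equiv> weak_operators Cb_scale radon_measures Cb_pairing"

lemma openin_weak_topology:
  assumes "y \<in> Y" "open U" shows "openin (weak_topology Y p) {x. p x y \<in> U}"
  unfolding weak_topology_def using assms by (intro topology_generated_by_Basis) auto

lemma topspace_weak: "Y \<noteq> {} \<Longrightarrow> topspace (weak_topology Y p) = UNIV"
  by (auto simp: weak_topology_def intro!: exI[of _ UNIV])

lemma radon_measures_nonempty: "(radon_measures :: ('e::t2_space set \<Rightarrow> complex) set) \<noteq> {}"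
  using radon_dirac by blast

text \<open>Pairing S f with \<mu> gives a weakly continuous L, which is below 1 in norm on a
  neighbourhood of 0 containing the common kernel of finitely many measures. By scaling L vanishes
  on this kernel, so it is a linear combination of those measures.\<close>

lemma weak_operator_adjoint:
  fixes S :: "('e::t2_space \<Rightarrow>\<^sub>C complex) \<Rightarrow> ('e \<Rightarrow>\<^sub>C complex)"
  assumes S: "S \<in> Cb_operators" and \<mu>: "\<mu> \<in> radon_measures"
  shows "\<exists>\<nu>\<in>radon_measures. \<forall>f. Cb_pairing (S f) \<mu> = Cb_pairing f \<nu>"
proof -
  have lin: "Vector_Spaces.linear Cb_scale Cb_scale S"
    and cont: "continuous_map Cb_weak_topology Cb_weak_topology S"
    using S by (auto simp: weak_operators_def)
  define L where "L f = Cb_pairing (S f) \<mu>" for f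
  have L: "Cb_functional L"
    using Cb_functional_pairing[OF \<mu>] by (simp add: Cb_functional_def L_def linear_Cb_scale[OF lin])
  have L0: "L 0 = 0" using L by (metis Cb_functional_def add_cancel_right_right)
  have "openin Cb_weak_topology {f. Cb_pairing f \<mu> \<in> ball 0 1}"
    by (intro openin_weak_topology \<mu> open_ball)
  then have "openin Cb_weak_topology {f \<in> topspace Cb_weak_topology. S f \<in> {f. Cb_pairing f \<mu> \<in> ball 0 1}}"
    using cont openin_continuous_map_preimage by blast
  then have "openin Cb_weak_topology {f. norm (L f) < 1}"
    by (simp add: topspace_weak[OF radon_measures_nonempty] L_def)
  from topology_generated_by_nbhd[OF this[unfolded weak_topology_def], of 0]
  obtain F where F: "finite F" "F \<subseteq> {{x. Cb_pairing x y \<in> U} |y U. y \<in> radon_measures \<and> open U}"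
    "0 \<in> \<Inter>F" "\<Inter>F \<subseteq> {f. norm (L f) < 1}" using L0 by auto
  have "\<forall>A\<in>F. \<exists>y. y \<in> radon_measures \<and> (\<forall>f. Cb_pairing f y = 0 \<longrightarrow> f \<in> A)"
  proof
    fix A assume "A \<in> F"
    then obtain y U where A: "A = {x. Cb_pairing x y \<in> U}" "y \<in> radon_measures" using F(2) by auto
    have "Cb_pairing 0 y = 0"
      using Cb_functional_pairing[OF A(2)] by (metis Cb_functional_def add_cancel_right_right)
    moreover have "0 \<in> A" using F(3) \<open>A \<in> F\<close> by auto
    ultimately have "0 \<in> U" using A by simp
    then show "\<exists>y. y \<in> radon_measures \<and> (\<forall>f. Cb_pairing f y = 0 \<longrightarrow> f \<in> A)"
      using A by (intro exI[of _ y]) auto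
  qed
  then obtain y where y: "\<And>A. A \<in> F \<Longrightarrow> y A \<in> radon_measures"
    "\<And>A f. A \<in> F \<Longrightarrow> Cb_pairing f (y A) = 0 \<Longrightarrow> f \<in> A" by metis
  define Y where "Y = y ` F"
  have Y: "finite Y" "Y \<subseteq> radon_measures" using F y by (auto simp: Y_def)
  have ker: "L f = 0" if f: "\<forall>\<nu>\<in>Y. Cb_pairing f \<nu> = 0" for f
  proof (rule ccontr)
    assume "L f \<noteq> 0"
    have "Cb_pairing (Cb_scale (1 / L f) f) (y A) = 0" if "A \<in> F" for A
      using f that Cb_functional_pairing[OF y(1)[OF that]] by (simp add: Y_def Cb_functional_def)
    then have "Cb_scale (1 / L f) f \<in> \<Inter>F" using y(2) by auto
    then have "norm (L (Cb_scale (1 / L f) f)) < 1" using F(4) by auto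
    moreover have "L (Cb_scale (1 / L f) f) = 1"
      using L \<open>L f \<noteq> 0\<close> by (simp add: Cb_functional_def)
    ultimately show False by simp
  qed
  have "\<exists>a. \<forall>f. L f = (\<Sum>\<nu>\<in>Y. a \<nu> * Cb_pairing f \<nu>)"
    using Y ker by (intro Cb_functional_in_span L) (auto intro!: Cb_functional_pairing)
  then obtain a where a: "\<forall>f. L f = (\<Sum>\<nu>\<in>Y. a \<nu> * Cb_pairing f \<nu>)" ..
  obtain \<rho> where "\<rho> \<in> radon_measures" "\<forall>f. Cb_pairing f \<rho> = (\<Sum>y\<in>Y. a y * Cb_pairing f y)"
    using radon_finite_combination[OF Y, of a] by blast
  then show ?thesis using a by (intro bexI[of _ \<rho>]) (simp_all add: L_def)
qed

text \<open>Converse of \<open>weak_operator_adjoint\<close>: the preimage of a subbasic set is the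
  subbasic set of the adjoint measure.\<close>

lemma weak_operatorI:
  fixes S :: "('e::t2_space \<Rightarrow>\<^sub>C complex) \<Rightarrow> ('e \<Rightarrow>\<^sub>C complex)"
  assumes "Vector_Spaces.linear Cb_scale Cb_scale S"
    and adj: "\<And>\<mu>. \<mu> \<in> radon_measures \<Longrightarrow> \<exists>\<nu>\<in>radon_measures. \<forall>f. Cb_pairing (S f) \<mu> = Cb_pairing f \<nu>"
  shows "S \<in> Cb_operators"
proof -
  have "continuous_map Cb_weak_topology (topology_generated_by
      {{x. Cb_pairing x y \<in> U} | y U. y \<in> radon_measures \<and> open U}) S"
  proof (rule continuous_on_generated_topo)
    fix V assume "V \<in> {{x :: 'e \<Rightarrow>\<^sub>C complex. Cb_pairing x y \<in> U} | y U. y \<in> radon_measures \<and> open U}"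
    then obtain y U where V: "V = {x. Cb_pairing x y \<in> U}" "y \<in> radon_measures" "open U" by auto
    obtain \<nu> where \<nu>: "\<nu> \<in> radon_measures" "\<forall>f. Cb_pairing (S f) y = Cb_pairing f \<nu>"
      using adj[OF V(2)] ..
    then have "S -` V \<inter> topspace Cb_weak_topology = {f. Cb_pairing f \<nu> \<in> U}"
      by (auto simp: topspace_weak[OF radon_measures_nonempty] V)
    then show "openin Cb_weak_topology (S -` V \<inter> topspace Cb_weak_topology)"
      using openin_weak_topology[OF \<nu>(1) V(3)] by simp
  next
    have "\<Union>{{x :: 'e \<Rightarrow>\<^sub>C complex. Cb_pairing x y \<in> U} | y U. y \<in> radon_measures \<and> open U} = UNIV"
      using topspace_weak[OF radon_measures_nonempty, of Cb_pairing]
      by (simp add: weak_topology_def)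
    then show "S ` topspace Cb_weak_topology \<subseteq>
        \<Union>{{x. Cb_pairing x y \<in> U} | y U. y \<in> radon_measures \<and> open U}" by simp
  qed
  then show ?thesis using assms(1) by (simp add: weak_operators_def weak_topology_def)
qed

lemma linear_norm_le_of_unit_ball:
  fixes S :: "'a::real_normed_vector \<Rightarrow> 'b::real_normed_vector"
  assumes "linear S" and C: "\<And>f. norm f \<le> 1 \<Longrightarrow> norm (S f) \<le> C"
  shows "norm (S f) \<le> C * norm f"
proof (cases "f = 0")
  case False
  interpret S: linear S by fact
  have "norm (S (inverse (norm f) *\<^sub>R f)) \<le> C" using False by (intro C) simp
  then have "inverse (norm f) * norm (S f) \<le> C" by (simp add: S.scale)
  then show ?thesis using False by (simp add: field_simps)
qed (simp add: linear_0[OF assms(1)])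

text \<open>Each \<mu> is bounded on the image of the unit ball, because the adjoint measure is a
  norm bounded functional; \<open>weakly_bounded_imp_bounded\<close> turns this into a norm
  bound.\<close>

lemma weak_operator_bounded:
  fixes S :: "('e::t2_space \<Rightarrow>\<^sub>C complex) \<Rightarrow> ('e \<Rightarrow>\<^sub>C complex)"
  assumes S: "S \<in> Cb_operators"
  shows "bounded_linear S"
proof -
  have lin: "Vector_Spaces.linear Cb_scale Cb_scale S" using S by (auto simp: weak_operators_def)
  interpret S: linear S by (rule linear_Cb_scale(3)[OF lin])
  have "\<exists>C. \<forall>g\<in>S ` {f. norm f \<le> 1}. norm g \<le> C"
  proof (rule weakly_bounded_imp_bounded)
    fix \<mu> :: "'e set \<Rightarrow> complex" assume "\<mu> \<in> radon_measures"
    then obtain \<nu> where \<nu>: "\<nu> \<in> radon_measures" "\<forall>f. Cb_pairing (S f) \<mu> = Cb_pairing f \<nu>"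
      using weak_operator_adjoint[OF S] by blast
    obtain K where K: "K \<ge> 0" "\<forall>f. norm (Cb_pairing f \<nu>) \<le> K * norm f"
      using Cb_pairing_bounded[OF \<nu>(1)] by blast
    have "norm (Cb_pairing (S f) \<mu>) \<le> K" if "norm f \<le> 1" for f
      using K \<nu>(2) that mult_left_le[of "norm f" K] order_trans by fastforce
    then show "\<exists>C. \<forall>f\<in>S ` {f. norm f \<le> 1}. norm (Cb_pairing f \<mu>) \<le> C" by blast
  qed
  then obtain C where C: "\<And>f. norm f \<le> 1 \<Longrightarrow> norm (S f) \<le> C" by auto
  show ?thesis
    using linear_norm_le_of_unit_ball[OF linear_Cb_scale(3)[OF lin] C]
    by (intro bounded_linear_intro[of _ C]) (simp_all add: S.add S.scale mult.commute)
qed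

section \<open>Weakly continuous semigroups\<close>

text \<open>The added 1 puts every grid point strictly to the right of t, the side on which the
  semigroup is known to be continuous; \<open>Suc n\<close> avoids division by 0.\<close>

lemma tendsto_floor_grid:
  fixes t :: real
  shows "filterlim (\<lambda>n. (of_int \<lfloor>real (Suc n) * t\<rfloor> + 1) / real (Suc n)) (at_right t) sequentially"
proof -
  have b: "t < (of_int \<lfloor>real (Suc n) * t\<rfloor> + 1) / real (Suc n)"
      "(of_int \<lfloor>real (Suc n) * t\<rfloor> + 1) / real (Suc n) \<le> t + 1 / real (Suc n)" for n
  proof -
    have "real (Suc n) * t < of_int \<lfloor>real (Suc n) * t\<rfloor> + 1" "of_int \<lfloor>real (Suc n) * t\<rfloor> \<le> real (Suc n) * t"
      by linarith+
    then show "t < (of_int \<lfloor>real (Suc n) * t\<rfloor> + 1) / real (Suc n)"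
      "(of_int \<lfloor>real (Suc n) * t\<rfloor> + 1) / real (Suc n) \<le> t + 1 / real (Suc n)"
      by (simp_all add: field_simps del: of_nat_Suc)
  qed
  have "(\<lambda>n. (of_int \<lfloor>real (Suc n) * t\<rfloor> + 1) / real (Suc n)) \<longlonglongrightarrow> t"
  proof (rule tendsto_sandwich[where f="\<lambda>_. t" and h="\<lambda>n. t + 1 / real (Suc n)"])
    show "(\<lambda>n. t + 1 / real (Suc n)) \<longlonglongrightarrow> t"
      using LIMSEQ_inverse_real_of_nat_add by (simp add: inverse_eq_divide)
    show "(\<lambda>n. t) \<longlonglongrightarrow> t" by simp
  qed (use b less_imp_le in \<open>blast intro: always_eventually\<close>)+
  then show ?thesis
    using b(1) by (auto simp: filterlim_at less_imp_neq[THEN not_sym] simp del: of_nat_Suc)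
qed

locale Cb_semigroup =
  fixes T :: "real \<Rightarrow> ('e::t2_space \<Rightarrow>\<^sub>C complex) \<Rightarrow> ('e \<Rightarrow>\<^sub>C complex)"
  assumes semigroup: "operator_semigroup Cb_scale radon_measures Cb_pairing T"
    and continuous_0: "weakly_continuous_at_0 radon_measures Cb_pairing T"
begin

lemma operator: "t \<ge> 0 \<Longrightarrow> T t \<in> Cb_operators"
  and T_add: "t \<ge> 0 \<Longrightarrow> s \<ge> 0 \<Longrightarrow> T (t + s) f = T t (T s f)"
  and T_0 [simp]: "T 0 f = f"
  using semigroup by (auto simp: operator_semigroup_def)

lemma T_linear: "t \<ge> 0 \<Longrightarrow> Vector_Spaces.linear Cb_scale Cb_scale (T t)"
  using operator by (auto simp: weak_operators_def)

lemma T_bounded_linear: "t \<ge> 0 \<Longrightarrow> bounded_linear (T t)"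
  using operator by (rule weak_operator_bounded)

lemma weakly_right_continuous_0:
  assumes "\<mu> \<in> radon_measures"
  shows "((\<lambda>t. Cb_pairing (T t f) \<mu>) \<longlongrightarrow> Cb_pairing f \<mu>) (at_right 0)"
proof (rule topological_tendstoI)
  fix U :: "complex set" assume U: "open U" "Cb_pairing f \<mu> \<in> U"
  have "limitin Cb_weak_topology (\<lambda>t. T t f) f (at_right 0)"
    using continuous_0 by (simp add: weakly_continuous_at_0_def)
  moreover have "openin Cb_weak_topology {f. Cb_pairing f \<mu> \<in> U}"
    by (rule openin_weak_topology[OF assms U(1)])
  ultimately have "\<forall>\<^sub>F t in at_right 0. T t f \<in> {f. Cb_pairing f \<mu> \<in> U}"
    using U(2) unfolding limitin_def by blast
  then show "\<forall>\<^sub>F t in at_right 0. Cb_pairing (T t f) \<mu> \<in> U" by simp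
qed

text \<open>The semigroup law reduces the claim to continuity at 0 for the function T t f. The
  argument reaches t from the right only, which is why all later approximations of times come from
  that side.\<close>

lemma weakly_right_continuous:
  assumes "\<mu> \<in> radon_measures" "t \<ge> 0"
  shows "((\<lambda>s. Cb_pairing (T s f) \<mu>) \<longlongrightarrow> Cb_pairing (T t f) \<mu>) (at_right t)"
proof -
  have "\<forall>\<^sub>F h in at_right 0. Cb_pairing (T h (T t f)) \<mu> = Cb_pairing (T (h + t) f) \<mu>"
    using eventually_at_right_less[of 0] assms(2) by (auto elim!: eventually_mono simp: T_add)
  from Lim_transform_eventually[OF weakly_right_continuous_0[OF assms(1), of "T t f"] this]
  show ?thesis by (subst filterlim_at_right_to_0)
qed

lemma pointwise_right_continuous:
  assumes "t \<ge> 0"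
  shows "((\<lambda>s. apply_bcontfun (T s f) x) \<longlongrightarrow> apply_bcontfun (T t f) x) (at_right t)"
proof -
  obtain \<rho> where \<rho>: "\<rho> \<in> radon_measures" "\<forall>f\<in>bounded_borel. complex_measure_integral f \<rho> = f x"
    using radon_dirac[of x] by blast
  show ?thesis
    using weakly_right_continuous[OF \<rho>(1) assms, of f] \<rho>(2)
    by (simp add: Cb_pairing_def bcontfun_bounded_borel)
qed

text \<open>Otherwise operators at times t n tending to 0 take values of norm above n + 1 on the
  unit ball. But T (t n) g converges weakly to g, hence stays bounded for each g, which contradicts
  \<open>uniform_boundedness_Cb\<close>.\<close>

lemma bounded_near_0:
  "\<exists>\<delta>>0. \<exists>M\<ge>1. \<forall>t f. 0 \<le> t \<longrightarrow> t \<le> \<delta> \<longrightarrow> norm f \<le> 1 \<longrightarrow> norm (T t f) \<le> M"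
proof (rule ccontr)
  assume contra: "\<not> ?thesis"
  have "\<exists>t f. 0 \<le> t \<and> t \<le> 1 / real (Suc n) \<and> norm f \<le> 1 \<and> norm (T t f) > real (Suc n)" for n
  proof (rule ccontr)
    assume "\<not> (\<exists>t f. 0 \<le> t \<and> t \<le> 1 / real (Suc n) \<and> norm f \<le> 1 \<and> norm (T t f) > real (Suc n))"
    then have "1 / real (Suc n) > 0 \<and> (real (Suc n) \<ge> 1 \<and> (\<forall>t f. 0 \<le> t \<longrightarrow> t \<le> 1 / real (Suc n) \<longrightarrow>
        norm f \<le> 1 \<longrightarrow> norm (T t f) \<le> real (Suc n)))"
      by (auto simp: not_less)
    with contra show False by blast
  qed
  then obtain t f where tf: "\<And>n. 0 \<le> t n" "\<And>n. t n \<le> 1 / real (Suc n)" "\<And>n. norm (f n) \<le> 1"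
    "\<And>n. norm (T (t n) (f n)) > real (Suc n)"
    by metis
  \<comment> \<open>T 0 is the identity and cannot enlarge f n; so t approaches 0 through positive
    times, as \<open>at_right 0\<close> requires.\<close>
  have pos: "t n > 0" for n
  proof (rule ccontr)
    assume "\<not> t n > 0"
    then have "t n = 0" using tf(1)[of n] by simp
    then show False using tf(3,4)[of n] by simp
  qed
  have "t \<longlonglongrightarrow> 0"
  proof (rule tendsto_sandwich[where f="\<lambda>_. 0" and h="\<lambda>n. 1 / real (Suc n)"])
    show "(\<lambda>n. 1 / real (Suc n)) \<longlonglongrightarrow> 0" using LIMSEQ_inverse_real_of_nat by (simp add: inverse_eq_divide)
  qed (use tf in auto)
  then have t: "filterlim t (at_right 0) sequentially"
    using pos by (auto simp: filterlim_at less_imp_neq[THEN not_sym])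
  have "\<exists>C. \<forall>n g. norm g \<le> 1 \<longrightarrow> norm (T (t n) g) \<le> C"
  proof (rule uniform_boundedness_Cb)
    show "Vector_Spaces.linear Cb_scale Cb_scale (T (t n))" "bounded_linear (T (t n))" for n
      using tf(1) T_linear T_bounded_linear by auto
    fix g
    have "\<exists>C. \<forall>h\<in>range (\<lambda>n. T (t n) g). norm h \<le> C"
    proof (rule weakly_bounded_imp_bounded)
      fix \<mu> :: "'e set \<Rightarrow> complex" assume "\<mu> \<in> radon_measures"
      from filterlim_compose[OF weakly_right_continuous_0[OF this, of g] t]
      have "Bseq (\<lambda>n. Cb_pairing (T (t n) g) \<mu>)"
        by (intro convergent_imp_Bseq convergentI)
      then show "\<exists>C. \<forall>h\<in>range (\<lambda>n. T (t n) g). norm (Cb_pairing h \<mu>) \<le> C"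
        by (auto simp: Bseq_def)
    qed
    then show "\<exists>C. \<forall>n. norm (T (t n) g) \<le> C" by auto
  qed
  then obtain C where C: "\<And>n g. norm g \<le> 1 \<Longrightarrow> norm (T (t n) g) \<le> C" by auto
  obtain n where "real n > C" using reals_Archimedean2 by blast
  then show False using C[OF tf(3), of n n] tf(4)[of n] by simp
qed

text \<open>Let M bound the operators up to time \<delta>. Writing t as n * \<delta> plus a
  remainder gives the bound M * M ^ n with n at most t / \<delta>, and this is the origin of
  \<omega> = ln M / \<delta>.\<close>

lemma exponentially_bounded:
  "\<exists>M \<omega>. M \<ge> 1 \<and> (\<forall>t\<ge>0. \<forall>f. norm (T t f) \<le> M * exp (\<omega> * t) * norm f)"
proof -
  obtain \<delta> M where \<delta>: "\<delta> > 0" and M: "M \<ge> 1"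
    "\<And>t f. 0 \<le> t \<Longrightarrow> t \<le> \<delta> \<Longrightarrow> norm f \<le> 1 \<Longrightarrow> norm (T t f) \<le> M"
    using bounded_near_0 by blast
  have small: "norm (T t f) \<le> M * norm f" if "0 \<le> t" "t \<le> \<delta>" for t f
    using that M(2) bounded_linear.linear[OF T_bounded_linear]
    by (intro linear_norm_le_of_unit_ball) auto
  have pow: "norm (T (real n * \<delta>) f) \<le> M ^ n * norm f" for n f
  proof (induction n)
    case (Suc n)
    have "T (real (Suc n) * \<delta>) f = T \<delta> (T (real n * \<delta>) f)"
      using \<delta> by (subst T_add[symmetric]) (auto simp: algebra_simps)
    also have "norm \<dots> \<le> M * norm (T (real n * \<delta>) f)" using \<delta> by (intro small) auto
    also have "\<dots> \<le> M * (M ^ n * norm f)" using Suc M(1) by (intro mult_left_mono) auto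
    finally show ?case by (simp add: mult.assoc)
  qed simp
  have "norm (T t f) \<le> M * exp (ln M / \<delta> * t) * norm f" if "t \<ge> 0" for t f
  proof -
    define n where "n = nat \<lfloor>t / \<delta>\<rfloor>"
    have n: "real n \<le> t / \<delta>" "t / \<delta> < real n + 1"
      using that \<delta> unfolding n_def by (simp_all add: floor_correct)
    then have s: "0 \<le> t - real n * \<delta>" "t - real n * \<delta> \<le> \<delta>"
      using \<delta> by (auto simp: field_simps)
    have "norm (T ((t - real n * \<delta>) + real n * \<delta>) f) \<le> M * norm (T (real n * \<delta>) f)"
      using s \<delta> by (subst T_add) (auto intro!: small)
    also have "\<dots> \<le> M * (M ^ n * norm f)" using pow M(1) by (intro mult_left_mono) auto
    also have "M ^ n = exp (ln M * real n)"
      using M(1) by (simp add: exp_of_nat2_mult)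
    also have "exp (ln M * real n) \<le> exp (ln M / \<delta> * t)"
      using n(1) M(1) mult_left_mono[OF n(1), of "ln M"] by simp
    finally show ?thesis using M(1) by (simp add: mult_left_mono mult_right_mono mult.assoc)
  qed
  then show ?thesis using M(1) by (intro exI[of _ M] exI[of _ "ln M / \<delta>"]) auto
qed

text \<open>For each n the grid times form a countable set, and T f at a fixed grid time is
  continuous in x, so the approximations are measurable for the product sigma-algebra. They converge
  by right-continuity. The indicator removes negative times, where T is unspecified.\<close>

lemma orbit_measurable:
  "(\<lambda>p. indicator {0..} (fst p) *\<^sub>R apply_bcontfun (T (fst p) f) (snd p))
     \<in> borel_measurable (lborel \<Otimes>\<^sub>M borel)"
proof (rule borel_measurable_LIMSEQ_metric)
  fix n
  have "(\<lambda>p. apply_bcontfun (T ((of_int \<lfloor>real (Suc n) * fst p\<rfloor> + 1) / real (Suc n)) f) (snd p))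
      \<in> borel_measurable (lborel \<Otimes>\<^sub>M borel)"
  proof (rule measurable_compose_countable[where
        f="\<lambda>i p. apply_bcontfun (T ((of_int i + 1) / real (Suc n)) f) (snd p)" and
        g="\<lambda>p. \<lfloor>real (Suc n) * fst p\<rfloor>"])
    show "(\<lambda>p. apply_bcontfun (T ((of_int i + 1) / real (Suc n)) f) (snd p))
        \<in> borel_measurable (lborel \<Otimes>\<^sub>M borel)" for i
      by (rule measurable_compose[OF measurable_snd])
        (rule bounded_borelD(1)[OF bcontfun_bounded_borel])
    show "(\<lambda>p. \<lfloor>real (Suc n) * fst p\<rfloor>) \<in> measurable (lborel \<Otimes>\<^sub>M borel) (count_space UNIV)"
      by measurable
  qed
  then show "(\<lambda>p. indicator {0..} (fst p) *\<^sub>R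
      apply_bcontfun (T ((of_int \<lfloor>real (Suc n) * fst p\<rfloor> + 1) / real (Suc n)) f) (snd p))
      \<in> borel_measurable (lborel \<Otimes>\<^sub>M borel)"
    by measurable
next
  fix p :: "real \<times> 'e"
  show "(\<lambda>n. indicator {0..} (fst p) *\<^sub>R
      apply_bcontfun (T ((of_int \<lfloor>real (Suc n) * fst p\<rfloor> + 1) / real (Suc n)) f) (snd p))
    \<longlonglongrightarrow> indicator {0..} (fst p) *\<^sub>R apply_bcontfun (T (fst p) f) (snd p)"
  proof (cases "fst p \<ge> 0")
    case True
    show ?thesis
      by (intro tendsto_intros
        filterlim_compose[OF pointwise_right_continuous[OF True] tendsto_floor_grid])
  qed simp
qed

end

section \<open>Integrating families of measures\<close>

text \<open>Fubini is applied to each of the four finite measures behind the integral, with w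
  dominating uniformly in x.\<close>

lemma
  fixes \<mu> :: "'e::topological_space set \<Rightarrow> complex" and G :: "real \<Rightarrow> 'e \<Rightarrow> complex"
  assumes \<mu>: "complex_borel_measure \<mu>"
    and G: "(\<lambda>p. G (fst p) (snd p)) \<in> borel_measurable (lborel \<Otimes>\<^sub>M borel)"
    and w: "integrable lborel w" "\<And>t x. norm (G t x) \<le> w t"
  shows integrable_integral: "integrable lborel (\<lambda>t. complex_measure_integral (G t) \<mu>)"
    and integral_fubini:
      "complex_measure_integral (\<lambda>x. LINT t|lborel. G t x) \<mu> =
         (LINT t|lborel. complex_measure_integral (G t) \<mu>)"
proof -
  have Gt: "(\<lambda>x. G t x) \<in> borel_measurable borel" for t
    using measurable_compose[OF _ G, of "\<lambda>x. (t, x)" borel] by simp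
  have Gb: "G t \<in> bounded_borel" for t using w(2) Gt by (intro bounded_borelI)
  have P: "integrable lborel (\<lambda>t. LINT x|positive_variation \<nu>. G t x) \<and>
      (LINT x|positive_variation \<nu>. (LINT t|lborel. G t x)) = (LINT t|lborel. (LINT x|positive_variation \<nu>. G t x))"
    if \<nu>: "sigma_additive \<nu>" for \<nu>
  proof -
    interpret F: finite_measure "positive_variation \<nu>"
      by (rule finite_positive_variation[OF \<nu>])
    interpret pair_sigma_finite lborel "positive_variation \<nu>" ..
    have Gm: "(\<lambda>p. G (fst p) (snd p)) \<in> borel_measurable (lborel \<Otimes>\<^sub>M positive_variation \<nu>)"
      using G by (simp cong: measurable_cong_sets sets_pair_measure_cong)
    have "integrable (lborel \<Otimes>\<^sub>M positive_variation \<nu>) (\<lambda>p. G (fst p) (snd p))"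
    proof (rule Fubini_integrable[OF Gm])
      have "integrable (positive_variation \<nu>) (\<lambda>x. norm (G t x))" for t
        using integrable_bounded_borel[OF \<nu> Gb] by (rule integrable_norm)
      then have le: "(LINT x|positive_variation \<nu>. norm (G t x)) \<le> w t * measure (positive_variation \<nu>) UNIV" for t
        using integral_mono[of "positive_variation \<nu>" "\<lambda>x. norm (G t x)" "\<lambda>_. w t"] w(2)
        by (simp add: mult.commute)
      show "integrable lborel (\<lambda>t. LINT x|positive_variation \<nu>. norm (G (fst (t, x)) (snd (t, x))))"
      proof (rule Bochner_Integration.integrable_bound)
        show "integrable lborel (\<lambda>t. w t * measure (positive_variation \<nu>) UNIV)" using w(1) by simp
        show "(\<lambda>t. LINT x|positive_variation \<nu>. norm (G (fst (t, x)) (snd (t, x)))) \<in> borel_measurable lborel"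
          using Gm by (intro F.borel_measurable_lebesgue_integral) (simp add: case_prod_beta')
        show "AE t in lborel. norm (LINT x|positive_variation \<nu>. norm (G (fst (t, x)) (snd (t, x))))
            \<le> norm (w t * measure (positive_variation \<nu>) UNIV)"
          using order_trans[OF le abs_ge_self] by (intro always_eventually) simp
      qed
      show "AE t in lborel. integrable (positive_variation \<nu>) (\<lambda>x. G (fst (t, x)) (snd (t, x)))"
        using integrable_bounded_borel[OF \<nu> Gb] by simp
    qed
    then have "integrable (lborel \<Otimes>\<^sub>M positive_variation \<nu>) (case_prod G)"
      by (simp add: case_prod_beta')
    from Fubini_integral[OF this] integrable_fst[OF this] show ?thesis by simp
  qed
  note Ps = complex_measureD(2-5)[OF \<mu>, THEN P]
  show "integrable lborel (\<lambda>t. complex_measure_integral (G t) \<mu>)"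
    unfolding complex_measure_integral_def using Ps by auto
  show "complex_measure_integral (\<lambda>x. LINT t|lborel. G t x) \<mu> =
      (LINT t|lborel. complex_measure_integral (G t) \<mu>)"
    unfolding complex_measure_integral_def using Ps by simp
qed

section \<open>Integrated orbits\<close>

text \<open>The times are kept in type \<open>rat\<close>, so that points and measures can be
  handled in families indexed by a countable type.\<close>

lemma rationals_from_right:
  fixes t :: real
  assumes "t \<ge> 0"
  obtains r :: "nat \<Rightarrow> rat"
  where "\<And>n. r n \<ge> 0" "filterlim (\<lambda>n. of_rat (r n)) (at_right t) sequentially"
proof
  define r :: "nat \<Rightarrow> rat" where "r n = (of_int \<lfloor>real (Suc n) * t\<rfloor> + 1) / of_nat (Suc n)" for n
  have "\<lfloor>real (Suc n) * t\<rfloor> \<ge> 0" for n using \<open>t \<ge> 0\<close> by simp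
  then show "r n \<ge> 0" for n by (simp add: r_def)
  have "(of_rat (r n) :: real) = (of_int \<lfloor>real (Suc n) * t\<rfloor> + 1) / real (Suc n)" for n
    by (simp add: r_def of_rat_divide of_rat_add del: of_nat_Suc)
  then show "filterlim (\<lambda>n. of_rat (r n)) (at_right t) sequentially"
    using tendsto_floor_grid[of t] by simp
qed

context Cb_semigroup
begin

section \<open>One orbit integrated against a weight\<close>

context
  fixes f :: "'e \<Rightarrow>\<^sub>C complex" and w :: "real \<Rightarrow> complex" and v :: "real \<Rightarrow> real"
  assumes w: "w \<in> borel_measurable lborel" "\<And>t. t < 0 \<Longrightarrow> w t = 0"
    and v: "integrable lborel v" "\<And>t. norm (w t) * norm (T t f) \<le> v t"
begin

lemma weighted_orbit_bound: "norm (w t * apply_bcontfun (T t f) x) \<le> v t"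
  using v(2)[of t] mult_left_mono[OF norm_bounded[of "T t f" x], of "norm (w t)"]
  by (simp add: norm_mult)

lemma weighted_orbit_measurable:
  "(\<lambda>p. w (fst p) * apply_bcontfun (T (fst p) f) (snd p)) \<in> borel_measurable (lborel \<Otimes>\<^sub>M borel)"
proof -
  have eq: "(\<lambda>p. w (fst p) * apply_bcontfun (T (fst p) f) (snd p)) =
      (\<lambda>p. w (fst p) * (indicator {0..} (fst p) *\<^sub>R apply_bcontfun (T (fst p) f) (snd p)))"
    using w(2) by (auto simp: indicator_def not_le)
  have "(\<lambda>p. w (fst p)) \<in> borel_measurable (lborel \<Otimes>\<^sub>M (borel :: 'e measure))"
    by (rule measurable_compose[OF measurable_fst w(1)])
  then show ?thesis
    unfolding eq by (intro borel_measurable_times orbit_measurable)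
qed

lemma weighted_orbit_measurable': "(\<lambda>t. w t * apply_bcontfun (T t f) x) \<in> borel_measurable lborel"
  using measurable_compose[OF _ weighted_orbit_measurable, of "\<lambda>t. (t, x)" lborel] by simp

text \<open>A plain function, because its continuity is the open question; integrals against
  measures make sense without it.\<close>

definition orbit_integral :: "'e \<Rightarrow> complex" where
  "orbit_integral x = (LINT t|lborel. w t * apply_bcontfun (T t f) x)"

lemma norm_orbit_integral_le: "norm (orbit_integral x) \<le> (LINT t|lborel. v t)"
  unfolding orbit_integral_def
proof (rule norm_LINT_le[OF _ v(1) weighted_orbit_bound])
  show "integrable lborel (\<lambda>t. w t * apply_bcontfun (T t f) x)"
    using weighted_orbit_measurable'
    by (rule Bochner_Integration.integrable_bound[OF v(1)])
      (auto intro!: AE_I2 order_trans[OF weighted_orbit_bound abs_ge_self])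
qed

lemma
  assumes "\<mu> \<in> radon_measures"
  shows integrable_orbit: "integrable lborel (\<lambda>t. w t * Cb_pairing (T t f) \<mu>)"
    and integral_orbit_integral:
      "complex_measure_integral orbit_integral \<mu> = (LINT t|lborel. w t * Cb_pairing (T t f) \<mu>)"
proof -
  note cb = radon_complex_measure[OF assms]
  have eq: "complex_measure_integral (\<lambda>x. w t * apply_bcontfun (T t f) x) \<mu> = w t * Cb_pairing (T t f) \<mu>" for t
    unfolding Cb_pairing_def
    by (rule normal_functionalD(2)[OF normal_functional_integral[OF cb]
          bcontfun_bounded_borel])
  show "integrable lborel (\<lambda>t. w t * Cb_pairing (T t f) \<mu>)"
    using integrable_integral[OF cb weighted_orbit_measurable v(1) weighted_orbit_bound]
    by (simp add: eq)
  show "complex_measure_integral orbit_integral \<mu> = (LINT t|lborel. w t * Cb_pairing (T t f) \<mu>)"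
    using integral_fubini[OF cb weighted_orbit_measurable v(1) weighted_orbit_bound]
    by (simp add: eq orbit_integral_def[abs_def])
qed

text \<open>Dominated convergence gives sequential continuity only. The two continuity proofs differ
  in how they get from there to continuity.\<close>

lemma orbit_integral_tendsto:
  assumes "\<And>t. t \<ge> 0 \<Longrightarrow> (\<lambda>n. apply_bcontfun (T t f) (y n)) \<longlonglongrightarrow> apply_bcontfun (T t f) x"
  shows "(\<lambda>n. orbit_integral (y n)) \<longlonglongrightarrow> orbit_integral x"
  unfolding orbit_integral_def
proof (rule integral_dominated_convergence[OF _ _ v(1)])
  have "(\<lambda>n. w t * apply_bcontfun (T t f) (y n)) \<longlonglongrightarrow> w t * apply_bcontfun (T t f) x" for t
  proof (cases "t \<ge> 0")
    case True
    then show ?thesis by (intro tendsto_intros assms)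
  qed (simp add: w(2))
  then show "AE t in lborel. (\<lambda>n. w t * apply_bcontfun (T t f) (y n)) \<longlonglongrightarrow> w t * apply_bcontfun (T t f) x"
    by simp
qed (simp_all only: weighted_orbit_measurable' weighted_orbit_bound AE_I2)

text \<open>If convergence fails at t, the bad points y n cluster at some z in K. Then z and x share
  their values at all rational times, hence at t by right-continuity, whereas clustering keeps the
  values at t at distance at least e.\<close>

lemma orbit_tendsto_of_rationals:
  assumes K: "compact K" "\<And>n. y n \<in> K"
    and lim: "\<And>q :: rat. q \<ge> 0 \<Longrightarrow>
      (\<lambda>n. apply_bcontfun (T (of_rat q) f) (y n)) \<longlonglongrightarrow> apply_bcontfun (T (of_rat q) f) x"
    and "t \<ge> 0"
  shows "(\<lambda>n. apply_bcontfun (T t f) (y n)) \<longlonglongrightarrow> apply_bcontfun (T t f) x"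
proof (rule tendstoI, rule ccontr)
  let ?u = "\<lambda>t x. apply_bcontfun (T t f) x"
  fix e :: real assume "e > 0"
  assume not: "\<not> (\<forall>\<^sub>F n in sequentially. dist (?u t (y n)) (?u t x) < e)"
  \<comment> \<open>A filter instead of a subsequence: compact subsets of E need not be sequentially
    compact.\<close>
  define F where "F = filtermap y (inf sequentially (principal {n. dist (?u t (y n)) (?u t x) \<ge> e}))"
  have "F \<noteq> bot"
    using not by (simp add: trivial_limit_def F_def eventually_filtermap eventually_inf_principal not_le)
  moreover have "eventually (\<lambda>z. z \<in> K) F"
    using K(2) by (simp add: F_def eventually_filtermap)
  ultimately obtain z where z: "z \<in> K" "inf (nhds z) F \<noteq> bot"
    using K(1) by (auto simp: compact_filter)
  let ?F = "inf (nhds z) F"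
  have at_z: "(?u s \<longlongrightarrow> ?u s z) ?F" for s
  proof -
    have "isCont (?u s) z"
      using continuous_on_eq_continuous_at[of UNIV "?u s"] continuous_on_apply_bcontfun[of UNIV "T s f"]
      by auto
    then have "(?u s \<longlongrightarrow> ?u s z) (nhds z)" by (simp add: isCont_def tendsto_at_iff_tendsto_nhds)
    then show ?thesis by (rule tendsto_mono[rotated]) simp
  qed
  have "F \<le> filtermap y sequentially"
    unfolding F_def by (intro filtermap_mono) simp
  then have le: "?F \<le> filtermap y sequentially" by (rule le_infI2)
  have rat: "?u (of_rat q) z = ?u (of_rat q) x" if "q \<ge> 0" for q :: rat
  proof (rule tendsto_unique[OF z(2) at_z])
    have "(?u (of_rat q) \<longlongrightarrow> ?u (of_rat q) x) (filtermap y sequentially)"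
      using lim[OF that] by (simp add: filterlim_filtermap)
    then show "(?u (of_rat q) \<longlongrightarrow> ?u (of_rat q) x) ?F" by (rule tendsto_mono[OF le])
  qed
  obtain r :: "nat \<Rightarrow> rat" where r: "\<And>n. r n \<ge> 0"
    "filterlim (\<lambda>n. of_rat (r n)) (at_right t) sequentially"
    using rationals_from_right[OF \<open>t \<ge> 0\<close>] by blast
  have rt: "(\<lambda>n. ?u (of_rat (r n)) p) \<longlonglongrightarrow> ?u t p" for p
    by (rule filterlim_compose[OF pointwise_right_continuous[OF \<open>t \<ge> 0\<close>] r(2)])
  have "?u t z = ?u t x"
    using rt[of z] rt[of x] rat[OF r(1)] by (simp add: LIMSEQ_unique)
  moreover have "e \<le> dist (?u t z) (?u t x)"
  proof (rule tendsto_lowerbound[OF _ _ z(2)])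
    show "((\<lambda>p. dist (?u t p) (?u t x)) \<longlongrightarrow> dist (?u t z) (?u t x)) ?F"
      by (intro tendsto_intros at_z)
    have "eventually (\<lambda>p. e \<le> dist (?u t p) (?u t x)) F"
      by (simp add: F_def eventually_filtermap eventually_inf_principal)
    then show "eventually (\<lambda>p. e \<le> dist (?u t p) (?u t x)) ?F"
      by (rule filter_leD[rotated]) simp
  qed
  ultimately show False using \<open>e > 0\<close> by simp
qed

text \<open>A discontinuity at x yields points y n of K whose orbit values at the first n rational
  times are within 1 / (n + 1) of those at x, while the integrals stay e apart. Countably many
  conditions suffice, although x may have no countable neighbourhood base.\<close>

lemma orbit_integral_continuous_compact:
  assumes K: "compact K"
  shows "continuous_on K orbit_integral"
  unfolding continuous_on_def
proof (intro ballI tendstoI, rule ccontr)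
  let ?u = "\<lambda>t x. apply_bcontfun (T t f) x"
  fix x and e :: real assume "x \<in> K" "e > 0"
  assume not: "\<not> (\<forall>\<^sub>F y in at x within K. dist (orbit_integral y) (orbit_integral x) < e)"
  \<comment> \<open>The enumeration includes negative rationals; this is harmless, since T f there
    is still a continuous function.\<close>
  define r :: "nat \<Rightarrow> real" where "r i = of_rat (from_nat i)" for i
  have "\<exists>y\<in>K. dist (orbit_integral y) (orbit_integral x) \<ge> e \<and>
      (\<forall>i<n. dist (?u (r i) y) (?u (r i) x) < 1 / real (Suc n))" for n
  proof (rule ccontr)
    assume none: "\<not> ?thesis"
    have "\<forall>\<^sub>F y in at x within K. \<forall>i\<in>{..<n}. dist (?u (r i) y) (?u (r i) x) < 1 / real (Suc n)"
    proof (intro eventually_ball_finite ballI)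
      fix i
      have "continuous_on K (?u (r i))" by (intro continuous_on_apply_bcontfun)
      then have "(?u (r i) \<longlongrightarrow> ?u (r i) x) (at x within K)"
        using \<open>x \<in> K\<close> by (simp add: continuous_on_def)
      then show "\<forall>\<^sub>F y in at x within K. dist (?u (r i) y) (?u (r i) x) < 1 / real (Suc n)"
        by (rule tendstoD) simp
    qed simp
    moreover have "\<forall>\<^sub>F y in at x within K. y \<in> K"
      by (simp add: eventually_at_filter)
    ultimately have "\<forall>\<^sub>F y in at x within K. dist (orbit_integral y) (orbit_integral x) < e"
      by eventually_elim (use none not_le in blast)
    with not show False ..
  qed
  then obtain y where y: "\<And>n. y n \<in> K" "\<And>n. dist (orbit_integral (y n)) (orbit_integral x) \<ge> e"
    "\<And>n i. i < n \<Longrightarrow> dist (?u (r i) (y n)) (?u (r i) x) < 1 / real (Suc n)"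
    by metis
  have rlim: "(\<lambda>n. ?u (of_rat q) (y n)) \<longlonglongrightarrow> ?u (of_rat q) x" for q :: rat
  proof -
    define i where "i = to_nat q"
    have ri: "r i = of_rat q" by (simp add: r_def i_def)
    have "(\<lambda>n. dist (?u (of_rat q) (y n)) (?u (of_rat q) x)) \<longlonglongrightarrow> 0"
    proof (rule tendsto_sandwich[where f="\<lambda>_. 0" and h="\<lambda>n. 1 / real (Suc n)"])
      show "\<forall>\<^sub>F n in sequentially. dist (?u (of_rat q) (y n)) (?u (of_rat q) x) \<le> 1 / real (Suc n)"
        by (rule eventually_mono[OF eventually_gt_at_top[of i]])
          (use y(3)[of i] in \<open>simp add: ri less_imp_le\<close>)
      show "(\<lambda>n. 1 / real (Suc n)) \<longlonglongrightarrow> 0" using LIMSEQ_inverse_real_of_nat by (simp add: inverse_eq_divide)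
    qed auto
    then show ?thesis by (rule tendsto_dist_iff[THEN iffD2])
  qed
  have lim: "(\<lambda>n. ?u t (y n)) \<longlonglongrightarrow> ?u t x" if "t \<ge> 0" for t
    by (rule orbit_tendsto_of_rationals[where y=y and x=x and K=K])
      (simp_all only: K y(1) rlim that)
  have "(\<lambda>n. orbit_integral (y n)) \<longlonglongrightarrow> orbit_integral x"
    by (rule orbit_integral_tendsto[where y=y and x=x]) (rule lim)
  then have "\<forall>\<^sub>F n in sequentially. dist (orbit_integral (y n)) (orbit_integral x) < e"
    using \<open>e > 0\<close> by (rule tendstoD)
  then obtain n where "dist (orbit_integral (y n)) (orbit_integral x) < e"
    by (auto simp: eventually_sequentially)
  then show False using y(2)[of n] by simp
qed

end

end

section \<open>Complete strict topologies\<close>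

text \<open>Without an upper bound the real supremum in the seminorm would carry no
  information.\<close>

lemma bounded_weighted_range:
  fixes \<phi> :: "'e::topological_space \<Rightarrow> complex"
  assumes "bounded (range \<phi>)"
  shows "bdd_above (range (\<lambda>x. norm (\<phi> x * apply_bcontfun f x)))"
proof -
  obtain B where B: "\<And>x. norm (\<phi> x) \<le> B" using assms by (auto simp: bounded_iff)
  have "norm (\<phi> x * apply_bcontfun f x) \<le> B * norm f" for x
    unfolding norm_mult using B order_trans[OF norm_ge_zero B] by (intro mult_mono norm_bounded) auto
  then show ?thesis by (rule bdd_aboveI2)
qed

text \<open>Tietze extension from compact sets is where complete regularity enters. It is applied to
  real and imaginary part with values in [-C, C], whence the bound 2 * C.\<close>

lemma Tietze_complex_bcontfun:
  fixes g :: "'e::t2_space \<Rightarrow> complex"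
  assumes cr: "completely_regular_space (euclidean :: 'e topology)"
    and K: "compact K" "continuous_on K g" and C: "\<And>x. norm (g x) \<le> C"
  shows "\<exists>h :: 'e \<Rightarrow>\<^sub>C complex. (\<forall>x\<in>K. apply_bcontfun h x = g x) \<and> norm h \<le> 2 * C"
proof -
  have "C \<ge> 0" using C norm_ge_zero order_trans by blast
  have ext: "\<exists>h. continuous_on UNIV h \<and> range h \<subseteq> {-C..C} \<and> (\<forall>x\<in>K. h x = k x)"
    if k: "continuous_on K k" "\<And>x. \<bar>k x\<bar> \<le> C" for k :: "'e \<Rightarrow> real"
  proof -
    have "k ` K \<subseteq> {-C..C}" using k(2) by (auto simp: abs_le_iff minus_le_iff)
    then obtain h where "continuous_map euclidean euclideanreal h"
      "h ` topspace (euclidean :: 'e topology) \<subseteq> {-C..C}" "\<And>x. x \<in> K \<Longrightarrow> h x = k x"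
      using \<open>C \<ge> 0\<close> k(1) K(1)
      by (elim Tietze_extension_completely_regular[OF cr, rotated -1])
        (auto simp: is_interval_cc)
    then show ?thesis by auto
  qed
  obtain h1 where h1: "continuous_on UNIV h1" "range h1 \<subseteq> {-C..C}" "\<forall>x\<in>K. h1 x = Re (g x)"
    using ext[of "\<lambda>x. Re (g x)"] K(2) C order_trans[OF abs_Re_le_cmod] by (auto intro: continuous_intros)
  obtain h2 where h2: "continuous_on UNIV h2" "range h2 \<subseteq> {-C..C}" "\<forall>x\<in>K. h2 x = Im (g x)"
    using ext[of "\<lambda>x. Im (g x)"] K(2) C order_trans[OF abs_Im_le_cmod] by (auto intro: continuous_intros)
  define h where "h x = Complex (h1 x) (h2 x)" for x
  have hC: "norm (h x) \<le> 2 * C" for x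
  proof -
    have "\<bar>h1 x\<bar> \<le> C" "\<bar>h2 x\<bar> \<le> C" using h1(2) h2(2) by (auto simp: abs_le_iff image_subset_iff minus_le_iff)
    then show ?thesis using cmod_le[of "h x"] by (simp add: h_def)
  qed
  have "continuous_on UNIV h"
    using h1(1) h2(1) unfolding h_def by (intro continuous_intros)
  then have "h \<in> bcontfun" using hC by (auto simp: bcontfun_def bounded_iff)
  then have ap: "apply_bcontfun (Bcontfun h) = h" by (rule Bcontfun_inverse)
  show ?thesis
    using h1(3) h2(3) hC by (intro exI[of _ "Bcontfun h"] conjI norm_bound) (auto simp: ap h_def)
qed

text \<open>Two members of B K agree on K and differ by at most 4 * C elsewhere, where the weight is
  small; that this bound does not depend on K makes the filter Cauchy. Weights
  \<open>indicator {x}\<close> identify the limit with g point by point.\<close>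

lemma complete_strict_continuous:
  fixes g :: "'e::t2_space \<Rightarrow> complex"
  assumes cr: "completely_regular_space (euclidean :: 'e topology)"
    and complete: "complete_linear_topology (strict_topology :: ('e \<Rightarrow>\<^sub>C complex) topology)"
    and cont: "\<And>K. compact K \<Longrightarrow> continuous_on K g" and C: "\<And>x. norm (g x) \<le> C"
  shows "\<exists>h :: 'e \<Rightarrow>\<^sub>C complex. \<forall>x. apply_bcontfun h x = g x"
proof -
  let ?p = "\<lambda>\<phi> (f :: 'e \<Rightarrow>\<^sub>C complex). SUP x. norm (\<phi> x * apply_bcontfun f x)"
  have "C \<ge> 0" using C norm_ge_zero order_trans by blast
  define B where "B K = {h :: 'e \<Rightarrow>\<^sub>C complex. (\<forall>x\<in>K. apply_bcontfun h x = g x) \<and> norm h \<le> 2 * C}" for K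
  define F where "F = (INF K\<in>{K. compact K}. principal (B K))"
  have ev: "eventually P F \<longleftrightarrow> (\<exists>K. compact K \<and> (\<forall>h\<in>B K. P h))" for P
  proof -
    have "eventually P F \<longleftrightarrow> (\<exists>K\<in>{K. compact K}. eventually P (principal (B K)))"
      unfolding F_def
    proof (rule eventually_INF_base)
      show "{K :: 'e set. compact K} \<noteq> {}" using compact_empty by blast
      fix K L :: "'e set" assume "K \<in> {K. compact K}" "L \<in> {K. compact K}"
      then show "\<exists>M\<in>{K. compact K}. principal (B M) \<le> inf (principal (B K)) (principal (B L))"
        by (intro bexI[of _ "K \<union> L"]) (auto simp: B_def)
    qed
    then show ?thesis by (simp add: eventually_principal)
  qed
  have nonempty: "B K \<noteq> {}" if "compact K" for K
    using Tietze_complex_bcontfun[OF cr that cont[OF that] C] by (auto simp: B_def)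
  then have proper: "F \<noteq> bot" by (auto simp: trivial_limit_def ev)
  have cauchy: "\<exists>A. eventually (\<lambda>f. f \<in> A) F \<and> (\<forall>f\<in>A. \<forall>g\<in>A. f - g \<in> U)"
    if U: "openin strict_topology U" "0 \<in> U" for U
  proof -
    from topology_generated_by_nbhd[OF U(1)[unfolded strict_topology_def seminorm_topology_def] U(2)]
    obtain \<A> where \<A>: "finite \<A>" "\<Inter>\<A> \<subseteq> U" "0 \<in> \<Inter>\<A>"
      "\<A> \<subseteq> {{g. p (g - f) < e} |p f e. p \<in> {?p \<phi> |\<phi>. bounded (range \<phi>) \<and> vanishing_at_infinity \<phi>} \<and> 0 < e}"
      by auto
    have "\<forall>A\<in>\<A>. \<exists>K. compact K \<and> (\<forall>h\<in>B K. \<forall>h'\<in>B K. h - h' \<in> A)"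
    proof
      fix A assume "A \<in> \<A>"
      then obtain \<phi> f e where A: "A = {g. ?p \<phi> (g - f) < e}" "bounded (range \<phi>)" "vanishing_at_infinity \<phi>"
        using \<A>(4) by auto
      \<comment> \<open>Subbasic sets are balls around some f and not around 0; \<eta> is half of
        the room that this ball leaves at 0.\<close>
      define \<eta> where "\<eta> = (e - ?p \<phi> (0 - f)) / 2"
      have "?p \<phi> (0 - f) < e" using \<A>(3) \<open>A \<in> \<A>\<close> A(1) by auto
      then have \<eta>: "\<eta> > 0" "\<eta> + ?p \<phi> (0 - f) < e" by (auto simp: \<eta>_def field_simps)
      \<comment> \<open>4 * C bounds the norm of the difference of two members of B K; the 1 keeps
        the denominator positive.\<close>
      define d where "d = \<eta> / (4 * C + 1)"
      have "d > 0" using \<eta>(1) \<open>C \<ge> 0\<close> by (simp add: d_def)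
      then obtain K where K: "compact K" "\<And>x. x \<notin> K \<Longrightarrow> norm (\<phi> x) \<le> d"
        using A(3) unfolding vanishing_at_infinity_def by blast
      have "h - h' \<in> A" if h: "h \<in> B K" "h' \<in> B K" for h h'
      proof -
        have small: "norm (\<phi> x * apply_bcontfun (h - h') x) \<le> \<eta>" for x
        proof (cases "x \<in> K")
          case True
          then show ?thesis using h \<eta>(1) by (simp add: B_def)
        next
          case False
          have "norm (apply_bcontfun (h - h') x) \<le> norm (h - h')" by (rule norm_bounded)
          also have "\<dots> \<le> 4 * C" using h norm_triangle_ineq4[of h h'] by (simp add: B_def)
          finally have "norm (\<phi> x * apply_bcontfun (h - h') x) \<le> d * (4 * C)"
            unfolding norm_mult using K(2)[OF False] \<open>d > 0\<close> by (intro mult_mono) auto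
          also have "\<dots> \<le> d * (4 * C + 1)" using \<open>d > 0\<close> by simp
          also have "\<dots> = \<eta>" using \<open>C \<ge> 0\<close> by (simp add: d_def)
          finally show ?thesis .
        qed
        have "?p \<phi> (h - h' - f) \<le> \<eta> + ?p \<phi> (0 - f)"
        proof (rule cSUP_least)
          fix x
          have "\<phi> x * apply_bcontfun (h - h' - f) x =
              \<phi> x * apply_bcontfun (h - h') x + \<phi> x * apply_bcontfun (0 - f) x"
            by (simp add: algebra_simps)
          then have "norm (\<phi> x * apply_bcontfun (h - h' - f) x) \<le>
              norm (\<phi> x * apply_bcontfun (h - h') x) + norm (\<phi> x * apply_bcontfun (0 - f) x)"
            by (simp only: norm_triangle_ineq)
          also have "\<dots> \<le> \<eta> + ?p \<phi> (0 - f)"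
            by (intro add_mono small cSUP_upper bounded_weighted_range[OF A(2)]) simp
          finally show "norm (\<phi> x * apply_bcontfun (h - h' - f) x) \<le> \<eta> + ?p \<phi> (0 - f)" .
        qed simp
        then show ?thesis using \<eta>(2) by (simp only: A(1) mem_Collect_eq le_less_trans)
      qed
      then show "\<exists>K. compact K \<and> (\<forall>h\<in>B K. \<forall>h'\<in>B K. h - h' \<in> A)" using K(1) by blast
    qed
    then obtain \<K> where \<K>: "\<And>A. A \<in> \<A> \<Longrightarrow> compact (\<K> A)"
      "\<And>A h h'. A \<in> \<A> \<Longrightarrow> h \<in> B (\<K> A) \<Longrightarrow> h' \<in> B (\<K> A) \<Longrightarrow> h - h' \<in> A"
      by metis
    define K where "K = (\<Union>A\<in>\<A>. \<K> A)"
    have "compact K" unfolding K_def using \<A>(1) \<K>(1) by (rule compact_UN)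
    moreover have "h - h' \<in> U" if "h \<in> B K" "h' \<in> B K" for h h'
    proof -
      have "B K \<subseteq> B (\<K> A)" if "A \<in> \<A>" for A using that by (auto simp: B_def K_def)
      then have "h - h' \<in> A" if "A \<in> \<A>" for A
        using that \<open>h \<in> B K\<close> \<open>h' \<in> B K\<close> by (intro \<K>(2)) auto
      then show ?thesis using \<A>(2) by auto
    qed
    ultimately show ?thesis by (intro exI[of _ "B K"]) (auto simp: ev)
  qed
  have "\<exists>f. limitin strict_topology (\<lambda>g. g) f F"
  proof (rule complete[unfolded complete_linear_topology_def, THEN spec, THEN mp], intro conjI allI impI)
    fix U :: "('e \<Rightarrow>\<^sub>C complex) set" assume "openin strict_topology U \<and> 0 \<in> U"
    then show "\<exists>A. eventually (\<lambda>f. f \<in> A) F \<and> (\<forall>f\<in>A. \<forall>g\<in>A. f - g \<in> U)"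
      by (intro cauchy) auto
  qed (rule proper)
  then obtain f where f: "limitin strict_topology (\<lambda>g. g) f F" ..
  have "apply_bcontfun f x = g x" for x
  proof (rule ccontr)
    assume ne: "apply_bcontfun f x \<noteq> g x"
    define e where "e = norm (g x - apply_bcontfun f x)"
    have "e > 0" using ne by (simp add: e_def)
    define \<phi> :: "'e \<Rightarrow> complex" where "\<phi> = indicator {x}"
    have \<phi>: "bounded (range \<phi>)" "vanishing_at_infinity \<phi>"
    proof -
      show "bounded (range \<phi>)"
        by (rule finite_imp_bounded, rule finite_subset[of _ "{0, 1}"]) (auto simp: \<phi>_def indicator_def)
      show "vanishing_at_infinity \<phi>"
        unfolding vanishing_at_infinity_def \<phi>_def by (intro allI impI exI[of _ "{x}"]) auto
    qed
    have \<phi>_mem: "?p \<phi> \<in> {?p \<phi> |\<phi>. bounded (range \<phi>) \<and> vanishing_at_infinity \<phi>}"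
      using \<phi> by blast
    have "openin strict_topology {g. ?p \<phi> (g - f) < e}"
      unfolding strict_topology_def seminorm_topology_def
      by (rule topology_generated_by_Basis, rule CollectI, rule exI[of _ "?p \<phi>"], rule exI[of _ f],
          rule exI[of _ e], intro conjI refl \<phi>_mem \<open>e > 0\<close>)
    moreover have "f \<in> {g. ?p \<phi> (g - f) < e}" using \<open>e > 0\<close> by simp
    ultimately have "eventually (\<lambda>g. g \<in> {g. ?p \<phi> (g - f) < e}) F"
      using f unfolding limitin_def by blast
    then obtain K where K: "compact K" "\<And>h. h \<in> B K \<Longrightarrow> ?p \<phi> (h - f) < e"
      unfolding ev by auto
    have "compact (insert x K)" using K(1) by (rule compact_insert)
    then have "B (insert x K) \<noteq> {}" by (rule nonempty)
    then obtain h where h: "h \<in> B (insert x K)" by blast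
    have "norm (\<phi> x * apply_bcontfun (h - f) x) \<le> ?p \<phi> (h - f)"
      by (intro cSUP_upper bounded_weighted_range[OF \<phi>(1)]) simp
    also have "\<dots> < e" using h by (intro K(2)) (auto simp: B_def)
    finally show False using h by (simp add: \<phi>_def e_def B_def)
  qed
  then show ?thesis by blast
qed

text \<open>The weight is the indicator of a Borel subset A of J. Its orbit integral is continuous
  on compact sets and bounded, so completeness makes it the element of C_b(E) that represents the
  integral over A.\<close>

lemma (in Cb_semigroup) locally_integrable_orbit:
  assumes cr: "completely_regular_space (euclidean :: 'e topology)"
    and complete: "complete_linear_topology (strict_topology :: ('e \<Rightarrow>\<^sub>C complex) topology)"
  shows "locally_Y_integrable radon_measures Cb_pairing (\<lambda>t. T t f)"
  unfolding locally_Y_integrable_def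
proof (intro allI impI)
  fix J :: "real set" assume J: "is_interval J \<and> bounded J \<and> J \<subseteq> {0..}"
  have Jm: "J \<in> sets lborel" using J real_interval_borel_measurable by simp
  obtain b where b: "\<And>t. t \<in> J \<Longrightarrow> 0 \<le> t \<and> t \<le> b"
    using J by (auto simp: bounded_iff abs_le_iff subset_iff)
  obtain M \<omega> where M: "M \<ge> 1" "\<And>t f. t \<ge> 0 \<Longrightarrow> norm (T t f) \<le> M * exp (\<omega> * t) * norm f"
    using exponentially_bounded by blast
  \<comment> \<open>The absolute value of \<omega> makes the bound on [0, b] valid for either
    sign.\<close>
  define v where "v t = M * exp (\<bar>\<omega>\<bar> * b) * norm f * indicator {0..b} t" for t
  have v: "integrable lborel v" unfolding v_def by (intro integrable_mult_right integrable_real_indicator) (auto simp: emeasure_lborel_Icc_eq)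
  have bound: "norm (indicator A t :: complex) * norm (T t f) \<le> v t" if "A \<subseteq> J" for A t
  proof (cases "t \<in> A")
    case True
    then have t: "0 \<le> t" "t \<le> b" using that b by auto
    have "\<omega> * t \<le> \<bar>\<omega>\<bar> * b" using t by (intro mult_mono) auto
    then have "M * exp (\<omega> * t) * norm f \<le> M * exp (\<bar>\<omega>\<bar> * b) * norm f"
      using M(1) by (intro mult_right_mono mult_left_mono) auto
    then show ?thesis using M(2)[OF t(1), of f] True t by (simp add: v_def)
  qed (use M(1) in \<open>simp add: v_def\<close>)
  have main: "(\<forall>\<mu>\<in>radon_measures. integrable lborel (\<lambda>t. indicator A t * Cb_pairing (T t f) \<mu>)) \<and>
      (\<exists>h. \<forall>\<mu>\<in>radon_measures. (LINT t|lborel. indicator A t * Cb_pairing (T t f) \<mu>) = Cb_pairing h \<mu>)"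
    if A: "A \<in> sets lborel" "A \<subseteq> J" for A
  proof -
    have w: "(\<lambda>t. indicator A t :: complex) \<in> borel_measurable lborel" "\<And>t. t < 0 \<Longrightarrow> (indicator A t :: complex) = 0"
      using A J by (auto simp: indicator_def subset_iff)
    note ctx = w v bound[OF A(2)]
    obtain h :: "'e \<Rightarrow>\<^sub>C complex" where h: "\<forall>x. apply_bcontfun h x = orbit_integral f (indicator A) x"
      using complete_strict_continuous[OF cr complete
          orbit_integral_continuous_compact[OF ctx] norm_orbit_integral_le[OF ctx]] by blast
    then have "apply_bcontfun h = orbit_integral f (indicator A)" by auto
    then have "Cb_pairing h \<mu> = (LINT t|lborel. indicator A t * Cb_pairing (T t f) \<mu>)"
      if "\<mu> \<in> radon_measures" for \<mu>
      using integral_orbit_integral[OF ctx that] by (simp add: Cb_pairing_def)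
    then show ?thesis using integrable_orbit[OF ctx] by (intro conjI ballI exI[of _ h]) auto
  qed
  have sc: "indicator A t *\<^sub>R z = indicator A t * z" for A and t :: real and z :: complex
    by (simp add: indicator_def)
  show "Y_integrable radon_measures Cb_pairing (restrict_space lborel J) (\<lambda>t. T t f)"
    unfolding Y_integrable_def
  proof (intro conjI ballI)
    fix \<mu> :: "'e set \<Rightarrow> complex" assume "\<mu> \<in> radon_measures"
    then show "integrable (restrict_space lborel J) (\<lambda>t. Cb_pairing (T t f) \<mu>)"
      using main[OF Jm] Jm by (simp add: integrable_restrict_space sc)
  next
    fix A assume "A \<in> sets (restrict_space lborel J)"
    then have A: "A \<in> sets lborel" "A \<subseteq> J"
      using Jm by (auto simp: sets_restrict_space_iff)
    have "(LINT t:A|restrict_space lborel J. F t) = (LINT t|lborel. indicator A t * F t)" for F :: "real \<Rightarrow> complex"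
    proof -
      have "(LINT t:A|restrict_space lborel J. F t) = (LINT t|lborel. indicator J t *\<^sub>R indicator A t *\<^sub>R F t)"
        using Jm unfolding set_lebesgue_integral_def by (subst integral_restrict_space) auto
      also have "\<dots> = (LINT t|lborel. indicator A t * F t)"
        using A(2) by (intro Bochner_Integration.integral_cong) (auto simp: indicator_def)
      finally show ?thesis .
    qed
    then show "\<exists>h. \<forall>\<mu>\<in>radon_measures. (LINT t:A|restrict_space lborel J. Cb_pairing (T t f) \<mu>) = Cb_pairing h \<mu>"
      using main[OF A] by simp
  qed
qed

section \<open>Radon measures on complete metric spaces\<close>

text \<open>Closed sets are stable under intersection and generate the Borel sets. By Dynkin's
  argument only disjoint unions have to be treated, and these are the ones about which countable
  additivity speaks.\<close>

lemma sets_borel_induct_closed [consumes 1, case_names closed compl union]: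
  fixes A :: "'e::topological_space set"
  assumes A: "A \<in> sets borel"
    and closed: "\<And>C. closed C \<Longrightarrow> Q C"
    and compl: "\<And>A. A \<in> sets borel \<Longrightarrow> Q A \<Longrightarrow> Q (UNIV - A)"
    and union: "\<And>A :: nat \<Rightarrow> 'e set. disjoint_family A \<Longrightarrow> range A \<subseteq> sets borel \<Longrightarrow>
      (\<And>i. Q (A i)) \<Longrightarrow> Q (\<Union>i. A i)"
  shows "Q A"
proof -
  have b: "sets borel = sigma_sets UNIV (Collect closed :: 'e set set)"
    by (subst borel_eq_closed) (simp add: sets_measure_of)
  have "Int_stable (Collect closed :: 'e set set)" by (auto simp: Int_stable_def)
  moreover have "Collect closed \<subseteq> Pow (UNIV :: 'e set)" by simp
  moreover have "A \<in> sigma_sets UNIV (Collect closed)" using A by (simp add: b)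
  ultimately show ?thesis
    by (induction rule: sigma_sets_induct_disjoint) (auto intro: closed compl union simp flip: b)
qed

lemma norm_le_positive_variations:
  assumes \<mu>: "complex_borel_measure \<mu>" and "B \<in> sets borel"
  shows "norm (\<mu> B) \<le> measure (positive_variation (\<lambda>A. Re (\<mu> A))) B +
    measure (positive_variation (\<lambda>A. - Re (\<mu> A))) B +
    (measure (positive_variation (\<lambda>A. Im (\<mu> A))) B + measure (positive_variation (\<lambda>A. - Im (\<mu> A))) B)"
proof -
  have *: "\<bar>\<nu> B\<bar> \<le> measure (positive_variation \<nu>) B + measure (positive_variation (\<lambda>A. - \<nu> A)) B"
    if "sigma_additive \<nu>" for \<nu>
    using jordan_decomposition[OF that assms(2)] by (smt (verit) measure_nonneg)
  show ?thesis
    using *[OF complex_measureD(2)[OF \<mu>]] *[OF complex_measureD(3)[OF \<mu>]] cmod_le[of "\<mu> B"]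
    by linarith
qed

text \<open>Four sets, one for each variation and each with error e / 4, are united. R stands for
  \<open>closed\<close> in one application and for \<open>compact\<close> in the other.\<close>

lemma inner_approximation:
  assumes \<mu>: "complex_borel_measure \<mu>" and A: "A \<in> sets borel" and "e > 0"
    and R: "\<And>C D. R C \<Longrightarrow> R D \<Longrightarrow> R (C \<union> D)" "\<And>C. R C \<Longrightarrow> C \<in> sets borel"
    and approx: "\<And>\<nu> e. \<nu> \<in> {\<lambda>A. Re (\<mu> A), \<lambda>A. - Re (\<mu> A), \<lambda>A. Im (\<mu> A), \<lambda>A. - Im (\<mu> A)} \<Longrightarrow>
      e > 0 \<Longrightarrow> \<exists>C. R C \<and> C \<subseteq> A \<and> measure (positive_variation \<nu>) (A - C) \<le> e"
  shows "\<exists>C. R C \<and> C \<subseteq> A \<and> (\<forall>B\<in>sets borel. B \<subseteq> A - C \<longrightarrow> norm (\<mu> B) \<le> e)"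
proof -
  let ?a = "\<lambda>A. Re (\<mu> A)" and ?b = "\<lambda>A. - Re (\<mu> A)" and ?c = "\<lambda>A. Im (\<mu> A)" and ?d = "\<lambda>A. - Im (\<mu> A)"
  have e4: "e / 4 > 0" using \<open>e > 0\<close> by simp
  obtain C1 where C1: "R C1" "C1 \<subseteq> A" "measure (positive_variation ?a) (A - C1) \<le> e / 4"
    using approx[OF _ e4, of ?a] by auto
  obtain C2 where C2: "R C2" "C2 \<subseteq> A" "measure (positive_variation ?b) (A - C2) \<le> e / 4"
    using approx[OF _ e4, of ?b] by auto
  obtain C3 where C3: "R C3" "C3 \<subseteq> A" "measure (positive_variation ?c) (A - C3) \<le> e / 4"
    using approx[OF _ e4, of ?c] by auto
  obtain C4 where C4: "R C4" "C4 \<subseteq> A" "measure (positive_variation ?d) (A - C4) \<le> e / 4"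
    using approx[OF _ e4, of ?d] by auto
  let ?C = "(C1 \<union> C2) \<union> (C3 \<union> C4)"
  have mono: "measure (positive_variation \<nu>) B \<le> measure (positive_variation \<nu>) (A - C)"
    if "sigma_additive \<nu>" "B \<in> sets borel" "B \<subseteq> A - C" "R C" for \<nu> B C
  proof -
    interpret finite_measure "positive_variation \<nu>"
      by (rule finite_positive_variation[OF that(1)])
    show ?thesis using that A R(2) by (intro finite_measure_mono) auto
  qed
  have "norm (\<mu> B) \<le> e" if B: "B \<in> sets borel" "B \<subseteq> A - ?C" for B
  proof -
    have sub: "B \<subseteq> A - C1" "B \<subseteq> A - C2" "B \<subseteq> A - C3" "B \<subseteq> A - C4" using B by auto
    note le = order_trans[OF mono[OF complex_measureD(2)[OF \<mu>] B(1) sub(1) C1(1)] C1(3)]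
      order_trans[OF mono[OF complex_measureD(4)[OF \<mu>] B(1) sub(2) C2(1)] C2(3)]
      order_trans[OF mono[OF complex_measureD(3)[OF \<mu>] B(1) sub(3) C3(1)] C3(3)]
      order_trans[OF mono[OF complex_measureD(5)[OF \<mu>] B(1) sub(4) C4(1)] C4(3)]
    show ?thesis using norm_le_positive_variations[OF \<mu> B(1)] le by linarith
  qed
  moreover have "R ?C" using R(1) C1(1) C2(1) C3(1) C4(1) by blast
  moreover have "?C \<subseteq> A" using C1(2) C2(2) C3(2) C4(2) by blast
  ultimately show ?thesis by blast
qed

text \<open>The type carries only a Hausdorff topology, so the metric is a parameter tied to that
  topology by an equation.\<close>

locale complete_metric_topology = Metric_space "UNIV :: 'e::t2_space set" d for d +
  assumes mtopology_euclidean: "mtopology = (euclidean :: 'e topology)" and mcomplete: mcomplete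
begin

lemma open_iff_mball: "open U \<longleftrightarrow> (\<forall>x\<in>U. \<exists>r>0. mball x r \<subseteq> U)"
  using openin_mtopology[of U] by (auto simp: mtopology_euclidean)

lemma open_mball: "open (mball x r)"
  using openin_mball[of x r] by (simp add: mtopology_euclidean)

lemma closed_mcball: "closed (mcball x r)"
  using closedin_mcball[of x r] by (simp add: mtopology_euclidean)

lemma tendsto_of_mdist:
  assumes "\<And>n. d x (y n) < 1 / real (Suc n)"
  shows "y \<longlonglongrightarrow> x"
proof (rule topological_tendstoI)
  fix U assume "open U" "x \<in> U"
  then obtain r where r: "r > 0" "mball x r \<subseteq> U" by (auto simp: open_iff_mball)
  have "\<forall>\<^sub>F n in sequentially. 1 / real (Suc n) < r"
    using order_tendstoD(2)[OF LIMSEQ_inverse_real_of_nat r(1)] by (simp add: inverse_eq_divide)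
  then show "\<forall>\<^sub>F n in sequentially. y n \<in> U"
  proof eventually_elim
    case (elim n)
    then have "d x (y n) < r" using assms[of n] by linarith
    then show ?case using r(2) by auto
  qed
qed

text \<open>Intended for nonempty C, as the real infimum over the empty set has no useful
  value.\<close>

definition set_distance :: "'e set \<Rightarrow> 'e \<Rightarrow> real" where
  "set_distance C x = (INF c\<in>C. d x c)"

lemma set_distance_le: "c \<in> C \<Longrightarrow> set_distance C x \<le> d x c"
  unfolding set_distance_def by (intro cINF_lower bdd_belowI2[of _ 0]) auto

lemma set_distance_nonneg: "C \<noteq> {} \<Longrightarrow> set_distance C x \<ge> 0"
  unfolding set_distance_def by (intro cINF_greatest) auto

lemma set_distance_in: "x \<in> C \<Longrightarrow> set_distance C x = 0"
  using set_distance_le[of x C x] set_distance_nonneg[of C x] by auto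

lemma set_distance_pos:
  assumes "closed C" "C \<noteq> {}" "x \<notin> C"
  shows "set_distance C x > 0"
proof -
  have "open (- C)" "x \<in> - C" using assms by auto
  then obtain r where r: "r > 0" "mball x r \<subseteq> - C" by (meson open_iff_mball)
  have "r \<le> d x c" if "c \<in> C" for c
  proof (rule ccontr)
    assume "\<not> r \<le> d x c"
    then have "c \<in> mball x r" by simp
    then show False using that r(2) by blast
  qed
  then have "r \<le> set_distance C x"
    unfolding set_distance_def using assms(2) by (intro cINF_greatest) auto
  then show ?thesis using r(1) by simp
qed

lemma continuous_set_distance:
  assumes "C \<noteq> {}" shows "continuous_on UNIV (set_distance C)"
proof -
  have lip: "set_distance C x - d x y \<le> set_distance C y" for x y
    unfolding set_distance_def[of C y]
  proof (rule cINF_greatest[OF assms])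
    fix c assume "c \<in> C"
    then show "set_distance C x - d x y \<le> d y c"
      using set_distance_le[of c C x] triangle[of x y c] by simp
  qed
  have "(set_distance C \<longlongrightarrow> set_distance C x) (at x)" for x
  proof (rule tendstoI)
    fix e :: real assume "e > 0"
    have "dist (set_distance C y) (set_distance C x) < e" if "y \<in> mball x e" for y
      using that lip[of x y] lip[of y x] by (auto simp: dist_real_def commute)
    then show "\<forall>\<^sub>F y in at x. dist (set_distance C y) (set_distance C x) < e"
      unfolding eventually_at_topological using \<open>e > 0\<close>
      by (intro exI[of _ "mball x e"]) (auto simp: open_mball)
  qed
  then show ?thesis by (simp add: continuous_on_def)
qed

text \<open>The function max 0 (1 - n * distance) is 1 on C; at a point off C the distance is
  positive because C is closed, so the function vanishes there for large n.\<close>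

lemma ex_cutoff_fun:
  fixes C :: "'e set"
  assumes "closed C"
  shows "\<exists>u. \<forall>n :: nat. continuous_on UNIV (u n) \<and> (\<forall>x. 0 \<le> u n x \<and> u n x \<le> (1 :: real)) \<and>
    (\<forall>x\<in>C. u n x = 1) \<and> (\<forall>x. (\<lambda>n. u n x) \<longlonglongrightarrow> indicator C x)"
proof (cases "C = {}")
  case True
  then show ?thesis by (intro exI[of _ "\<lambda>n x. 0"]) auto
next
  case False
  define u where "u n x = max 0 (1 - real n * set_distance C x)" for n x
  have "(\<lambda>n. u n x) \<longlonglongrightarrow> indicator C x" for x
  proof (cases "x \<in> C")
    case True
    then show ?thesis by (simp add: u_def set_distance_in)
  next
    case out: False
    have p: "set_distance C x > 0" using assms False out by (rule set_distance_pos)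
    obtain N where N: "1 < real N * set_distance C x"
      using reals_Archimedean3[OF p] by blast
    have "u n x = 0" if "n \<ge> N" for n
    proof -
      have "real N * set_distance C x \<le> real n * set_distance C x"
        using that p by (intro mult_right_mono) auto
      then show ?thesis using N by (simp add: u_def)
    qed
    then have "\<forall>\<^sub>F n in sequentially. u n x = 0" by (auto simp: eventually_sequentially)
    then show ?thesis using out by (simp add: tendsto_eventually)
  qed
  moreover have "continuous_on UNIV (u n)" for n
    unfolding u_def using continuous_set_distance[OF False] by (intro continuous_intros)
  ultimately show ?thesis
    using set_distance_nonneg[OF False]
    by (intro exI[of _ u]) (auto simp: u_def set_distance_in)
qed

text \<open>A cutoff for C times 1 minus a cutoff for S. Empty S approximates closed sets; general S
  provides test functions that vanish on a prescribed closed set.\<close>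

lemma ex_cutoff:
  assumes "closed C" "closed S"
  shows "\<exists>f :: nat \<Rightarrow> 'e \<Rightarrow>\<^sub>C complex. (\<forall>n. norm (f n) \<le> 1) \<and>
    (\<forall>n. \<forall>x\<in>S. apply_bcontfun (f n) x = 0) \<and>
    (\<forall>x. (\<lambda>n. apply_bcontfun (f n) x) \<longlonglongrightarrow> indicator (C - S) x)"
proof -
  obtain u where u: "\<And>n :: nat. continuous_on UNIV (u n)" "\<And>n x. 0 \<le> u n x" "\<And>n x. u n x \<le> (1 :: real)"
    "\<And>x. (\<lambda>n. u n x) \<longlonglongrightarrow> indicator C x"
    using ex_cutoff_fun[OF assms(1)] by blast
  obtain v where v: "\<And>n :: nat. continuous_on UNIV (v n)" "\<And>n x. 0 \<le> v n x" "\<And>n x. v n x \<le> (1 :: real)"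
    "\<And>n x. x \<in> S \<Longrightarrow> v n x = 1" "\<And>x. (\<lambda>n. v n x) \<longlonglongrightarrow> indicator S x"
    using ex_cutoff_fun[OF assms(2)] by blast
  define h :: "nat \<Rightarrow> 'e \<Rightarrow> complex" where "h n x = of_real (u n x * (1 - v n x))" for n x
  have nh: "norm (h n x) \<le> 1" for n x
    using u(2,3)[of n x] v(2,3)[of n x] mult_mono[of "u n x" 1 "1 - v n x" 1]
    by (simp add: h_def norm_mult flip: of_real_diff)
  have "continuous_on UNIV (h n)" for n
    unfolding h_def by (intro continuous_intros u v)
  then have "h n \<in> bcontfun" for n using nh by (auto simp: bcontfun_def bounded_iff)
  then have ap: "apply_bcontfun (Bcontfun (h n)) = h n" for n by (rule Bcontfun_inverse)
  have "(\<lambda>n. h n x) \<longlonglongrightarrow> of_real (indicator C x * (1 - indicator S x))" for x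
    unfolding h_def by (intro tendsto_intros u v)
  moreover have "of_real (indicator C x * (1 - indicator S x)) = (indicator (C - S) x :: complex)" for x
    by (simp add: indicator_def)
  ultimately show ?thesis
    using nh v(4) by (intro exI[of _ "\<lambda>n. Bcontfun (h n)"] conjI allI norm_bound) (auto simp: ap h_def)
qed

lemma functional_tendsto_indicator:
  assumes L: "normal_functional L" and f: "\<And>n. norm (f n) \<le> 1"
    "\<And>x. (\<lambda>n. apply_bcontfun (f n) x) \<longlonglongrightarrow> indicator A x"
  shows "(\<lambda>n. L (apply_bcontfun (f n))) \<longlonglongrightarrow> L (indicator A)"
  using f order_trans[OF norm_bounded f(1)] bounded_borelD(1)[OF bcontfun_bounded_borel]
  by (intro normal_functionalD(3)[OF L, where C=1]) auto

text \<open>The cutoffs vanishing on S settle the sets C - S with C closed; complements and disjoint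
  unions give the rest. Thus the support of a mixture can be found by testing continuous
  functions.\<close>

lemma functional_measure_eq_0:
  assumes L: "normal_functional L" and S: "closed S"
    and zero: "\<And>f :: 'e \<Rightarrow>\<^sub>C complex. (\<And>x. x \<in> S \<Longrightarrow> apply_bcontfun f x = 0) \<Longrightarrow> L (apply_bcontfun f) = 0"
    and B: "B \<in> sets borel" "B \<inter> S = {}"
  shows "functional_measure L B = 0"
proof -
  let ?\<mu> = "functional_measure L"
  have sa: "sigma_additive ?\<mu>"
    by (rule complex_measureD(1)[OF measure_functional[OF L]])
  have cl: "?\<mu> (C - S) = 0" if C: "closed C" for C
  proof -
    obtain f :: "nat \<Rightarrow> 'e \<Rightarrow>\<^sub>C complex" where f: "\<And>n. norm (f n) \<le> 1"
      "\<And>n x. x \<in> S \<Longrightarrow> apply_bcontfun (f n) x = 0"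
      "\<And>x. (\<lambda>n. apply_bcontfun (f n) x) \<longlonglongrightarrow> indicator (C - S) x"
      using ex_cutoff[OF C S] by blast
    have "(\<lambda>n. 0) \<longlonglongrightarrow> L (indicator (C - S))"
      using functional_tendsto_indicator[OF L f(1,3)] zero[OF f(2)] by simp
    then have "L (indicator (C - S)) = 0" by (simp add: LIMSEQ_const_iff)
    then show ?thesis by (simp add: functional_measure_def)
  qed
  have "?\<mu> (B - S) = 0"
    using B(1)
  proof (induction rule: sets_borel_induct_closed)
    case (closed C)
    then show ?case by (rule cl)
  next
    case (compl A)
    have "UNIV - A - S = (UNIV - S) - (A - S)" by auto
    moreover have "?\<mu> ((UNIV - S) - (A - S)) = ?\<mu> (UNIV - S) - ?\<mu> (A - S)"
      using compl S by (intro sigma_additive_Diff[OF sa]) auto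
    ultimately show ?case using cl[of UNIV] compl by simp
  next
    case (union A)
    have "disjoint_family (\<lambda>i. A i - S)" using union(1) by (auto simp: disjoint_family_on_def)
    moreover have "range (\<lambda>i. A i - S) \<subseteq> sets borel" using union(2) S by auto
    ultimately have "(\<lambda>i. ?\<mu> (A i - S)) sums ?\<mu> (\<Union>i. A i - S)"
      using sa unfolding sigma_additive_def by blast
    then show ?case using union(3) by (simp add: sums_iff)
  qed
  moreover have "B - S = B" using B(2) by auto
  ultimately show ?thesis by simp
qed

text \<open>In the application the measures behind L t are obtained by choice, so measurability in t
  is visible on continuous functions only. Cutoffs carry it to closed sets, Dynkin induction to
  Borel sets, bounded limits to functions.\<close>

lemma functional_measurable:
  fixes L :: "real \<Rightarrow> ('e \<Rightarrow> complex) \<Rightarrow> complex"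
  assumes L: "\<And>t. normal_functional (L t)"
    and cont: "\<And>f :: 'e \<Rightarrow>\<^sub>C complex. (\<lambda>t. L t (apply_bcontfun f)) \<in> borel_measurable lborel"
    and "f \<in> bounded_borel"
  shows "(\<lambda>t. L t f) \<in> borel_measurable lborel"
  using assms(3)
proof (induction rule: bounded_borel_induct)
  case (indicator A)
  have sa: "sigma_additive (functional_measure (L t))" for t
    by (rule complex_measureD(1)[OF measure_functional[OF L]])
  have cl: "(\<lambda>t. functional_measure (L t) C) \<in> borel_measurable lborel" if C: "closed C" for C
  proof -
    obtain f :: "nat \<Rightarrow> 'e \<Rightarrow>\<^sub>C complex" where f: "\<And>n. norm (f n) \<le> 1"
      "\<And>x. (\<lambda>n. apply_bcontfun (f n) x) \<longlonglongrightarrow> indicator (C - {}) x"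
      using ex_cutoff[OF C closed_empty] by blast
    have "(\<lambda>n. L t (apply_bcontfun (f n))) \<longlonglongrightarrow> functional_measure (L t) C" for t
      using functional_tendsto_indicator[OF L f, of t] C by (simp add: functional_measure_def)
    then show ?thesis by (rule borel_measurable_LIMSEQ_metric[OF cont])
  qed
  have "(\<lambda>t. functional_measure (L t) A) \<in> borel_measurable lborel"
    using indicator
  proof (induction rule: sets_borel_induct_closed)
    case (closed C)
    then show ?case by (rule cl)
  next
    case (compl A)
    have "functional_measure (L t) (UNIV - A) = functional_measure (L t) UNIV - functional_measure (L t) A" for t
      using compl by (intro sigma_additive_Diff[OF sa]) auto
    then show ?case using cl[of UNIV] compl(2) by (simp add: borel_measurable_diff)
  next
    case (union A)
    have "(\<lambda>n. \<Sum>i<n. functional_measure (L t) (A i)) \<longlonglongrightarrow> functional_measure (L t) (\<Union>i. A i)" for t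
      using sa[of t] union(1,2) unfolding sigma_additive_def sums_def by blast
    then show ?case
      by (rule borel_measurable_LIMSEQ_metric[rotated]) (intro borel_measurable_sum union(3))
  qed
  then show ?case using indicator by (simp add: functional_measure_def)
next
  case (lim F f C)
  show ?case
    by (rule borel_measurable_LIMSEQ_metric[OF lim(4) normal_functionalD(3)[OF L lim(1-3)]])
qed (simp_all add: L[THEN normal_functionalD(1)] L[THEN normal_functionalD(2)])

text \<open>Approximation from inside and outside at once is symmetric under complements, so the
  induction goes through. A closed set is the intersection of the open sets of points at distance
  less than 1 / (n + 1) from it.\<close>

lemma closed_open_approximation:
  assumes P: "finite_measure P" "sets P = sets borel" and A: "A \<in> sets (borel :: 'e measure)"
  shows "\<forall>e>0. \<exists>C U. closed C \<and> open U \<and> C \<subseteq> A \<and> A \<subseteq> U \<and> measure P (U - C) \<le> e"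
  using A
proof (induction rule: sets_borel_induct_closed)
  interpret finite_measure P by fact
  case (closed C)
  show ?case
  proof (intro allI impI)
    fix e :: real assume "e > 0"
    show "\<exists>C' U. closed C' \<and> open U \<and> C' \<subseteq> C \<and> C \<subseteq> U \<and> measure P (U - C') \<le> e"
    proof (cases "C = {}")
      case True
      then show ?thesis using \<open>e > 0\<close> by (intro exI[of _ "{}"]) auto
    next
      case False
      define U where "U n = {x. set_distance C x < 1 / real (Suc n)}" for n
      have U: "open (U n)" for n
        unfolding U_def using continuous_set_distance[OF False] by (intro open_Collect_less) auto
      have CU: "C \<subseteq> U n" for n by (auto simp: U_def set_distance_in)
      have "decseq (\<lambda>n. U n - C)"
      proof (rule decseq_SucI)
        fix n
        have "1 / real (Suc (Suc n)) \<le> 1 / real (Suc n)" by (simp add: frac_le)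
        then show "U (Suc n) - C \<subseteq> U n - C" by (auto simp: U_def simp del: of_nat_Suc)
      qed
      moreover have "range (\<lambda>n. U n - C) \<subseteq> sets P" using U closed by (auto simp: P(2))
      ultimately have "(\<lambda>n. measure P (U n - C)) \<longlonglongrightarrow> measure P (\<Inter>n. U n - C)"
        by (intro finite_Lim_measure_decseq)
      moreover have "(\<Inter>n. U n - C) = {}"
      proof -
        have "\<exists>n. x \<notin> U n" if "x \<notin> C" for x
        proof -
          have "set_distance C x > 0" using closed False that by (rule set_distance_pos)
          then obtain n where "inverse (real (Suc n)) < set_distance C x" using reals_Archimedean by blast
          then show ?thesis by (intro exI[of _ n]) (simp add: U_def inverse_eq_divide)
        qed
        then show ?thesis by blast
      qed
      ultimately have "(\<lambda>n. measure P (U n - C)) \<longlonglongrightarrow> 0"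
        by (simp only: measure_empty)
      then have "\<forall>\<^sub>F n in sequentially. measure P (U n - C) < e"
        using \<open>e > 0\<close> by (rule order_tendstoD)
      then obtain n where "measure P (U n - C) < e" by (auto simp: eventually_sequentially)
      then show ?thesis using closed U[of n] CU[of n] less_imp_le by blast
    qed
  qed
next
  case (compl A)
  show ?case
  proof (intro allI impI)
    fix e :: real assume "e > 0"
    from compl(2)[rule_format, OF this] obtain C U where
      CU: "closed C" "open U" "C \<subseteq> A" "A \<subseteq> U" "measure P (U - C) \<le> e" by blast
    have "(- C) - (- U) = U - C" by auto
    then have "closed (- U)" "open (- C)" "- U \<subseteq> UNIV - A" "UNIV - A \<subseteq> - C" "measure P ((- C) - (- U)) \<le> e"
      using CU by auto
    then show "\<exists>C U. closed C \<and> open U \<and> C \<subseteq> UNIV - A \<and> UNIV - A \<subseteq> U \<and> measure P (U - C) \<le> e"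
      by blast
  qed
next
  interpret finite_measure P by fact
  case (union A)
  show ?case
  proof (intro allI impI)
    fix e :: real assume "e > 0"
    \<comment> \<open>These errors add up to e / 2. The other half pays for keeping only finitely
      many C n, as an infinite union of closed sets need not be closed.\<close>
    have "\<forall>n. \<exists>C U. closed C \<and> open U \<and> C \<subseteq> A n \<and> A n \<subseteq> U \<and> measure P (U - C) \<le> e / 2 * (1/2) ^ Suc n"
      using \<open>e > 0\<close> by (intro allI union(3)[rule_format]) simp
    then obtain C U where CU: "\<And>n. closed (C n)" "\<And>n. open (U n)" "\<And>n. C n \<subseteq> A n" "\<And>n. A n \<subseteq> U n"
      "\<And>n. measure P (U n - C n) \<le> e / 2 * (1/2) ^ Suc n"
      by metis
    have m: "C n \<in> sets P" "U n \<in> sets P" for n using CU(1,2) by (auto simp: P(2))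
    have geo: "(\<lambda>n. e / 2 * (1/2) ^ Suc n) sums (e / 2 * 1)"
      by (intro sums_mult power_half_series)
    have sm: "summable (\<lambda>n. measure P (U n - C n))"
      using CU(5) by (intro summable_comparison_test'[OF sums_summable[OF geo], of 0]) simp
    have "measure P (\<Union>n. U n - C n) \<le> (\<Sum>n. measure P (U n - C n))"
      using m sm by (intro finite_measure_subadditive_countably) auto
    also have "\<dots> \<le> (\<Sum>n. e / 2 * (1/2) ^ Suc n)"
      using CU(5) sm by (intro suminf_le sums_summable[OF geo])
    also have "\<dots> = e / 2" using sums_unique[OF geo] by simp
    finally have 1: "measure P (\<Union>n. U n - C n) \<le> e / 2" .
    define B where "B N = (\<Union>n. C n) - (\<Union>i<N. C i)" for N
    have Bm: "B N \<in> sets P" for N unfolding B_def using m by auto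
    have "(\<lambda>N. measure P (B N)) \<longlonglongrightarrow> measure P (\<Inter>N. B N)"
      using Bm by (intro finite_Lim_measure_decseq) (auto simp: B_def decseq_def)
    moreover have "(\<Inter>N. B N) = {}" by (auto simp: B_def)
    ultimately have "(\<lambda>N. measure P (B N)) \<longlonglongrightarrow> 0"
      by (simp only: measure_empty)
    then have "\<forall>\<^sub>F N in sequentially. measure P (B N) < e / 2"
      by (rule order_tendstoD) (use \<open>e > 0\<close> in simp)
    then obtain N where N: "measure P (B N) < e / 2" by (auto simp: eventually_sequentially)
    have "measure P ((\<Union>n. U n) - (\<Union>i<N. C i)) \<le> measure P ((\<Union>n. U n - C n) \<union> B N)"
      using m Bm by (intro finite_measure_mono) (auto simp: B_def)
    also have "\<dots> \<le> measure P (\<Union>n. U n - C n) + measure P (B N)"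
      using m Bm by (intro measure_Un_le) auto
    also have "\<dots> \<le> e" using 1 N by simp
    finally have "measure P ((\<Union>n. U n) - (\<Union>i<N. C i)) \<le> e" .
    moreover have "closed (\<Union>i<N. C i)" "open (\<Union>n. U n)" using CU(1,2) by auto
    moreover have "(\<Union>i<N. C i) \<subseteq> (\<Union>n. A n)" "(\<Union>n. A n) \<subseteq> (\<Union>n. U n)"
      using CU(3,4) by blast+
    ultimately show "\<exists>C V. closed C \<and> open V \<and> C \<subseteq> (\<Union>n. A n) \<and> (\<Union>n. A n) \<subseteq> V \<and> measure P (V - C) \<le> e"
      by meson
  qed
qed

lemma closed_inner_approximation:
  assumes \<mu>: "complex_borel_measure \<mu>" and A: "A \<in> sets (borel :: 'e measure)" and "e > 0"
  shows "\<exists>C. closed C \<and> C \<subseteq> A \<and> (\<forall>B\<in>sets borel. B \<subseteq> A - C \<longrightarrow> norm (\<mu> B) \<le> e)"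
proof (rule inner_approximation[OF \<mu> A \<open>e > 0\<close>])
  fix \<nu> and e :: real
  assume "\<nu> \<in> {\<lambda>A. Re (\<mu> A), \<lambda>A. - Re (\<mu> A), \<lambda>A. Im (\<mu> A), \<lambda>A. - Im (\<mu> A)}" and e: "e > 0"
  then have "sigma_additive \<nu>" using complex_measureD[OF \<mu>] by auto
  then interpret finite_measure "positive_variation \<nu>" by (rule finite_positive_variation)
  obtain C U where CU: "closed C" "open U" "C \<subseteq> A" "A \<subseteq> U" "measure (positive_variation \<nu>) (U - C) \<le> e"
    using closed_open_approximation[OF finite_measure_axioms sets_positive_variation A,
        rule_format, OF e] by blast
  have "measure (positive_variation \<nu>) (A - C) \<le> measure (positive_variation \<nu>) (U - C)"
    using CU by (intro finite_measure_mono) auto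
  then show "\<exists>C. closed C \<and> C \<subseteq> A \<and> measure (positive_variation \<nu>) (A - C) \<le> e"
    using CU by (intro exI[of _ C]) auto
qed auto

text \<open>Cutoffs give the bound for closed sets, inner approximation for Borel sets. This
  converts operator norm estimates on C_b(E) into estimates on measures.\<close>

lemma norm_measure_le_of_unit_ball:
  assumes \<mu>: "complex_borel_measure \<mu>" and A: "A \<in> sets (borel :: 'e measure)"
    and K: "\<And>f :: 'e \<Rightarrow>\<^sub>C complex. norm f \<le> 1 \<Longrightarrow> norm (complex_measure_integral (apply_bcontfun f) \<mu>) \<le> K"
  shows "norm (\<mu> A) \<le> K"
proof (rule field_le_epsilon)
  fix e :: real assume "e > 0"
  from closed_inner_approximation[OF \<mu> A this]
  obtain C where C: "closed C" "C \<subseteq> A" "\<forall>B\<in>sets borel. B \<subseteq> A - C \<longrightarrow> norm (\<mu> B) \<le> e"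
    by blast
  obtain f :: "nat \<Rightarrow> 'e \<Rightarrow>\<^sub>C complex" where f: "\<And>n. norm (f n) \<le> 1"
    "\<And>x. (\<lambda>n. apply_bcontfun (f n) x) \<longlonglongrightarrow> indicator (C - {}) x"
    using ex_cutoff[OF C(1) closed_empty] by blast
  have "(\<lambda>n. complex_measure_integral (apply_bcontfun (f n)) \<mu>) \<longlonglongrightarrow> \<mu> C"
    using functional_tendsto_indicator[OF normal_functional_integral[OF \<mu>] f] C(1)
    by (simp add: integral_complex_indicator[OF \<mu>])
  then have "norm (\<mu> C) \<le> K"
    using K[OF f(1)] by (intro LIMSEQ_le_const2[OF tendsto_norm]) auto
  moreover have "\<mu> A = \<mu> C + \<mu> (A - C)"
    using sigma_additive_Diff[OF complex_measureD(1)[OF \<mu>] A _ C(2)] C(1) by simp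
  moreover have "norm (\<mu> (A - C)) \<le> e" using C(1) A by (intro C(3)[rule_format]) auto
  ultimately show "norm (\<mu> A) \<le> K + e" using norm_triangle_ineq[of "\<mu> C" "\<mu> (A - C)"] by simp
qed

text \<open>In a complete metric, closed and totally bounded means compact. Total boundedness asks
  for centres in K, so a centre whose ball meets K is replaced by a point of K, which doubles the
  radius.\<close>

lemma compact_of_mcball_covers:
  assumes "closed K" and cover: "\<And>k :: nat. \<exists>X. finite X \<and> K \<subseteq> (\<Union>x\<in>X. mcball x (1 / real (Suc k)))"
  shows "compact K"
proof -
  have "mtotally_bounded K"
    unfolding mtotally_bounded_def
  proof (intro allI impI)
    fix e :: real assume "e > 0"
    then obtain k where k: "inverse (real (Suc k)) < e / 2" using reals_Archimedean[of "e / 2"] by auto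
    obtain X where X: "finite X" "K \<subseteq> (\<Union>x\<in>X. mcball x (1 / real (Suc k)))" using cover by blast
    define Y where "Y = {x\<in>X. K \<inter> mcball x (1 / real (Suc k)) \<noteq> {}}"
    have "\<forall>x\<in>Y. \<exists>y. y \<in> K \<and> d x y \<le> 1 / real (Suc k)" by (auto simp: Y_def)
    then obtain y where y: "\<And>x. x \<in> Y \<Longrightarrow> y x \<in> K" "\<And>x. x \<in> Y \<Longrightarrow> d x (y x) \<le> 1 / real (Suc k)" by metis
    have "K \<subseteq> (\<Union>z\<in>y ` Y. mball z e)"
    proof
      fix z assume "z \<in> K"
      then obtain x where x: "x \<in> X" "d x z \<le> 1 / real (Suc k)" using X(2) by auto
      then have "x \<in> Y" using \<open>z \<in> K\<close> by (auto simp: Y_def)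
      have "d (y x) z \<le> d x (y x) + d x z" using triangle[of "y x" x z] by (simp add: commute)
      also have "\<dots> \<le> 2 * inverse (real (Suc k))"
        using y(2)[OF \<open>x \<in> Y\<close>] x(2) by (simp add: inverse_eq_divide)
      also have "\<dots> < e" using k by simp
      finally show "z \<in> (\<Union>z\<in>y ` Y. mball z e)" using \<open>x \<in> Y\<close> by auto
    qed
    moreover have "finite (y ` Y)" using X(1) by (simp add: Y_def)
    ultimately show "\<exists>X. finite X \<and> X \<subseteq> K \<and> K \<subseteq> (\<Union>x\<in>X. mball x e)"
      using y(1) by (intro exI[of _ "y ` Y"]) auto
  qed
  then have "compactin mtopology (mtopology closure_of K)"
    using mtotally_bounded_eq_compact_closure_of[OF mcomplete] by blast
  then show ?thesis
    using assms(1) by (simp add: mtopology_euclidean)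
qed

text \<open>Ulam's argument: balls of radius 1 / (k + 1) around the points of D cover
  \<open>closure D\<close>, so finitely many of them leave out measure at most e / 2 ^ (k + 1).
  Intersecting over k gives a compact set, and the errors add up to e.\<close>

lemma finite_measure_tight:
  assumes P: "finite_measure P" "sets P = sets (borel :: 'e measure)"
    and D: "countable D" "D \<noteq> {}" "measure P (UNIV - closure D) = 0" and "e > 0"
  shows "\<exists>K. compact K \<and> measure P (UNIV - K) \<le> e"
proof -
  interpret finite_measure P by fact
  define x where "x = from_nat_into D"
  have x: "range x = D" using D by (simp add: x_def range_from_nat_into)
  define W where "W k N = (\<Union>i<N. mcball (x i) (1 / real (Suc k)))" for k N
  have Wc: "closed (W k N)" for k N unfolding W_def by (intro closed_UN ballI closed_mcball) simp
  have "\<exists>N. measure P (UNIV - W k N) \<le> e * (1/2) ^ Suc k" for k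
  proof -
    have "(\<lambda>N. measure P (UNIV - W k N)) \<longlonglongrightarrow> measure P (\<Inter>N. UNIV - W k N)"
      using Wc by (intro finite_Lim_measure_decseq) (auto simp: P(2) W_def decseq_def)
    moreover have "measure P (\<Inter>N. UNIV - W k N) = 0"
    proof -
      have "y \<in> (\<Union>N. W k N)" if "y \<in> closure D" for y
      proof -
        have "open (mball y (1 / real (Suc k)))" "y \<in> mball y (1 / real (Suc k))"
          by (auto simp: open_mball)
        then have "mball y (1 / real (Suc k)) \<inter> D \<noteq> {}"
          using that open_Int_closure_eq_empty by blast
        then obtain z where "z \<in> D" "z \<in> mball y (1 / real (Suc k))" by blast
        moreover from this(1) obtain i where "z = x i" using x by auto
        ultimately have "y \<in> mcball (x i) (1 / real (Suc k))"
          by (simp add: commute less_imp_le)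
        then show ?thesis by (auto simp: W_def)
      qed
      then have "measure P (\<Inter>N. UNIV - W k N) \<le> measure P (UNIV - closure D)"
        by (intro finite_measure_mono) (auto simp: P(2))
      then show ?thesis using D(3) measure_nonneg[of P "\<Inter>N. UNIV - W k N"] by linarith
    qed
    ultimately have "(\<lambda>N. measure P (UNIV - W k N)) \<longlonglongrightarrow> 0"
      by (simp only:)
    then have "\<forall>\<^sub>F N in sequentially. measure P (UNIV - W k N) < e * (1/2) ^ Suc k"
      by (rule order_tendstoD) (use \<open>e > 0\<close> in simp)
    then show ?thesis by (auto simp: eventually_sequentially intro: less_imp_le)
  qed
  then obtain N where N: "\<And>k. measure P (UNIV - W k (N k)) \<le> e * (1/2) ^ Suc k" by metis
  define K where "K = (\<Inter>k. W k (N k))"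
  have "compact K"
  proof (rule compact_of_mcball_covers)
    show "closed K" unfolding K_def using Wc by auto
    show "\<exists>X. finite X \<and> K \<subseteq> (\<Union>x\<in>X. mcball x (1 / real (Suc k)))" for k
      by (intro exI[of _ "x ` {..<N k}"]) (auto simp: K_def W_def)
  qed
  moreover have "measure P (UNIV - K) \<le> e"
  proof -
    have geo: "(\<lambda>k. e * (1/2) ^ Suc k) sums (e * 1)"
      by (intro sums_mult power_half_series)
    have sm: "summable (\<lambda>k. measure P (UNIV - W k (N k)))"
      using N by (intro summable_comparison_test'[OF sums_summable[OF geo], of 0]) simp
    have "UNIV - K = (\<Union>k. UNIV - W k (N k))" by (auto simp: K_def)
    also have "measure P \<dots> \<le> (\<Sum>k. measure P (UNIV - W k (N k)))"
      using Wc sm by (intro finite_measure_subadditive_countably) (auto simp: P(2))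
    also have "\<dots> \<le> (\<Sum>k. e * (1/2) ^ Suc k)"
      using N sm by (intro suminf_le sums_summable[OF geo])
    also have "\<dots> = e" using sums_unique[OF geo] by simp
    finally show ?thesis .
  qed
  ultimately show ?thesis by blast
qed

text \<open>Regularity gives a closed subset of A and tightness a compact set, each with error e /
  2; their intersection is the required compact set.\<close>

lemma radon_of_separable_support:
  assumes \<mu>: "complex_borel_measure \<mu>" and D: "countable D" "D \<noteq> {}"
    and zero: "\<And>B. B \<in> sets (borel :: 'e measure) \<Longrightarrow> B \<inter> closure D = {} \<Longrightarrow> \<mu> B = 0"
  shows "\<mu> \<in> radon_measures"
  unfolding radon_measure_iff[OF \<mu>]
proof (intro ballI allI impI)
  fix A :: "'e set" and e :: real assume A: "A \<in> sets borel" and "e > 0"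
  have e2: "e / 2 > 0" using \<open>e > 0\<close> by simp
  obtain C where C: "closed C" "C \<subseteq> A" "\<forall>B\<in>sets borel. B \<subseteq> A - C \<longrightarrow> norm (\<mu> B) \<le> e / 2"
    using closed_inner_approximation[OF \<mu> A e2] by blast
  have "\<exists>K. compact K \<and> K \<subseteq> UNIV \<and> (\<forall>B\<in>sets borel. B \<subseteq> UNIV - K \<longrightarrow> norm (\<mu> B) \<le> e / 2)"
  proof (rule inner_approximation[OF \<mu> _ e2])
    fix \<nu> and e :: real
    assume \<nu>: "\<nu> \<in> {\<lambda>A. Re (\<mu> A), \<lambda>A. - Re (\<mu> A), \<lambda>A. Im (\<mu> A), \<lambda>A. - Im (\<mu> A)}" and e: "e > 0"
    then have sa: "sigma_additive \<nu>" using complex_measureD[OF \<mu>] by auto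
    then interpret finite_measure "positive_variation \<nu>" by (rule finite_positive_variation)
    have "\<nu> B \<le> 0" if "B \<in> sets borel" "B \<subseteq> UNIV - closure D" for B
    proof -
      have "\<mu> B = 0" using that by (intro zero) auto
      then show ?thesis using \<nu> by auto
    qed
    then have "measure (positive_variation \<nu>) (UNIV - closure D) \<le> 0"
      by (intro positive_variation_least[OF sa]) auto
    then have "measure (positive_variation \<nu>) (UNIV - closure D) = 0"
      using measure_nonneg order_antisym by blast
    from finite_measure_tight[OF finite_measure_axioms sets_positive_variation D this e]
    show "\<exists>C. compact C \<and> C \<subseteq> UNIV \<and> measure (positive_variation \<nu>) (UNIV - C) \<le> e" by auto
  qed (auto intro: borel_closed compact_imp_closed)
  then obtain K where K: "compact K" "\<forall>B\<in>sets borel. B \<subseteq> UNIV - K \<longrightarrow> norm (\<mu> B) \<le> e / 2"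
    by blast
  have "norm (\<mu> B) \<le> e" if B: "B \<in> sets borel" "B \<subseteq> A - C \<inter> K" for B
  proof -
    have "\<mu> B = \<mu> (B \<inter> C) + \<mu> (B - C)"
      using B C by (intro sigma_additive_split complex_measureD[OF \<mu>]) auto
    moreover have "norm (\<mu> (B \<inter> C)) \<le> e / 2" using B C(1) by (intro K(2)[rule_format]) auto
    moreover have "norm (\<mu> (B - C)) \<le> e / 2" using B C(1) by (intro C(3)[rule_format]) auto
    ultimately show ?thesis using norm_triangle_ineq[of "\<mu> (B \<inter> C)" "\<mu> (B - C)"] by simp
  qed
  then show "\<exists>K. K \<subseteq> A \<and> compact K \<and> (\<forall>B\<in>sets borel. B \<subseteq> A - K \<longrightarrow> norm (\<mu> B) \<le> e)"
    using C(1,2) K(1) by (intro exI[of _ "C \<inter> K"]) (auto intro: closed_Int_compact)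
qed

end

section \<open>The resolvent on a complete metric space\<close>

lemma integral_complex_eq_0:
  assumes \<mu>: "complex_borel_measure \<mu>" and S: "S \<in> sets borel"
    and zero: "\<And>B. B \<in> sets borel \<Longrightarrow> B \<inter> S = {} \<Longrightarrow> \<mu> B = 0"
    and f: "f \<in> bounded_borel" "\<And>x. x \<in> S \<Longrightarrow> f x = 0"
  shows "complex_measure_integral f \<mu> = 0"
proof -
  \<comment> \<open>The induction treats g times the indicator of the complement of S for arbitrary
    g, because approximants of f need not vanish on S.\<close>
  let ?g = "\<lambda>g x. g x * indicator (- S) x :: complex"
  note nf = normal_functional_integral[OF \<mu>]
  have bb: "?g g \<in> bounded_borel" if g: "g \<in> bounded_borel" for g
  proof -
    obtain C where C: "\<forall>x. norm (g x) \<le> C" using bounded_borelD(2)[OF g] ..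
    then have "norm (?g g x) \<le> C" for x
      using order_trans[OF norm_ge_zero, of "g x" C] by (simp add: indicator_def)
    moreover have "?g g \<in> borel_measurable borel"
      using S by (intro borel_measurable_times bounded_borelD(1)[OF g]) auto
    ultimately show ?thesis by (rule bounded_borelI[rotated])
  qed
  have "complex_measure_integral (?g f) \<mu> = 0"
    using f(1)
  proof (induction rule: bounded_borel_induct)
    case (indicator A)
    have "(\<lambda>x. indicator A x * indicator (- S) x :: complex) = indicator (A - S)"
      by (auto simp: indicator_def)
    then show ?case
      using indicator S by (simp add: integral_complex_indicator[OF \<mu>] zero Diff_Int_distrib2)
  next
    case (add f g)
    then show ?case using normal_functionalD(1)[OF nf bb bb, of f g] by (simp add: algebra_simps)
  next
    case (scale f c)
    then show ?case using normal_functionalD(2)[OF nf bb, of f c] by (simp add: algebra_simps)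
  next
    case (lim F f C)
    have "(\<lambda>n. complex_measure_integral (?g (F n)) \<mu>) \<longlonglongrightarrow> complex_measure_integral (?g f) \<mu>"
    proof (rule normal_functionalD(3)[OF nf, where C=C])
      show "?g (F n) \<in> borel_measurable borel" for n
        using S lim(1) by (intro borel_measurable_times) auto
      show "norm (?g (F n) x) \<le> C" for n x
        using lim(2)[of n x] order_trans[OF norm_ge_zero lim(2)] by (simp add: indicator_def)
      show "(\<lambda>n. ?g (F n) x) \<longlonglongrightarrow> ?g f x" for x
        by (intro tendsto_intros lim(3))
    qed
    then show ?case using lim(4) by (simp add: LIMSEQ_const_iff)
  qed
  moreover have "?g f x = f x" for x using f(2)[of x] by (cases "x \<in> S") (simp_all add: indicator_def)
  then have "?g f = f" by (rule ext)
  ultimately show ?thesis by simp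
qed

text \<open>A Radon measure lives on countably many compact sets up to a null set, compact sets of a
  metric space are separable, and countably many countable sets have a countable union.\<close>

lemma (in complete_metric_topology) common_separable_support:
  fixes \<kappa> :: "'i::countable \<Rightarrow> 'e set \<Rightarrow> complex"
  assumes \<kappa>: "\<And>i. \<kappa> i \<in> radon_measures"
  shows "\<exists>D. countable D \<and> D \<noteq> {} \<and> (\<forall>i. \<forall>B\<in>sets borel. B \<inter> closure D = {} \<longrightarrow> \<kappa> i B = 0)"
proof -
  have "\<exists>K. compact K \<and> (\<forall>B\<in>sets borel. B \<subseteq> UNIV - K \<longrightarrow> norm (\<kappa> i B) \<le> 1 / real (Suc n))" for i n
    using \<kappa>[of i] radon_measure_iff[OF radon_complex_measure[OF \<kappa>], of i, THEN iffD1,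
        rule_format, of UNIV "1 / real (Suc n)"] by auto
  then obtain K where K: "\<And>i n. compact (K i n)"
    "\<And>i n. \<forall>B\<in>sets borel. B \<subseteq> UNIV - K i n \<longrightarrow> norm (\<kappa> i B) \<le> 1 / real (Suc n)"
    by metis
  have "\<exists>F. F \<subseteq> K i n \<and> finite F \<and> K i n \<subseteq> (\<Union>x\<in>F. mball x (1 / real (Suc k)))" for i n k
  proof (rule compactE_image[OF K(1)[of i n], of "K i n" "\<lambda>x. mball x (1 / real (Suc k))"])
    show "open (mball x (1 / real (Suc k)))" for x by (rule open_mball)
    show "K i n \<subseteq> (\<Union>x\<in>K i n. mball x (1 / real (Suc k)))" by auto
  qed blast
  then obtain F where F: "\<And>i n k. finite (F i n k)"
    "\<And>i n k. K i n \<subseteq> (\<Union>x\<in>F i n k. mball x (1 / real (Suc k)))" by metis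
  \<comment> \<open>The extra point only ensures that D is nonempty.\<close>
  define D where "D = insert undefined (\<Union>i n k. F i n k)"
  have KD: "K i n \<subseteq> closure D" for i n
  proof (rule subsetI, rule ccontr)
    fix y assume "y \<in> K i n" "y \<notin> closure D"
    then obtain r where r: "r > 0" "mball y r \<subseteq> - closure D"
      using open_iff_mball[of "- closure D"] by auto
    obtain k where "inverse (real (Suc k)) < r" using reals_Archimedean[OF r(1)] by blast
    then have k: "1 / real (Suc k) < r" by (simp add: inverse_eq_divide)
    obtain x where x: "x \<in> F i n k" "d x y < 1 / real (Suc k)"
      using F(2)[of i n k] \<open>y \<in> K i n\<close> by auto
    then have "d y x < r" using k commute[of x y] by linarith
    then have "x \<in> mball y r" by simp
    moreover have "x \<in> D" using x(1) unfolding D_def by blast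
    then have "x \<in> closure D" using closure_subset by blast
    ultimately show False using r(2) by blast
  qed
  have "\<kappa> i B = 0" if B: "B \<in> sets borel" "B \<inter> closure D = {}" for i B
  proof -
    have "norm (\<kappa> i B) \<le> 1 / real (Suc n)" for n
      using K(2)[of i n] KD[of i n] B by blast
    then have "norm (\<kappa> i B) \<le> 0"
      using LIMSEQ_inverse_real_of_nat by (intro LIMSEQ_le_const) (auto simp: inverse_eq_divide)
    then show ?thesis by simp
  qed
  moreover have "countable D"
    unfolding D_def
    by (intro countable_insert countable_UN countable_finite[OF F(1)] countableI_type)
  ultimately show ?thesis by (intro exI[of _ D]) (auto simp: D_def)
qed

locale metric_Cb_semigroup = complete_metric_topology d + Cb_semigroup T
  for d :: "'e::t2_space \<Rightarrow> 'e \<Rightarrow> real"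
    and T :: "real \<Rightarrow> ('e \<Rightarrow>\<^sub>C complex) \<Rightarrow> ('e \<Rightarrow>\<^sub>C complex)"
begin

section \<open>Weighted integrals of the whole semigroup\<close>

context
  fixes w :: "real \<Rightarrow> complex" and v :: "real \<Rightarrow> real"
  assumes w: "w \<in> borel_measurable lborel" "\<And>t. t < 0 \<Longrightarrow> w t = 0"
    and v: "integrable lborel v" "\<And>t. v t \<ge> 0" "\<And>t f. norm (w t) * norm (T t f) \<le> v t * norm f"
begin

lemma weight_context:
  "integrable lborel (\<lambda>t. v t * norm f)" "norm (w t) * norm (T t f) \<le> v t * norm f"
  using v by auto

text \<open>
  The adjoint sends \<open>\<mu>\<close> to the mixture of the measures \<open>T(t)'\<mu>\<close> with weight \<open>w\<close>. It is Radon because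
  all \<open>T(t)'\<mu>\<close> live on one separable closed set: those with rational \<open>t\<close> do, and \<open>T(t)'\<mu>\<close> is the
  weak limit of them from the right.
\<close>

lemma weighted_adjoint:
  assumes \<mu>: "\<mu> \<in> radon_measures"
  shows "\<exists>\<nu>\<in>radon_measures. \<forall>f. Cb_pairing f \<nu> = (LINT t|lborel. w t * Cb_pairing (T t f) \<mu>)"
proof -
  \<comment> \<open>For negative t, \<mu> itself serves as a dummy, since the weight vanishes
    there.\<close>
  have "\<forall>t. \<exists>\<nu>. \<nu> \<in> radon_measures \<and> (t \<ge> 0 \<longrightarrow> (\<forall>f. Cb_pairing (T t f) \<mu> = Cb_pairing f \<nu>))"
    using weak_operator_adjoint[OF operator \<mu>] \<mu> by (metis not_le)
  then obtain \<kappa> where \<kappa>: "\<And>t. \<kappa> t \<in> radon_measures"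
    "\<And>t f. t \<ge> 0 \<Longrightarrow> Cb_pairing (T t f) \<mu> = Cb_pairing f (\<kappa> t)" by metis
  note \<kappa>_nf = normal_functional_integral[OF radon_complex_measure[OF \<kappa>(1)]]
  \<comment> \<open>With the weight built in, L t is known on continuous functions for every real t,
    including negative times.\<close>
  define L where "L t g = w t * complex_measure_integral g (\<kappa> t)" for t g
  have L: "normal_functional (L t)" for t
    unfolding normal_functional_def L_def
    by (auto simp: algebra_simps \<kappa>_nf[THEN normal_functionalD(1)] \<kappa>_nf[THEN normal_functionalD(2)]
        intro!: tendsto_intros \<kappa>_nf[THEN normal_functionalD(3)])
  have L_Cb: "L t (apply_bcontfun f) = w t * Cb_pairing (T t f) \<mu>" for t f
    using w(2)[of t] \<kappa>(2)[of t f] by (cases "t < 0") (auto simp: L_def Cb_pairing_def)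
  have L_m: "(\<lambda>t. L t g) \<in> borel_measurable lborel" if "g \<in> bounded_borel" for g
  proof (rule functional_measurable[OF L _ that])
    show "(\<lambda>t. L t (apply_bcontfun f)) \<in> borel_measurable lborel" for f
      unfolding L_Cb by (rule borel_measurable_integrable[OF integrable_orbit[OF w weight_context \<mu>]])
  qed
  obtain K where K: "K \<ge> 0" "\<And>f. norm (Cb_pairing f \<mu>) \<le> K * norm f"
    using Cb_pairing_bounded[OF \<mu>] by blast
  \<comment> \<open>The mixture needs a dominating bound on all bounded Borel functions, not only on
    continuous ones. It is obtained through the measure of L t, at the cost of the factor 4.\<close>
  have L_bound: "norm (L t g) \<le> 4 * (K * v t) * C"
    if g: "g \<in> borel_measurable borel" "\<And>x. norm (g x) \<le> C" for t g C
  proof -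
    let ?\<mu> = "functional_measure (L t)"
    note cb = measure_functional[OF L, of t]
    have "norm (?\<mu> A) \<le> K * v t" if "A \<in> sets borel" for A
    proof (rule norm_measure_le_of_unit_ball[OF cb that])
      fix f :: "'e \<Rightarrow>\<^sub>C complex" assume f: "norm f \<le> 1"
      have "norm (complex_measure_integral (apply_bcontfun f) ?\<mu>) = norm (w t) * norm (Cb_pairing (T t f) \<mu>)"
        by (simp add: integral_functional_measure[OF L bcontfun_bounded_borel]
            L_Cb norm_mult)
      also have "\<dots> \<le> norm (w t) * (K * norm (T t f))" by (intro mult_left_mono K(2)) simp
      also have "\<dots> = K * (norm (w t) * norm (T t f))" by simp
      also have "\<dots> \<le> K * (v t * norm f)" by (intro mult_left_mono K(1) v(3))
      also have "\<dots> \<le> K * (v t * 1)" using f by (intro mult_left_mono K(1) v(2))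
      finally show "norm (complex_measure_integral (apply_bcontfun f) ?\<mu>) \<le> K * v t" by simp
    qed
    from norm_integral_le[OF cb this g] show ?thesis
      by (simp only: integral_functional_measure[OF L bounded_borelI[OF g]])
  qed
  have L_int: "integrable lborel (\<lambda>t. L t g)" if g: "g \<in> bounded_borel" for g
  proof -
    obtain C where C: "\<forall>x. norm (g x) \<le> C" using bounded_borelD(2)[OF g] ..
    show ?thesis
    proof (rule Bochner_Integration.integrable_bound[OF _ L_m[OF g]])
      show "integrable lborel (\<lambda>t. 4 * (K * v t) * C)" using v(1) by simp
      show "AE t in lborel. norm (L t g) \<le> norm (4 * (K * v t) * C)"
        using L_bound[OF bounded_borelD(1)[OF g]] C
        by (intro AE_I2) (metis abs_ge_self order_trans real_norm_def)
    qed
  qed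
  define \<Lambda> where "\<Lambda> g = (LINT t|lborel. L t g)" for g
  have \<Lambda>: "normal_functional \<Lambda>"
    unfolding normal_functional_def
  proof (intro conjI ballI allI impI)
    show "\<Lambda> (\<lambda>x. f x + g x) = \<Lambda> f + \<Lambda> g" if "f \<in> bounded_borel" "g \<in> bounded_borel" for f g
      using that by (simp add: \<Lambda>_def normal_functionalD(1)[OF L] L_int)
    show "\<Lambda> (\<lambda>x. c * f x) = c * \<Lambda> f" if "f \<in> bounded_borel" for f c
      using that by (simp add: \<Lambda>_def normal_functionalD(2)[OF L])
    fix F :: "nat \<Rightarrow> 'e \<Rightarrow> complex" and f C
    assume F: "\<forall>n. F n \<in> borel_measurable borel" "\<forall>n x. norm (F n x) \<le> C" "\<forall>x. (\<lambda>n. F n x) \<longlonglongrightarrow> f x"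
    have Fb: "F n \<in> bounded_borel" for n using F by (intro bounded_borelI[of _ C]) auto
    have lim: "(\<lambda>n. L t (F n)) \<longlonglongrightarrow> L t f" for t
      using F by (intro normal_functionalD(3)[OF L, where C=C]) auto
    show "(\<lambda>n. \<Lambda> (F n)) \<longlonglongrightarrow> \<Lambda> f"
      unfolding \<Lambda>_def
    proof (rule integral_dominated_convergence[where w="\<lambda>t. 4 * (K * v t) * C"])
      show "(\<lambda>t. L t f) \<in> borel_measurable lborel"
        by (rule borel_measurable_LIMSEQ_metric[OF L_m[OF Fb] lim])
      show "integrable lborel (\<lambda>t. 4 * (K * v t) * C)" using v(1) by simp
      show "AE t in lborel. norm (L t (F n)) \<le> 4 * (K * v t) * C" for n
        using L_bound F by (intro AE_I2) auto
    qed (use lim L_m[OF Fb] in auto)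
  qed
  note cb = measure_functional[OF \<Lambda>]
  have "\<exists>D. countable D \<and> D \<noteq> {} \<and>
      (\<forall>q :: rat. \<forall>B\<in>sets borel. B \<inter> closure D = {} \<longrightarrow> \<kappa> (of_rat q) B = 0)"
    by (rule common_separable_support[OF \<kappa>(1)])
  then obtain D where D: "countable D" "D \<noteq> {}"
    "\<And>q B. B \<in> sets borel \<Longrightarrow> B \<inter> closure D = {} \<Longrightarrow> \<kappa> (of_rat q) B = 0" by blast
  have "\<Lambda> (apply_bcontfun f) = 0" if f: "\<And>x. x \<in> closure D \<Longrightarrow> apply_bcontfun f x = 0" for f
  proof -
    have "Cb_pairing (T t f) \<mu> = 0" if "t \<ge> 0" for t
    proof -
      obtain r :: "nat \<Rightarrow> rat" where r: "\<And>n. r n \<ge> 0"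
        "filterlim (\<lambda>n. of_rat (r n)) (at_right t) sequentially"
        using rationals_from_right[OF \<open>t \<ge> 0\<close>] by blast
      have "Cb_pairing f (\<kappa> (of_rat (r n))) = 0" for n
        unfolding Cb_pairing_def
        by (rule integral_complex_eq_0[OF radon_complex_measure[OF \<kappa>(1)], of "closure D"])
          (auto intro: D(3) f bcontfun_bounded_borel)
      then have "Cb_pairing (T (of_rat (r n)) f) \<mu> = 0" for n using \<kappa>(2) r(1) by simp
      with filterlim_compose[OF weakly_right_continuous[OF \<mu> \<open>t \<ge> 0\<close>] r(2), of f]
      show ?thesis by (simp add: LIMSEQ_const_iff)
    qed
    then have "L t (apply_bcontfun f) = 0" for t
      using w(2)[of t] by (cases "t < 0") (auto simp: L_Cb)
    then show ?thesis by (simp add: \<Lambda>_def)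
  qed
  then have "functional_measure \<Lambda> B = 0" if "B \<in> sets borel" "B \<inter> closure D = {}" for B
    using that by (intro functional_measure_eq_0[OF \<Lambda> closed_closure]) auto
  then have "functional_measure \<Lambda> \<in> radon_measures"
    by (rule radon_of_separable_support[OF cb D(1,2)])
  moreover have "Cb_pairing f (functional_measure \<Lambda>) = (LINT t|lborel. w t * Cb_pairing (T t f) \<mu>)" for f
    unfolding Cb_pairing_def[of f]
    by (simp add: integral_functional_measure[OF \<Lambda> bcontfun_bounded_borel])
      (simp add: \<Lambda>_def L_Cb)
  ultimately show ?thesis by blast
qed

text \<open>In a metric space a discontinuity is witnessed by a sequence of points at distance less
  than 1 / (n + 1), so \<open>orbit_integral_tendsto\<close> suffices.\<close>

lemma orbit_integral_continuous: "continuous_on UNIV (orbit_integral f w)"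
proof -
  have "(orbit_integral f w \<longlongrightarrow> orbit_integral f w x) (at x)" for x
  proof (rule tendstoI, rule ccontr)
    fix e :: real assume "e > 0"
    assume not: "\<not> (\<forall>\<^sub>F y in at x. dist (orbit_integral f w y) (orbit_integral f w x) < e)"
    have "\<exists>y. d x y < 1 / real (Suc n) \<and> dist (orbit_integral f w y) (orbit_integral f w x) \<ge> e" for n
    proof (rule ccontr)
      assume "\<nexists>y. d x y < 1 / real (Suc n) \<and> dist (orbit_integral f w y) (orbit_integral f w x) \<ge> e"
      then have "\<forall>y\<in>mball x (1 / real (Suc n)). y \<noteq> x \<longrightarrow> y \<in> UNIV \<longrightarrow>
          dist (orbit_integral f w y) (orbit_integral f w x) < e"
        by (auto simp: not_le simp del: of_nat_Suc)
      then have "\<forall>\<^sub>F y in at x. dist (orbit_integral f w y) (orbit_integral f w x) < e"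
        unfolding eventually_at_topological
        by (intro exI[of _ "mball x (1 / real (Suc n))"]) (simp add: open_mball)
      with not show False ..
    qed
    then obtain y where y: "\<And>n. d x (y n) < 1 / real (Suc n)"
      "\<And>n. dist (orbit_integral f w (y n)) (orbit_integral f w x) \<ge> e" by metis
    have "(\<lambda>n. orbit_integral f w (y n)) \<longlonglongrightarrow> orbit_integral f w x"
    proof (rule orbit_integral_tendsto[OF w weight_context])
      fix t
      have "isCont (apply_bcontfun (T t f)) x"
        using continuous_on_eq_continuous_at[of UNIV "apply_bcontfun (T t f)"]
          continuous_on_apply_bcontfun[of UNIV "T t f"] by auto
      then show "(\<lambda>n. apply_bcontfun (T t f) (y n)) \<longlonglongrightarrow> apply_bcontfun (T t f) x"
        by (rule isCont_tendsto_compose) (rule tendsto_of_mdist[OF y(1)])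
    qed
    then have "\<forall>\<^sub>F n in sequentially. dist (orbit_integral f w (y n)) (orbit_integral f w x) < e"
      using \<open>e > 0\<close> by (rule tendstoD)
    then obtain n where "dist (orbit_integral f w (y n)) (orbit_integral f w x) < e"
      by (auto simp: eventually_sequentially)
    then show False using y(2)[of n] by simp
  qed
  then show ?thesis by (simp add: continuous_on_def)
qed

text \<open>The operator sends f to its orbit integral; \<open>weighted_adjoint\<close> supplies the
  adjoint measures that \<open>weak_operatorI\<close> asks for.\<close>

lemma ex_weighted_operator:
  "\<exists>R\<in>Cb_operators. \<forall>f. \<forall>\<mu>\<in>radon_measures. Cb_pairing (R f) \<mu> = (LINT t|lborel. w t * Cb_pairing (T t f) \<mu>)"
proof -
  define R where "R f = Bcontfun (orbit_integral f w)" for f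
  have R: "apply_bcontfun (R f) = orbit_integral f w" for f
  proof -
    have "orbit_integral f w \<in> bcontfun"
      using orbit_integral_continuous norm_orbit_integral_le[OF w weight_context]
      by (auto simp: bcontfun_def bounded_iff)
    then show ?thesis unfolding R_def by (rule Bcontfun_inverse)
  qed
  have pair: "Cb_pairing (R f) \<mu> = (LINT t|lborel. w t * Cb_pairing (T t f) \<mu>)"
    if "\<mu> \<in> radon_measures" for f \<mu>
    unfolding Cb_pairing_def[of "R f"] R
    by (rule integral_orbit_integral[OF w weight_context that])
  have int: "integrable lborel (\<lambda>t. w t * apply_bcontfun (T t f) x)" for f x
  proof -
    obtain \<rho> where \<rho>: "\<rho> \<in> radon_measures" "\<forall>f\<in>bounded_borel. complex_measure_integral f \<rho> = f x"
      using radon_dirac[of x] by blast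
    show ?thesis
      using integrable_orbit[OF w weight_context \<rho>(1), of f] \<rho>(2)
      by (simp add: Cb_pairing_def bcontfun_bounded_borel)
  qed
  have "R \<in> Cb_operators"
  proof (rule weak_operatorI)
    have add: "w t * apply_bcontfun (T t (f + g)) x = w t * apply_bcontfun (T t f) x + w t * apply_bcontfun (T t g) x"
      for t f g x
      using w(2)[of t] linear_Cb_scale(1)[OF T_linear, of t f g]
      by (cases "t < 0") (auto simp: plus_bcontfun.rep_eq algebra_simps)
    have scale: "w t * apply_bcontfun (T t (Cb_scale c f)) x = c * (w t * apply_bcontfun (T t f) x)" for t c f x
      using w(2)[of t] linear_Cb_scale(2)[OF T_linear, of t c f] by (cases "t < 0") auto
    show "Vector_Spaces.linear Cb_scale Cb_scale R"
      unfolding Vector_Spaces.linear_iff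
    proof (intro conjI allI vector_space_Cb_scale)
      show "R (f + g) = R f + R g" for f g
        by (rule bcontfun_eqI) (simp add: R plus_bcontfun.rep_eq orbit_integral_def[OF w weight_context] add int)
      show "R (Cb_scale c f) = Cb_scale c (R f)" for c f
        by (rule bcontfun_eqI) (simp add: R orbit_integral_def[OF w weight_context] scale)
    qed
    fix \<mu> :: "'e set \<Rightarrow> complex" assume \<mu>: "\<mu> \<in> radon_measures"
    then show "\<exists>\<nu>\<in>radon_measures. \<forall>f. Cb_pairing (R f) \<mu> = Cb_pairing f \<nu>"
      using weighted_adjoint[OF \<mu>] pair[OF \<mu>] by metis
  qed
  then show ?thesis using pair by blast
qed

end

lemma integrable_exp_minus_Ici: "integrable lborel (\<lambda>t :: real. exp (- t) * indicator {0..} t)"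
proof (rule integrableI_nonneg)
  have "(\<integral>\<^sup>+t. ennreal (exp (- t)) * indicator {0..} t \<partial>lborel) = ennreal (0 - (- exp (- 0 :: real)))"
  proof (rule nn_integral_FTC_atLeast[where F="\<lambda>t. - exp (- t)"])
    show "((\<lambda>t :: real. - exp (- t)) \<longlongrightarrow> 0) at_top"
      using tendsto_minus[OF filterlim_compose[OF exp_at_bot filterlim_uminus_at_bot_at_top]] by simp
  qed (auto intro!: derivative_eq_intros)
  then show "(\<integral>\<^sup>+t. ennreal (exp (- t) * indicator {0..} t) \<partial>lborel) < \<infinity>"
    by (simp add: ennreal_mult ennreal_indicator)
qed auto

theorem integrable: "integrable_semigroup Cb_scale radon_measures Cb_pairing T"
proof -
  obtain M \<omega> where M: "M \<ge> 1" "\<And>t f. t \<ge> 0 \<Longrightarrow> norm (T t f) \<le> M * exp (\<omega> * t) * norm f"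
    using exponentially_bounded by blast
  \<comment> \<open>Exceeding \<omega> by 1 leaves the weighted orbit dominated by M * exp (- t)
    times norm f.\<close>
  define z where "z = complex_of_real (\<omega> + 1)"
  define w where "w t = indicator {0..} t *\<^sub>R exp (- z * complex_of_real t)" for t
  define v where "v t = M * (exp (- t) * indicator {0..} t)" for t :: real
  have wm: "w \<in> borel_measurable lborel"
    unfolding w_def by (intro borel_measurable_scaleR borel_measurable_continuous_onI borel_measurable_indicator)
      (auto intro!: continuous_intros)
  have w0: "w t = 0" if "t < 0" for t using that by (simp add: w_def)
  have vi: "integrable lborel v"
    unfolding v_def by (intro integrable_mult_right integrable_exp_minus_Ici)
  have v0: "v t \<ge> 0" for t using M(1) by (simp add: v_def)
  have wv: "norm (w t) * norm (T t f) \<le> v t * norm f" for t f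
  proof (cases "t \<ge> 0")
    case True
    have "norm (w t) = exp (- ((\<omega> + 1) * t))" using True by (simp add: w_def z_def algebra_simps)
    then have "norm (w t) * norm (T t f) \<le> exp (- ((\<omega> + 1) * t)) * (M * exp (\<omega> * t) * norm f)"
      using M(2)[OF True, of f] by (simp add: mult_left_mono)
    also have "\<dots> = M * (exp (- ((\<omega> + 1) * t)) * exp (\<omega> * t)) * norm f" by (simp add: mult_ac)
    also have "exp (- ((\<omega> + 1) * t)) * exp (\<omega> * t) = exp (- t)"
      by (simp add: algebra_simps flip: exp_add)
    finally show ?thesis using True by (simp add: v_def)
  qed (simp add: w0 v_def)
  note ctx = wm w0 vi v0 wv
  obtain R where R: "R \<in> Cb_operators"
    "\<And>f \<mu>. \<mu> \<in> radon_measures \<Longrightarrow> Cb_pairing (R f) \<mu> = (LINT t|lborel. w t * Cb_pairing (T t f) \<mu>)"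
    using ex_weighted_operator[OF ctx] by blast
  have "semigroup_type M \<omega> T"
    unfolding semigroup_type_def using M T_bounded_linear by (auto intro!: onorm_bound)
  moreover have "(\<lambda>t. Cb_pairing (T t f) \<mu>) \<in> borel_measurable (restrict_space borel {0..})"
    if \<mu>: "\<mu> \<in> radon_measures" for f \<mu>
  proof -
    have "(\<lambda>t. w t * Cb_pairing (T t f) \<mu>) \<in> borel_measurable lborel"
      by (rule borel_measurable_integrable[OF integrable_orbit[OF wm w0 weight_context[OF ctx] \<mu>]])
    then have "(\<lambda>t. w t * Cb_pairing (T t f) \<mu>) \<in> borel_measurable borel" by simp
    \<comment> \<open>Only the weighted orbit is known to be measurable so far; multiplication by
      this exponential undoes the weight on [0, infinity).\<close>
    moreover have "(\<lambda>t. exp (z * complex_of_real t)) \<in> borel_measurable borel"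
      by (intro borel_measurable_continuous_onI continuous_intros)
    ultimately have "(\<lambda>t. exp (z * complex_of_real t) * (w t * Cb_pairing (T t f) \<mu>)) \<in> borel_measurable borel"
      by (rule borel_measurable_times[rotated])
    moreover have "exp (z * complex_of_real t) * (w t * Cb_pairing (T t f) \<mu>) = indicator {0..} t *\<^sub>R Cb_pairing (T t f) \<mu>" for t
    proof -
      have "exp (z * complex_of_real t) * exp (- z * complex_of_real t) = 1"
        by (simp flip: exp_add)
      then show ?thesis by (simp add: w_def indicator_def mult.assoc[symmetric])
    qed
    ultimately show ?thesis by (simp add: borel_measurable_restrict_space_iff)
  qed
  moreover have "Cb_pairing (R f) \<mu> = (LINT t:{0..}|lborel. exp (- z * complex_of_real t) * Cb_pairing (T t f) \<mu>)"
    if "\<mu> \<in> radon_measures" for f \<mu>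
    unfolding R(2)[OF that] set_lebesgue_integral_def by (simp add: w_def)
  moreover have "Re z > \<omega>" by (simp add: z_def)
  ultimately show ?thesis
    unfolding integrable_semigroup_def using semigroup R(1) by blast
qed

end

theorem theorem6p2:
  fixes T :: "real \<Rightarrow> ('e::t2_space \<Rightarrow>\<^sub>C complex) \<Rightarrow> ('e \<Rightarrow>\<^sub>C complex)"
  assumes "completely_regular_space (euclidean :: 'e topology)"
    and "operator_semigroup Cb_scale radon_measures Cb_pairing T"
    and "weakly_continuous_at_0 radon_measures Cb_pairing T"
  shows "(complete_linear_topology (strict_topology :: ('e \<Rightarrow>\<^sub>C complex) topology) \<longrightarrow>
            (\<forall>f. locally_Y_integrable radon_measures Cb_pairing (\<lambda>t. T t f))) \<and>
         (completely_metrizable_space (euclidean :: 'e topology) \<longrightarrow>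
            integrable_semigroup Cb_scale radon_measures Cb_pairing T)"
proof (intro conjI impI allI)
  have sg: "Cb_semigroup T" using assms(2,3) by (rule Cb_semigroup.intro)
  show "locally_Y_integrable radon_measures Cb_pairing (\<lambda>t. T t f)"
    if "complete_linear_topology (strict_topology :: ('e \<Rightarrow>\<^sub>C complex) topology)" for f
    by (rule Cb_semigroup.locally_integrable_orbit[OF sg assms(1) that])
  assume "completely_metrizable_space (euclidean :: 'e topology)"
  then obtain M d where d: "Metric_space M d" "Metric_space.mcomplete M d"
    "(euclidean :: 'e topology) = Metric_space.mtopology M d"
    unfolding completely_metrizable_space_def by blast
  \<comment> \<open>The carrier supplied by complete metrizability is the topspace of the topology,
    here the whole type.\<close>
  have "M = UNIV"
    using Metric_space.topspace_mtopology[OF d(1)] by (simp flip: d(3))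
  then have "complete_metric_topology d"
    using d by (simp add: complete_metric_topology_def complete_metric_topology_axioms_def)
  then show "integrable_semigroup Cb_scale radon_measures Cb_pairing T"
    using sg by (intro metric_Cb_semigroup.integrable metric_Cb_semigroup.intro)
qed

end
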